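(* Let $R$ be a compact complex manifold such that $H^1(R,\mathcal O_R)\neq0$. Let $$0\longrightarrow\mathcal O_R^{r_1}\longrightarrow E\longrightarrow\mathcal O_R^{r_2}\longrightarrow0$$ be a nontrivial (non-split) short exact sequence of holomorphic vector bundles. Then the tautological line bundle $\mathcal O_{\mathbb P(E)}(1)$ is not semi-positive.
   Context: $r_1,r_2$ are positive integers. $\mathbb P(E)$ is the projective bundle of rank-one quotients (hyperplanes) of the fibres of $E$, and $\mathcal O_{\mathbb P(E)}(1)$ is its tautological quotient line bundle. A holomorphic line bundle is semi-positive if it admits a $C^\infty$ Hermitian metric whose Chern curvature form is semi-positive everywhere. *)

theory Defs
  imports "HOL-Analysis.Analysis"
begin

section \<open>Several complex variables\<close>

text \<open>
  \<open>Cn n\<close> models the space of complex n-tuples; the convention is that of \<^const>\<open>Euclidean_space\<close>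
  (sequences vanishing from index \<open>n\<close> on, with the product topology), so that \<open>n\<close> is an ordinary
  natural number and spaces of different dimensions can occur in one statement.
\<close>

type_synonym cvec = "nat \<Rightarrow> complex"

definition Cn :: "nat \<Rightarrow> cvec set" where
  "Cn n = {z. \<forall>i\<ge>n. z i = 0}"

definition cunit :: "nat \<Rightarrow> cvec" where
  "cunit k = (\<lambda>i. if i = k then 1 else 0)"

text \<open>Everywhere below, \<open>\<Omega>\<close> is a relatively open subset of \<open>Cn n\<close>.\<close>

definition holo_Cn :: "nat \<Rightarrow> cvec set \<Rightarrow> (cvec \<Rightarrow> complex) \<Rightarrow> bool" where
  "holo_Cn n \<Omega> f \<longleftrightarrow>
     continuous_on \<Omega> f \<and>
     (\<forall>z\<in>\<Omega>. \<forall>j<n. (\<lambda>w. f (z(j := w))) field_differentiable (at (z j)))"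

text \<open>
  \<open>pd j d f\<close> is the real partial derivative of \<open>f\<close> in the \<open>j\<close>-th variable in the direction \<open>d\<close>:
  with \<open>z j = x + \<i> y\<close>, it is the \<open>x\<close>-derivative for \<open>d = 1\<close> and the \<open>y\<close>-derivative for \<open>d = \<i>\<close>.
\<close>

definition pd :: "nat \<Rightarrow> complex \<Rightarrow> (cvec \<Rightarrow> complex) \<Rightarrow> cvec \<Rightarrow> complex" where
  "pd j d f z = vector_derivative (\<lambda>t::real. f (z(j := z j + of_real t * d))) (at 0)"

fun Ck_Cn :: "nat \<Rightarrow> nat \<Rightarrow> cvec set \<Rightarrow> (cvec \<Rightarrow> complex) \<Rightarrow> bool" where
  "Ck_Cn 0 n \<Omega> f \<longleftrightarrow> continuous_on \<Omega> f"
| "Ck_Cn (Suc k) n \<Omega> f \<longleftrightarrow>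
     continuous_on \<Omega> f \<and>
     (\<forall>j<n. \<forall>d\<in>{1, \<i>}.
        (\<forall>z\<in>\<Omega>. (\<lambda>t::real. f (z(j := z j + of_real t * d))) differentiable (at 0)) \<and>
        Ck_Cn k n \<Omega> (pd j d f))"

definition smooth_Cn :: "nat \<Rightarrow> cvec set \<Rightarrow> (cvec \<Rightarrow> complex) \<Rightarrow> bool" where
  "smooth_Cn n \<Omega> f \<longleftrightarrow> (\<forall>k. Ck_Cn k n \<Omega> f)"

definition wirt :: "nat \<Rightarrow> (cvec \<Rightarrow> complex) \<Rightarrow> cvec \<Rightarrow> complex" where
  "wirt j f z = (pd j 1 f z - \<i> * pd j \<i> f z) / 2"

definition wirt_bar :: "nat \<Rightarrow> (cvec \<Rightarrow> complex) \<Rightarrow> cvec \<Rightarrow> complex" where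
  "wirt_bar j f z = (pd j 1 f z + \<i> * pd j \<i> f z) / 2"


section \<open>Complex manifolds\<close>

record 'a cmanifold =
  cdim :: nat
  ctop :: "'a topology"
  catlas :: "('a set \<times> ('a \<Rightarrow> cvec)) set"

definition complex_manifold :: "'a cmanifold \<Rightarrow> bool" where
  "complex_manifold M \<longleftrightarrow>
     Hausdorff_space (ctop M) \<and>
     second_countable (ctop M) \<and>
     (\<Union>(V, \<phi>)\<in>catlas M. V) = topspace (ctop M) \<and>
     (\<forall>(V, \<phi>)\<in>catlas M.
        openin (ctop M) V \<and>
        openin (top_of_set (Cn (cdim M))) (\<phi> ` V) \<and>
        homeomorphic_map (subtopology (ctop M) V) (top_of_set (\<phi> ` V)) \<phi>) \<and>
     (\<forall>(V, \<phi>)\<in>catlas M. \<forall>(V', \<phi>')\<in>catlas M. \<forall>j<cdim M.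
        holo_Cn (cdim M) (\<phi> ` (V \<inter> V')) (\<lambda>z. \<phi>' (inv_into V \<phi> z) j))"

text \<open>Holomorphic and smooth functions on an open subset \<open>W\<close> of \<open>M\<close>.\<close>

definition mfd_holo :: "'a cmanifold \<Rightarrow> 'a set \<Rightarrow> ('a \<Rightarrow> complex) \<Rightarrow> bool" where
  "mfd_holo M W f \<longleftrightarrow>
     (\<forall>(V, \<phi>)\<in>catlas M. holo_Cn (cdim M) (\<phi> ` (V \<inter> W)) (\<lambda>z. f (inv_into V \<phi> z)))"

definition mfd_smooth :: "'a cmanifold \<Rightarrow> 'a set \<Rightarrow> ('a \<Rightarrow> complex) \<Rightarrow> bool" where
  "mfd_smooth M W f \<longleftrightarrow>
     (\<forall>(V, \<phi>)\<in>catlas M. smooth_Cn (cdim M) (\<phi> ` (V \<inter> W)) (\<lambda>z. f (inv_into V \<phi> z)))"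


section \<open>First cohomology of the structure sheaf\<close>

text \<open>
  \<open>H1 M\<close> is the first Cech cohomology of the sheaf of holomorphic functions (the direct limit over
  all open covers, ordered by refinement), which is its sheaf cohomology in degree one. Covers are
  indexed by their own members; values of cochains outside the relevant intersections are
  irrelevant.
\<close>

type_synonym 'a cochain1 = "'a set \<Rightarrow> 'a set \<Rightarrow> 'a \<Rightarrow> complex"

definition open_cover :: "'a cmanifold \<Rightarrow> 'a set set \<Rightarrow> bool" where
  "open_cover M \<U> \<longleftrightarrow> (\<forall>U\<in>\<U>. openin (ctop M) U) \<and> \<Union>\<U> = topspace (ctop M)"

definition cocycle1 :: "'a cmanifold \<Rightarrow> 'a set set \<Rightarrow> 'a cochain1 \<Rightarrow> bool" where
  "cocycle1 M \<U> f \<longleftrightarrow>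
     (\<forall>U\<in>\<U>. \<forall>V\<in>\<U>. mfd_holo M (U \<inter> V) (f U V)) \<and>
     (\<forall>U\<in>\<U>. \<forall>V\<in>\<U>. \<forall>W\<in>\<U>. \<forall>x\<in>U \<inter> V \<inter> W. f U V x + f V W x = f U W x)"

definition coboundary1 :: "'a cmanifold \<Rightarrow> 'a set set \<Rightarrow> 'a cochain1 \<Rightarrow> bool" where
  "coboundary1 M \<U> f \<longleftrightarrow>
     (\<exists>g :: 'a set \<Rightarrow> 'a \<Rightarrow> complex.
        (\<forall>U\<in>\<U>. mfd_holo M U (g U)) \<and>
        (\<forall>U\<in>\<U>. \<forall>V\<in>\<U>. \<forall>x\<in>U \<inter> V. f U V x = g V x - g U x))"

definition refinement_map :: "'a set set \<Rightarrow> 'a set set \<Rightarrow> ('a set \<Rightarrow> 'a set) \<Rightarrow> bool" where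
  "refinement_map \<W> \<U> \<rho> \<longleftrightarrow> (\<forall>W\<in>\<W>. \<rho> W \<in> \<U> \<and> W \<subseteq> \<rho> W)"

definition cocycles1 :: "'a cmanifold \<Rightarrow> ('a set set \<times> 'a cochain1) set" where
  "cocycles1 M = {(\<U>, f). open_cover M \<U> \<and> cocycle1 M \<U> f}"

definition cohomologous ::
    "'a cmanifold \<Rightarrow> (('a set set \<times> 'a cochain1) \<times> ('a set set \<times> 'a cochain1)) set" where
  "cohomologous M =
     {((\<U>, f), (\<V>, g)).
        (\<U>, f) \<in> cocycles1 M \<and> (\<V>, g) \<in> cocycles1 M \<and>
        (\<exists>\<W> \<rho> \<sigma>. open_cover M \<W> \<and> refinement_map \<W> \<U> \<rho> \<and> refinement_map \<W> \<V> \<sigma> \<and>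
           coboundary1 M \<W> (\<lambda>U V x. f (\<rho> U) (\<rho> V) x - g (\<sigma> U) (\<sigma> V) x))}"

definition H1 :: "'a cmanifold \<Rightarrow> ('a set set \<times> 'a cochain1) set set" where
  "H1 M = cocycles1 M // cohomologous M"

definition H1_zero :: "'a cmanifold \<Rightarrow> ('a set set \<times> 'a cochain1) set" where
  "H1_zero M = cohomologous M `` {({topspace (ctop M)}, (\<lambda>U V x. 0))}"


section \<open>Holomorphic vector bundles\<close>

text \<open>
  A vector bundle is given by its fibres, with their vector space operations, and a family of local
  trivialisations \<open>(U, \<psi>)\<close>, where \<open>\<psi> x\<close> identifies the fibre over \<open>x \<in> U\<close> with \<open>Cn vrank\<close>.
  The total space is the disjoint union \<open>Sigma (topspace (ctop M)) (fib E)\<close>; its complex structure is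
  the one determined by the trivialisations. The vector space axioms for the fibres follow from
  the requirement that \<open>\<psi> x\<close> is bijective and preserves the operations.
\<close>

record ('x, 'v) vbundle =
  vrank :: nat
  fib :: "'x \<Rightarrow> 'v set"
  vzero :: "'x \<Rightarrow> 'v"
  vadd :: "'x \<Rightarrow> 'v \<Rightarrow> 'v \<Rightarrow> 'v"
  vscale :: "'x \<Rightarrow> complex \<Rightarrow> 'v \<Rightarrow> 'v"
  trivs :: "('x set \<times> ('x \<Rightarrow> 'v \<Rightarrow> cvec)) set"

text \<open>The local holomorphic frame defined by a trivialisation.\<close>

definition frame :: "('x, 'v) vbundle \<Rightarrow> ('x \<Rightarrow> 'v \<Rightarrow> cvec) \<Rightarrow> nat \<Rightarrow> 'x \<Rightarrow> 'v" where
  "frame E \<psi> k x = inv_into (fib E x) (\<psi> x) (cunit k)"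

definition holomorphic_vbundle :: "'x cmanifold \<Rightarrow> ('x, 'v) vbundle \<Rightarrow> bool" where
  "holomorphic_vbundle M E \<longleftrightarrow>
     (\<forall>x\<in>topspace (ctop M).
        vzero E x \<in> fib E x \<and>
        (\<forall>u\<in>fib E x. \<forall>v\<in>fib E x. vadd E x u v \<in> fib E x) \<and>
        (\<forall>c. \<forall>u\<in>fib E x. vscale E x c u \<in> fib E x)) \<and>
     (\<Union>(U, \<psi>)\<in>trivs E. U) = topspace (ctop M) \<and>
     (\<forall>(U, \<psi>)\<in>trivs E.
        openin (ctop M) U \<and>
        (\<forall>x\<in>U.
           bij_betw (\<psi> x) (fib E x) (Cn (vrank E)) \<and>
           \<psi> x (vzero E x) = (\<lambda>i. 0) \<and>
           (\<forall>u\<in>fib E x. \<forall>v\<in>fib E x. \<psi> x (vadd E x u v) = (\<lambda>i. \<psi> x u i + \<psi> x v i)) \<and>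
           (\<forall>c. \<forall>u\<in>fib E x. \<psi> x (vscale E x c u) = (\<lambda>i. c * \<psi> x u i)))) \<and>
     (\<forall>(U, \<psi>)\<in>trivs E. \<forall>(U', \<psi>')\<in>trivs E. \<forall>j<vrank E. \<forall>k<vrank E.
        mfd_holo M (U \<inter> U') (\<lambda>x. \<psi>' x (frame E \<psi> k x) j))"

definition trivial_vbundle :: "'x cmanifold \<Rightarrow> nat \<Rightarrow> ('x, cvec) vbundle" where
  "trivial_vbundle M r =
     \<lparr> vrank = r,
       fib = (\<lambda>x. Cn r),
       vzero = (\<lambda>x i. 0),
       vadd = (\<lambda>x u v i. u i + v i),
       vscale = (\<lambda>x c u i. c * u i),
       trivs = {(topspace (ctop M), \<lambda>x v. v)} \<rparr>"

definition vbundle_hom ::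
    "'x cmanifold \<Rightarrow> ('x, 'v) vbundle \<Rightarrow> ('x, 'w) vbundle \<Rightarrow> ('x \<Rightarrow> 'v \<Rightarrow> 'w) \<Rightarrow> bool" where
  "vbundle_hom M E F f \<longleftrightarrow>
     (\<forall>x\<in>topspace (ctop M).
        (\<forall>u\<in>fib E x. f x u \<in> fib F x) \<and>
        (\<forall>u\<in>fib E x. \<forall>v\<in>fib E x. f x (vadd E x u v) = vadd F x (f x u) (f x v)) \<and>
        (\<forall>c. \<forall>u\<in>fib E x. f x (vscale E x c u) = vscale F x c (f x u))) \<and>
     (\<forall>(U, \<psi>)\<in>trivs E. \<forall>(U', \<psi>')\<in>trivs F. \<forall>k<vrank E. \<forall>j<vrank F.
        mfd_holo M (U \<inter> U') (\<lambda>x. \<psi>' x (f x (frame E \<psi> k x)) j))"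

definition short_exact_sequence ::
    "'x cmanifold \<Rightarrow> ('x, 'u) vbundle \<Rightarrow> ('x \<Rightarrow> 'u \<Rightarrow> 'v) \<Rightarrow> ('x, 'v) vbundle \<Rightarrow>
     ('x \<Rightarrow> 'v \<Rightarrow> 'w) \<Rightarrow> ('x, 'w) vbundle \<Rightarrow> bool" where
  "short_exact_sequence M S \<iota> E \<pi> Q \<longleftrightarrow>
     vbundle_hom M S E \<iota> \<and> vbundle_hom M E Q \<pi> \<and>
     (\<forall>x\<in>topspace (ctop M).
        inj_on (\<iota> x) (fib S x) \<and>
        \<iota> x ` fib S x = {v \<in> fib E x. \<pi> x v = vzero Q x} \<and>
        \<pi> x ` fib E x = fib Q x)"

definition split_surjection ::
    "'x cmanifold \<Rightarrow> ('x, 'v) vbundle \<Rightarrow> ('x \<Rightarrow> 'v \<Rightarrow> 'w) \<Rightarrow> ('x, 'w) vbundle \<Rightarrow> bool" where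
  "split_surjection M E \<pi> Q \<longleftrightarrow>
     (\<exists>\<sigma>. vbundle_hom M Q E \<sigma> \<and>
        (\<forall>x\<in>topspace (ctop M). \<forall>w\<in>fib Q x. \<pi> x (\<sigma> x w) = w))"


section \<open>Semi-positive line bundles\<close>

text \<open>Hermitian forms are linear in the first and conjugate linear in the second argument.\<close>

definition hermitian_metric ::
    "'x cmanifold \<Rightarrow> ('x, 'v) vbundle \<Rightarrow> ('x \<Rightarrow> 'v \<Rightarrow> 'v \<Rightarrow> complex) \<Rightarrow> bool" where
  "hermitian_metric M E h \<longleftrightarrow>
     (\<forall>x\<in>topspace (ctop M).
        (\<forall>u\<in>fib E x. \<forall>v\<in>fib E x. \<forall>w\<in>fib E x. h x (vadd E x u v) w = h x u w + h x v w) \<and>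
        (\<forall>c. \<forall>u\<in>fib E x. \<forall>w\<in>fib E x. h x (vscale E x c u) w = c * h x u w) \<and>
        (\<forall>u\<in>fib E x. \<forall>w\<in>fib E x. h x w u = cnj (h x u w)) \<and>
        (\<forall>u\<in>fib E x. u \<noteq> vzero E x \<longrightarrow> Re (h x u u) > 0)) \<and>
     (\<forall>(U, \<psi>)\<in>trivs E. \<forall>j<vrank E. \<forall>k<vrank E.
        mfd_smooth M U (\<lambda>x. h x (frame E \<psi> j x) (frame E \<psi> k x)))"

text \<open>
  For a line bundle with local holomorphic frame \<open>e\<close>, the Chern connection form is
  \<open>\<partial> log h(e,e)\<close>, so the Chern curvature form is \<open>- \<partial> \<partial>\<^bsub>bar\<^esub> log h(e,e)\<close>. The function
  below is its coefficient at \<open>dz\<^sub>j \<and> d(cnj z\<^sub>k)\<close> in the chart \<open>(V, \<phi>)\<close>.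
\<close>

definition chern_curvature ::
    "('x, 'v) vbundle \<Rightarrow> ('x \<Rightarrow> 'v \<Rightarrow> 'v \<Rightarrow> complex) \<Rightarrow> ('x \<Rightarrow> 'v \<Rightarrow> cvec) \<Rightarrow>
     'x set \<Rightarrow> ('x \<Rightarrow> cvec) \<Rightarrow> nat \<Rightarrow> nat \<Rightarrow> cvec \<Rightarrow> complex" where
  "chern_curvature L h \<psi> V \<phi> j k =
     wirt j (wirt_bar k
       (\<lambda>z. let x = inv_into V \<phi> z; e = frame L \<psi> 0 x in of_real (- ln (Re (h x e e)))))"

text \<open>
  Semi-positivity of the (1,1)-form \<open>\<i> \<Theta>\<close> means that the Hermitian matrix of the coefficients of
  \<open>\<Theta>\<close> is positive semidefinite at every point; the quadratic form below is automatically
  real-valued.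
\<close>

definition semi_positive :: "'x cmanifold \<Rightarrow> ('x, 'v) vbundle \<Rightarrow> bool" where
  "semi_positive M L \<longleftrightarrow>
     (\<exists>h. hermitian_metric M L h \<and>
        (\<forall>(U, \<psi>)\<in>trivs L. \<forall>(V, \<phi>)\<in>catlas M. \<forall>z\<in>\<phi> ` (V \<inter> U). \<forall>\<xi> :: nat \<Rightarrow> complex.
           0 \<le> Re (\<Sum>j<cdim M. \<Sum>k<cdim M.
                     chern_curvature L h \<psi> V \<phi> j k z * \<xi> j * cnj (\<xi> k))))"


section \<open>The projective bundle and its tautological quotient line bundle\<close>

definition hyperplane :: "('x, 'v) vbundle \<Rightarrow> 'x \<Rightarrow> 'v set \<Rightarrow> bool" where
  "hyperplane E x H \<longleftrightarrow>
     H \<subseteq> fib E x \<and> vzero E x \<in> H \<and>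
     (\<forall>u\<in>H. \<forall>v\<in>H. vadd E x u v \<in> H) \<and>
     (\<forall>c. \<forall>u\<in>H. vscale E x c u \<in> H) \<and>
     (\<exists>e\<in>fib E x - H. \<forall>v\<in>fib E x. \<exists>c. \<exists>w\<in>H. v = vadd E x (vscale E x c e) w)"

text \<open>
  Points of the projective bundle are pairs \<open>(x, H)\<close> with \<open>H\<close> a hyperplane in the fibre over \<open>x\<close>,
  that is, one-dimensional quotients \<open>E\<^sub>x / H\<close>. A frame \<open>e\<^sub>0, \<dots>, e\<^bsub>r-1\<^esub>\<close> of \<open>E\<close> over
  \<open>U\<close> and an index \<open>k\<close> give the affine piece of those \<open>(x, H)\<close> for which \<open>e\<^sub>k\<close> is nonzero in the quotient.
\<close>

definition proj_piece ::
    "('x, 'v) vbundle \<Rightarrow> 'x set \<Rightarrow> ('x \<Rightarrow> 'v \<Rightarrow> cvec) \<Rightarrow> nat \<Rightarrow> ('x \<times> 'v set) set" where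
  "proj_piece E U \<psi> k = {(x, H). x \<in> U \<and> hyperplane E x H \<and> frame E \<psi> k x \<notin> H}"

text \<open>The affine coordinate \<open>c\<close> with \<open>e\<^sub>j = c e\<^sub>k\<close> in the quotient by \<open>H\<close>.\<close>

definition affine_coord ::
    "('x, 'v) vbundle \<Rightarrow> ('x \<Rightarrow> 'v \<Rightarrow> cvec) \<Rightarrow> nat \<Rightarrow> 'x \<Rightarrow> 'v set \<Rightarrow> nat \<Rightarrow> complex" where
  "affine_coord E \<psi> k x H j =
     (THE c. vadd E x (frame E \<psi> j x) (vscale E x (- c) (frame E \<psi> k x)) \<in> H)"

text \<open>
  The base coordinates come first, followed by the affine coordinates with the index \<open>j = k\<close> (where the
  value is 1) left out.
\<close>

definition proj_chart ::
    "'x cmanifold \<Rightarrow> ('x, 'v) vbundle \<Rightarrow> ('x \<Rightarrow> cvec) \<Rightarrow> ('x \<Rightarrow> 'v \<Rightarrow> cvec) \<Rightarrow> nat \<Rightarrow>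
     'x \<times> 'v set \<Rightarrow> cvec" where
  "proj_chart M E \<phi> \<psi> k = (\<lambda>(x, H) i.
     if i < cdim M then \<phi> x i
     else if i < cdim M + (vrank E - 1) then
       (let j = i - cdim M in affine_coord E \<psi> k x H (if j < k then j else j + 1))
     else 0)"

definition proj_atlas ::
    "'x cmanifold \<Rightarrow> ('x, 'v) vbundle \<Rightarrow> (('x \<times> 'v set) set \<times> ('x \<times> 'v set \<Rightarrow> cvec)) set" where
  "proj_atlas M E =
     {(proj_piece E (V \<inter> U) \<psi> k, proj_chart M E \<phi> \<psi> k) | V \<phi> U \<psi> k.
        (V, \<phi>) \<in> catlas M \<and> (U, \<psi>) \<in> trivs E \<and> k < vrank E}"

definition proj_bundle :: "'x cmanifold \<Rightarrow> ('x, 'v) vbundle \<Rightarrow> ('x \<times> 'v set) cmanifold" where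
  "proj_bundle M E =
     \<lparr> cdim = cdim M + (vrank E - 1),
       ctop = topology_generated_by
         {P \<inter> \<theta> -` \<Omega> | P \<theta> \<Omega>. (P, \<theta>) \<in> proj_atlas M E \<and>
            openin (top_of_set (Cn (cdim M + (vrank E - 1)))) \<Omega>},
       catlas = proj_atlas M E \<rparr>"

text \<open>
  The fibre over \<open>(x, H)\<close> is the quotient space of cosets of \<open>H\<close> in \<open>E\<^sub>x\<close>. The elements of \<open>H\<close> are
  added in the scalar multiplication so that multiplication by 0 yields the coset \<open>H\<close>.
  Over the affine piece belonging to \<open>k\<close>, the class of \<open>e\<^sub>k\<close> is the frame.
\<close>

definition taut_line_bundle :: "('x, 'v) vbundle \<Rightarrow> ('x \<times> 'v set, 'v set) vbundle" where
  "taut_line_bundle E =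
     \<lparr> vrank = 1,
       fib = (\<lambda>(x, H). {vadd E x v ` H | v. v \<in> fib E x}),
       vzero = (\<lambda>(x, H). H),
       vadd = (\<lambda>(x, H) A B. {vadd E x a b | a b. a \<in> A \<and> b \<in> B}),
       vscale = (\<lambda>(x, H) c A. {vadd E x (vscale E x c a) w | a w. a \<in> A \<and> w \<in> H}),
       trivs = {(proj_piece E U \<psi> k,
                 \<lambda>(x, H) A i. if i = 0 then (THE c. vscale E x c (frame E \<psi> k x) \<in> A) else 0)
               | U \<psi> k. (U, \<psi>) \<in> trivs E \<and> k < vrank E} \<rparr>"

end

theory Submission
  imports Defs "HOL-Complex_Analysis.Complex_Analysis" "HOL-Library.Function_Algebras"
begin

text \<open>
  A point of the projective bundle is a nonzero functional \<open>\<xi>\<close> on a fibre \<open>E\<^sub>x\<close>, up to scaling.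
  A semi-positive metric on the tautological line bundle becomes a function \<open>u(x, \<xi>)\<close> with
  \<open>u(x, c \<xi>) = u(x, \<xi>) + log |c|\<^sup>2\<close> whose Levi form is positive semidefinite. Every \<open>\<lambda> \<noteq> 0\<close> on the
  trivial quotient gives a section \<open>x \<mapsto> \<lambda> \<circ> \<pi>\<^sub>x\<close> along which \<open>u\<close> is plurisubharmonic, hence constant
  on the connected components of the compact manifold \<open>R\<close>. So the Levi form vanishes in the
  directions tangent to this section, and by Cauchy-Schwarz these directions lie in its kernel:
  the fibre derivatives of \<open>u\<close> are holomorphic along the section. In other words, the fibrewise
  gradient of \<open>u\<close> at \<open>\<lambda> \<circ> \<pi>\<^sub>x\<close>, which is a vector of \<open>E\<^sub>x\<close>, is a holomorphic section of \<open>E\<close>. Its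
  image \<open>w\<^sub>\<lambda>\<close> in the trivial quotient is constant on components, and \<open>\<lambda>(w\<^sub>\<lambda>) = 1\<close> by homogeneity
  (Euler's relation). Hence no nonzero \<open>\<lambda>\<close> annihilates all the vectors \<open>w\<^sub>\<lambda>\<close>; they span the
  quotient and the gradients provide a holomorphic splitting.
\<close>

section \<open>Calculus on \<open>Cn n\<close>\<close>

text \<open>Two features shape the proof. The vectors w_\<lambda> need not depend linearly on
  \<lambda>, so the gradients are not themselves a linear lift. What is linear is the set of all
  values in the quotient that lift to holomorphic sections; it contains every w_\<lambda>, and a
  separating functional compares it with the whole quotient. Second, holomorphy here means
  continuity together with holomorphy in each variable, and smoothness means iterated continuous
  partial derivatives. Everything is therefore tested on coordinate discs of charts: a maximum
  principle for functions that are subharmonic in each variable separately suffices, and the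
  Cauchy-Riemann equation is read off one variable at a time. The price is that the chain rule and
  the symmetry of second derivatives have to be derived from partial derivatives. Since
  \<open>R\<close> may be disconnected, constancy holds on each component, and lifts chosen on the
  components are pasted; this keeps holomorphy because components are open.\<close>

definition polydisc :: "nat \<Rightarrow> cvec \<Rightarrow> real \<Rightarrow> cvec set" where
  "polydisc n z \<delta> = {w \<in> Cn n. \<forall>i<n. dist (w i) (z i) < \<delta>}"

abbreviation Cn_open :: "nat \<Rightarrow> cvec set \<Rightarrow> bool" where
  "Cn_open n \<Omega> \<equiv> openin (top_of_set (Cn n)) \<Omega>"

lemma Cn_openD: "Cn_open n \<Omega> \<Longrightarrow> z \<in> \<Omega> \<Longrightarrow> z \<in> Cn n"
  using openin_subset by fastforce

lemma centre_in_polydisc: "z \<in> Cn n \<Longrightarrow> 0 < \<delta> \<Longrightarrow> z \<in> polydisc n z \<delta>"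
  by (simp add: polydisc_def)

lemma Cn_open_polydisc: "Cn_open n (polydisc n z \<delta>)"
proof -
  have "open {w. \<forall>i\<in>{..<n}. w (id i) \<in> ball (z i) \<delta>}"
    by (rule product_topology_basis') auto
  then have "Cn_open n (Cn n \<inter> {w. \<forall>i\<in>{..<n}. w (id i) \<in> ball (z i) \<delta>})"
    by (rule openin_open_Int)
  moreover have "Cn n \<inter> {w. \<forall>i\<in>{..<n}. w (id i) \<in> ball (z i) \<delta>} = polydisc n z \<delta>"
    by (auto simp: polydisc_def dist_commute)
  ultimately show ?thesis by simp
qed

lemma Cn_open_contains_polydisc:
  assumes "Cn_open n \<Omega>" "z \<in> \<Omega>"
  obtains \<delta> where "\<delta> > 0" "polydisc n z \<delta> \<subseteq> \<Omega>"
proof -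
  obtain T where T: "open T" "\<Omega> = Cn n \<inter> T"
    using assms(1) by (auto simp: openin_open)
  then have "openin (product_topology (\<lambda>i. euclidean) UNIV) T" "z \<in> T"
    using assms by (auto simp: open_fun_def)
  from product_topology_open_contains_basis[OF this] obtain X where
    X: "z \<in> (\<Pi>\<^sub>E i\<in>UNIV. X i)" "\<And>i. open (X i)" "(\<Pi>\<^sub>E i\<in>UNIV. X i) \<subseteq> T"
    by auto
  have "\<forall>i. \<exists>e>0. ball (z i) e \<subseteq> X i"
    using X(1,2) by (metis PiE_mem UNIV_I open_contains_ball)
  then obtain e where e: "\<And>i. e i > 0" "\<And>i. ball (z i) (e i) \<subseteq> X i" by metis
  \<comment> \<open>Only the first \<open>n\<close> coordinates constrain a point of
    \<open>Cn n\<close>; the others are 0 for both points. The inserted 1 keeps \<open>Min\<close>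
    away from the empty set when \<open>n\<close> is 0.\<close>
  define \<delta> where "\<delta> = Min (insert 1 (e ` {..<n}))"
  have "\<delta> > 0" using e(1) by (simp add: \<delta>_def)
  moreover have "polydisc n z \<delta> \<subseteq> \<Omega>"
  proof
    fix w assume w: "w \<in> polydisc n z \<delta>"
    have "w i \<in> X i" for i
    proof (cases "i < n")
      case True
      then have "\<delta> \<le> e i" by (simp add: \<delta>_def)
      with True w have "w i \<in> ball (z i) (e i)"
        by (force simp: polydisc_def dist_commute)
      with e(2) show ?thesis by blast
    next
      case False
      then have "w i = z i" using w Cn_openD[OF assms] by (auto simp: polydisc_def Cn_def)
      then show ?thesis using X(1) by auto
    qed
    with X(3) w T show "w \<in> \<Omega>" by (auto simp: polydisc_def)
  qed
  ultimately show ?thesis using that by blast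
qed

lemma open_Cn_preimage:
  assumes "Cn_open n \<Omega>" "open X" "\<And>i. continuous_on X (\<lambda>w. \<gamma> w i)" "\<And>w. w \<in> X \<Longrightarrow> \<gamma> w \<in> Cn n"
  shows "open {w \<in> X. \<gamma> w \<in> \<Omega>}"
proof -
  obtain T where T: "open T" "\<Omega> = Cn n \<inter> T"
    using assms(1) by (auto simp: openin_open)
  have "continuous_on X \<gamma>"
    by (intro continuous_on_coordinatewise_then_product assms)
  then have "open (X \<inter> \<gamma> -` T)"
    using assms(2) T(1) by (simp add: continuous_on_open_vimage Int_commute)
  moreover have "{w \<in> X. \<gamma> w \<in> \<Omega>} = X \<inter> \<gamma> -` T" using T assms(4) by auto
  ultimately show ?thesis by simp
qed

lemma Cn_upd: "z \<in> Cn n \<Longrightarrow> j < n \<Longrightarrow> z(j := w) \<in> Cn n"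
  by (auto simp: Cn_def)

lemma continuous_on_upd [continuous_intros]:
  assumes "continuous_on X f" "continuous_on X (\<lambda>x. g x :: cvec)"
  shows "continuous_on X (\<lambda>x. (g x)(j := f x))"
proof (rule continuous_on_coordinatewise_then_product)
  fix i show "continuous_on X (\<lambda>x. ((g x)(j := f x)) i)"
    using assms by (cases "i = j") (auto intro: continuous_on_product_then_coordinatewise)
qed

lemma open_slice:
  assumes "Cn_open n \<Omega>" "z \<in> Cn n" "j < n"
  shows "open {w. z(j := w) \<in> \<Omega>}"
proof -
  have "continuous_on UNIV (\<lambda>w. (z(j := w)) i)" for i
    by (cases "i = j") (auto intro: continuous_intros)
  then show ?thesis
    using open_Cn_preimage[OF assms(1) open_UNIV, of "\<lambda>w. z(j := w)"] assms Cn_upd by auto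
qed

lemma open_real_slice:
  assumes "Cn_open n \<Omega>" "z \<in> Cn n" "j < n"
  shows "open {t::real. z(j := z j + of_real t * d) \<in> \<Omega>}"
proof -
  have "open ((\<lambda>t::real. z j + of_real t * d) -` {w. z(j := w) \<in> \<Omega>})"
    by (intro open_vimage open_slice[OF assms] continuous_intros)
  then show ?thesis by (simp add: vimage_def)
qed

section \<open>Differentiation along coordinate lines and closure properties of
  \<open>Ck_Cn\<close>\<close>

lemma Ck_Cn_continuous: "Ck_Cn k n \<Omega> f \<Longrightarrow> continuous_on \<Omega> f"
  by (cases k) auto

lemma Ck_Cn_pd: "Ck_Cn (Suc k) n \<Omega> f \<Longrightarrow> j < n \<Longrightarrow> d \<in> {1, \<i>} \<Longrightarrow> Ck_Cn k n \<Omega> (pd j d f)"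
  by auto

lemma pd_has_vector_derivative:
  assumes "Ck_Cn (Suc k) n \<Omega> f" "z \<in> \<Omega>" "j < n" "d \<in> {1, \<i>}"
  shows "((\<lambda>t::real. f (z(j := z j + of_real t * d))) has_vector_derivative pd j d f z) (at 0)"
proof -
  have "(\<lambda>t::real. f (z(j := z j + of_real t * d))) differentiable (at 0)"
    using assms unfolding Ck_Cn.simps by blast
  then show ?thesis unfolding pd_def by (simp add: vector_derivative_works)
qed

text \<open>\<open>pd\<close> looks only at parameter 0. The base point may be moved along its own
  line, so the derivative at parameter \<open>s\<close> is the derivative at 0 from the shifted
  point.\<close>

lemma pd_has_vector_derivative_at:
  assumes "Ck_Cn (Suc k) n \<Omega> f" "z(j := z j + of_real s * d) \<in> \<Omega>" "j < n" "d \<in> {1, \<i>}"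
  shows "((\<lambda>t::real. f (z(j := z j + of_real t * d))) has_vector_derivative
           pd j d f (z(j := z j + of_real s * d))) (at s)"
proof -
  have "((\<lambda>t::real. f ((z(j := z j + of_real s * d))(j := (z(j := z j + of_real s * d)) j + of_real t * d)))
      has_vector_derivative pd j d f (z(j := z j + of_real s * d))) (at (s - s))"
    using pd_has_vector_derivative[OF assms(1,2,3,4)] by simp
  moreover have "((\<lambda>t. t - s) has_vector_derivative 1) (at s)"
    by (auto intro!: derivative_eq_intros)
  ultimately have "((\<lambda>t::real. f ((z(j := z j + of_real s * d))(j := (z(j := z j + of_real s * d)) j + of_real t * d)))
       \<circ> (\<lambda>t. t - s) has_vector_derivative 1 *\<^sub>R pd j d f (z(j := z j + of_real s * d))) (at s)"
    by (rule vector_diff_chain_at[rotated])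
  moreover have "((\<lambda>t::real. f ((z(j := z j + of_real s * d))(j := (z(j := z j + of_real s * d)) j + of_real t * d)))
       \<circ> (\<lambda>t. t - s)) = (\<lambda>t::real. f (z(j := z j + of_real t * d)))"
    by (auto simp: fun_eq_iff algebra_simps)
  ultimately show ?thesis by simp
qed

lemma pd_eqI:
  "((\<lambda>t::real. f (z(j := z j + of_real t * d))) has_vector_derivative D) (at 0) \<Longrightarrow> pd j d f z = D"
  unfolding pd_def by (rule vector_derivative_at)

lemma eventually_real_slice:
  assumes "Cn_open n \<Omega>" "z \<in> \<Omega>" "j < n"
  shows "\<forall>\<^sub>F t::real in nhds 0. z(j := z j + of_real t * d) \<in> \<Omega>"
proof -
  have "open {t::real. z(j := z j + of_real t * d) \<in> \<Omega>}"
    using assms Cn_openD by (blast intro: open_real_slice)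
  then have "\<forall>\<^sub>F t in nhds 0. t \<in> {t::real. z(j := z j + of_real t * d) \<in> \<Omega>}"
    by (rule eventually_nhds_in_open) (use assms in auto)
  then show ?thesis by simp
qed

lemma pd_cong:
  assumes "Cn_open n \<Omega>" "\<And>z. z \<in> \<Omega> \<Longrightarrow> f z = g z" "z \<in> \<Omega>" "j < n"
  shows "pd j d f z = pd j d g z"
proof -
  have "\<forall>\<^sub>F t::real in nhds 0. f (z(j := z j + of_real t * d)) = g (z(j := z j + of_real t * d))"
    by (rule eventually_mono[OF eventually_real_slice[OF assms(1,3,4)]]) (rule assms(2))
  then show ?thesis
    unfolding pd_def by (intro vector_derivative_cong_eq) auto
qed

lemma wirt_cong:
  assumes "Cn_open n \<Omega>" "\<And>z. z \<in> \<Omega> \<Longrightarrow> f z = g z" "z \<in> \<Omega>" "j < n"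
  shows "wirt j f z = wirt j g z" "wirt_bar j f z = wirt_bar j g z"
  using pd_cong[OF assms] by (simp_all add: wirt_def wirt_bar_def)

text \<open>A partial derivative depends only on the germ of the function, and openness of
  \<open>\<Omega>\<close> turns agreement on \<open>\<Omega>\<close> into agreement of germs, order
  after order.\<close>

lemma Ck_Cn_cong:
  assumes "Cn_open n \<Omega>" "\<And>z. z \<in> \<Omega> \<Longrightarrow> f z = g z" "Ck_Cn k n \<Omega> f"
  shows "Ck_Cn k n \<Omega> g"
  using assms(2,3)
proof (induction k arbitrary: f g)
  case 0
  then show ?case by (simp cong: continuous_on_cong)
next
  case (Suc k)
  have "continuous_on \<Omega> g"
    using Ck_Cn_continuous[OF Suc.prems(2)] Suc.prems(1) by (simp cong: continuous_on_cong)
  moreover have "(\<lambda>t::real. g (z(j := z j + of_real t * d))) differentiable (at 0)"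
    if "j < n" "d \<in> {1, \<i>}" "z \<in> \<Omega>" for j d z
  proof -
    have "((\<lambda>t::real. f (z(j := z j + of_real t * d))) has_vector_derivative pd j d f z) (at 0)"
      using Suc.prems that by (intro pd_has_vector_derivative) auto
    moreover have "\<forall>\<^sub>F t::real in nhds 0. f (z(j := z j + of_real t * d)) = g (z(j := z j + of_real t * d))"
      by (rule eventually_mono[OF eventually_real_slice[OF assms(1) that(3,1)]]) (rule Suc.prems(1))
    ultimately have "((\<lambda>t::real. g (z(j := z j + of_real t * d))) has_vector_derivative pd j d f z) (at 0)"
      by (subst has_vector_derivative_cong_ev[symmetric]) (auto simp: Suc.prems(1)[OF that(3)])
    then show ?thesis by (rule differentiableI_vector)
  qed
  moreover have "Ck_Cn k n \<Omega> (pd j d g)" if "j < n" "d \<in> {1, \<i>}" for j d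
  proof (rule Suc.IH)
    show "Ck_Cn k n \<Omega> (pd j d f)" using Suc.prems that by auto
    show "pd j d f z = pd j d g z" if "z \<in> \<Omega>" for z
      using pd_cong[OF assms(1) Suc.prems(1) that \<open>j < n\<close>] .
  qed
  ultimately show ?case by auto
qed

text \<open>The derivatives may be given by any convenient formula \<open>D\<close>, which by
  uniqueness equals \<open>pd\<close> on \<open>\<Omega>\<close>. The closure properties below
  supply the usual differentiation rules as \<open>D\<close>.\<close>

lemma Ck_Cn_SucI:
  assumes \<Omega>: "Cn_open n \<Omega>"
    and "continuous_on \<Omega> f"
    and D: "\<And>j d z. j < n \<Longrightarrow> d \<in> {1, \<i>} \<Longrightarrow> z \<in> \<Omega> \<Longrightarrow>
         ((\<lambda>t::real. f (z(j := z j + of_real t * d))) has_vector_derivative D j d z) (at 0)"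
    and Ck: "\<And>j d. j < n \<Longrightarrow> d \<in> {1, \<i>} \<Longrightarrow> Ck_Cn k n \<Omega> (D j d)"
  shows "Ck_Cn (Suc k) n \<Omega> f"
proof -
  have "(\<lambda>t::real. f (z(j := z j + of_real t * d))) differentiable (at 0)"
    if "j < n" "d \<in> {1, \<i>}" "z \<in> \<Omega>" for j d z
    by (rule differentiableI_vector[OF D[OF that]])
  moreover have "Ck_Cn k n \<Omega> (pd j d f)" if "j < n" "d \<in> {1, \<i>}" for j d
    by (rule Ck_Cn_cong[OF \<Omega> _ Ck[OF that]]) (rule pd_eqI[OF D[OF that], symmetric])
  ultimately show ?thesis using assms(2) by auto
qed

lemma Ck_Cn_Suc_imp: "Ck_Cn (Suc k) n \<Omega> f \<Longrightarrow> Ck_Cn k n \<Omega> f"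
proof (induction k arbitrary: f)
  case (Suc k)
  have "Ck_Cn k n \<Omega> (pd j d f)" if "j < n" "d \<in> {1, \<i>}" for j d
    by (rule Suc.IH[OF Ck_Cn_pd[OF Suc.prems that]])
  then show ?case using Suc.prems unfolding Ck_Cn.simps(2) by blast
qed simp

lemma Ck_Cn_add:
  assumes "Cn_open n \<Omega>" "Ck_Cn k n \<Omega> f" "Ck_Cn k n \<Omega> g"
  shows "Ck_Cn k n \<Omega> (\<lambda>z. f z + g z)"
  using assms(2,3)
proof (induction k arbitrary: f g)
  case (Suc k)
  show ?case
  proof (rule Ck_Cn_SucI[OF assms(1), where D = "\<lambda>j d z. pd j d f z + pd j d g z"])
    show "continuous_on \<Omega> (\<lambda>z. f z + g z)" using Suc.prems by (auto intro: continuous_intros)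
    show "Ck_Cn k n \<Omega> (\<lambda>z. pd j d f z + pd j d g z)" if "j < n" "d \<in> {1, \<i>}" for j d
      by (rule Suc.IH[OF Ck_Cn_pd[OF Suc.prems(1) that] Ck_Cn_pd[OF Suc.prems(2) that]])
    show "((\<lambda>t::real. f (z(j := z j + of_real t * d)) + g (z(j := z j + of_real t * d)))
        has_vector_derivative pd j d f z + pd j d g z) (at 0)"
      if "j < n" "d \<in> {1, \<i>}" "z \<in> \<Omega>" for j d z
      using has_vector_derivative_add[OF pd_has_vector_derivative[OF Suc.prems(1) that(3,1,2)]
          pd_has_vector_derivative[OF Suc.prems(2) that(3,1,2)]] .
  qed
qed (auto intro: continuous_intros)

lemma Ck_Cn_mult:
  assumes "Cn_open n \<Omega>" "Ck_Cn k n \<Omega> f" "Ck_Cn k n \<Omega> g"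
  shows "Ck_Cn k n \<Omega> (\<lambda>z. f z * g z)"
  using assms(2,3)
proof (induction k arbitrary: f g)
  case (Suc k)
  show ?case
  proof (rule Ck_Cn_SucI[OF assms(1), where D = "\<lambda>j d z. f z * pd j d g z + pd j d f z * g z"])
    show "continuous_on \<Omega> (\<lambda>z. f z * g z)" using Suc.prems by (auto intro: continuous_intros)
    show "Ck_Cn k n \<Omega> (\<lambda>z. f z * pd j d g z + pd j d f z * g z)" if "j < n" "d \<in> {1, \<i>}" for j d
      by (intro Ck_Cn_add assms(1) Suc.IH Ck_Cn_Suc_imp[OF Suc.prems(1)] Ck_Cn_Suc_imp[OF Suc.prems(2)]
          Ck_Cn_pd[OF Suc.prems(1) that] Ck_Cn_pd[OF Suc.prems(2) that])
    show "((\<lambda>t::real. f (z(j := z j + of_real t * d)) * g (z(j := z j + of_real t * d)))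
        has_vector_derivative f z * pd j d g z + pd j d f z * g z) (at 0)"
      if "j < n" "d \<in> {1, \<i>}" "z \<in> \<Omega>" for j d z
      using has_vector_derivative_mult[OF pd_has_vector_derivative[OF Suc.prems(1) that(3,1,2)]
          pd_has_vector_derivative[OF Suc.prems(2) that(3,1,2)]] by (simp add: fun_upd_def)
  qed
qed (auto intro: continuous_intros)

lemma Ck_Cn_const: "Cn_open n \<Omega> \<Longrightarrow> Ck_Cn k n \<Omega> (\<lambda>z. c)"
proof (induction k arbitrary: c)
  case (Suc k)
  show ?case by (rule Ck_Cn_SucI[OF Suc.prems, where D = "\<lambda>j d z. 0"]) (use Suc in simp_all)
qed simp

lemma Ck_Cn_of_real_Re:
  assumes "Cn_open n \<Omega>" "Ck_Cn k n \<Omega> f"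
  shows "Ck_Cn k n \<Omega> (\<lambda>z. complex_of_real (Re (f z)))"
  using assms(2)
proof (induction k arbitrary: f)
  case (Suc k)
  show ?case
  proof (rule Ck_Cn_SucI[OF assms(1), where D = "\<lambda>j d z. of_real (Re (pd j d f z))"])
    show "((\<lambda>t::real. complex_of_real (Re (f (z(j := z j + of_real t * d)))))
        has_vector_derivative of_real (Re (pd j d f z))) (at 0)"
      if "j < n" "d \<in> {1, \<i>}" "z \<in> \<Omega>" for j d z
      using bounded_linear.has_vector_derivative[OF bounded_linear_of_real
          bounded_linear.has_vector_derivative[OF bounded_linear_Re
          pd_has_vector_derivative[OF Suc.prems that(3,1,2)]]] .
    show "continuous_on \<Omega> (\<lambda>z. complex_of_real (Re (f z)))"
      using Ck_Cn_continuous[OF Suc.prems] by (intro continuous_intros)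
    show "Ck_Cn k n \<Omega> (\<lambda>z. complex_of_real (Re (pd j d f z)))" if "j < n" "d \<in> {1, \<i>}" for j d
      by (rule Suc.IH[OF Ck_Cn_pd[OF Suc.prems that]])
  qed
qed (auto intro: continuous_intros)

lemma Ck_Cn_inverse:
  assumes "Cn_open n \<Omega>" "Ck_Cn k n \<Omega> f" "\<And>z. z \<in> \<Omega> \<Longrightarrow> f z \<noteq> 0"
  shows "Ck_Cn k n \<Omega> (\<lambda>z. inverse (f z))"
  using assms(2,3)
proof (induction k arbitrary: f)
  case (Suc k)
  show ?case
  proof (rule Ck_Cn_SucI[OF assms(1), where D = "\<lambda>j d z. (-1) * (pd j d f z * (inverse (f z) * inverse (f z)))"])
    show "continuous_on \<Omega> (\<lambda>z. inverse (f z))"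
      using Suc.prems by (auto intro: continuous_intros)
    show "Ck_Cn k n \<Omega> (\<lambda>z. (-1) * (pd j d f z * (inverse (f z) * inverse (f z))))"
      if "j < n" "d \<in> {1, \<i>}" for j d
      using Suc.prems(2) that Ck_Cn_Suc_imp[OF Suc.prems(1)] Ck_Cn_pd[OF Suc.prems(1) that]
      by (intro Ck_Cn_mult Ck_Cn_const Suc.IH assms(1)) auto
    show "((\<lambda>t::real. inverse (f (z(j := z j + of_real t * d)))) has_vector_derivative
        (-1) * (pd j d f z * (inverse (f z) * inverse (f z)))) (at 0)"
      if "j < n" "d \<in> {1, \<i>}" "z \<in> \<Omega>" for j d z
    proof -
      have "(inverse has_field_derivative - (inverse (f z) * inverse (f z))) (at (f z))"
        using DERIV_inverse[of "f z"] Suc.prems(2)[OF that(3)] by (simp add: power2_eq_square)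
      then show ?thesis
        using field_vector_diff_chain_at[OF pd_has_vector_derivative[OF Suc.prems(1) that(3,1,2)],
            of inverse "- (inverse (f z) * inverse (f z))"] by (simp add: o_def fun_upd_def)
    qed
  qed
qed (auto intro: continuous_intros)

lemma Ck_Cn_ln_Re:
  assumes \<Omega>: "Cn_open n \<Omega>" and f: "Ck_Cn k n \<Omega> f" and pos: "\<And>z. z \<in> \<Omega> \<Longrightarrow> Re (f z) > 0"
  shows "Ck_Cn k n \<Omega> (\<lambda>z. complex_of_real (- ln (Re (f z))))"
proof (cases k)
  case 0
  then have "continuous_on \<Omega> f" using f by simp
  then have "continuous_on \<Omega> (\<lambda>z. complex_of_real (- ln (Re (f z))))"
    using pos by (intro continuous_intros) force+
  then show ?thesis using 0 by simp
next
  case (Suc k)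
  show ?thesis unfolding Suc
  proof (rule Ck_Cn_SucI[OF \<Omega>, where D = "\<lambda>j d z.
        (-1) * (complex_of_real (Re (pd j d f z)) * inverse (complex_of_real (Re (f z))))"])
    show "continuous_on \<Omega> (\<lambda>z. complex_of_real (- ln (Re (f z))))"
      using Ck_Cn_continuous[OF f] pos by (intro continuous_intros) force+
    show "Ck_Cn k n \<Omega> (\<lambda>z. (-1) * (complex_of_real (Re (pd j d f z)) * inverse (complex_of_real (Re (f z)))))"
      if "j < n" "d \<in> {1, \<i>}" for j d
    proof -
      have "complex_of_real (Re (f z)) \<noteq> 0" if "z \<in> \<Omega>" for z using pos[OF that] by simp
      then show ?thesis
        by (intro Ck_Cn_mult Ck_Cn_const Ck_Cn_inverse Ck_Cn_of_real_Re \<Omega> Ck_Cn_Suc_imp[OF f[unfolded Suc]]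
            Ck_Cn_pd[OF f[unfolded Suc] that])
    qed
    show "((\<lambda>t::real. complex_of_real (- ln (Re (f (z(j := z j + of_real t * d)))))) has_vector_derivative
        (-1) * (complex_of_real (Re (pd j d f z)) * inverse (complex_of_real (Re (f z))))) (at 0)"
      if "j < n" "d \<in> {1, \<i>}" "z \<in> \<Omega>" for j d z
    proof -
      have "((\<lambda>t::real. Re (f (z(j := z j + of_real t * d)))) has_vector_derivative Re (pd j d f z)) (at 0)"
        using bounded_linear.has_vector_derivative[OF bounded_linear_Re
            pd_has_vector_derivative[OF f[unfolded Suc] that(3,1,2)]] .
      then have "((\<lambda>t::real. - ln (Re (f (z(j := z j + of_real t * d))))) has_vector_derivative
          - (inverse (Re (f z)) * Re (pd j d f z))) (at 0)"
        unfolding has_real_derivative_iff_has_vector_derivative[symmetric]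
        by (intro DERIV_minus DERIV_chain2[where f = ln]) (use pos[OF that(3)] DERIV_ln in auto)
      from bounded_linear.has_vector_derivative[OF bounded_linear_of_real[where 'a = complex] this]
      show ?thesis by (simp add: mult.commute)
    qed
  qed
qed

text \<open>One more real variable is released: differentiability in \<open>x\<close> at a single
  point, plus a continuous partial derivative in \<open>y\<close>, gives joint differentiability,
  and composing with the map from \<open>x\<close> to \<open>(x, \<beta> x)\<close> adds one term.
  Iteration builds the total derivative out of partial ones.\<close>

lemma has_derivative_real_step:
  fixes F :: "'a::real_normed_vector \<Rightarrow> real \<Rightarrow> complex"
  assumes "open X" "x0 \<in> X" "open Y" "convex Y" "\<beta> x0 \<in> Y"
    and A: "((\<lambda>x. F x (\<beta> x0)) has_derivative A) (at x0)"
    and G: "\<And>x y. x \<in> X \<Longrightarrow> y \<in> Y \<Longrightarrow> ((\<lambda>s. F x s) has_vector_derivative G x y) (at y)"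
    and cont: "continuous_on (X \<times> Y) (\<lambda>(x, y). G x y)"
    and B: "(\<beta> has_derivative B) (at x0)"
  shows "((\<lambda>x. F x (\<beta> x)) has_derivative (\<lambda>h. A h + B h *\<^sub>R G x0 (\<beta> x0))) (at x0)"
proof -
  have mem: "(x0, \<beta> x0) \<in> X \<times> Y" "open (X \<times> Y)" using assms by (auto intro: open_Times)
  have "((\<lambda>(x, y). F x y) has_derivative (\<lambda>(tx, ty). A tx + blinfun_scaleR_left (G x0 (\<beta> x0)) ty))
      (at (x0, \<beta> x0) within X \<times> Y)"
  proof (rule has_derivative_partialsI[where fy = "\<lambda>x y. blinfun_scaleR_left (G x y)"])
    show "((\<lambda>x. F x (\<beta> x0)) has_derivative A) (at x0 within X)"
      using A by (rule has_derivative_at_withinI)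
    show "((\<lambda>y. F x y) has_derivative blinfun_apply (blinfun_scaleR_left (G x y))) (at y within Y)"
      if "x \<in> X" "y \<in> Y" for x y
      using has_derivative_at_withinI[OF G[OF that, unfolded has_vector_derivative_def]] by simp
    have "continuous_on (X \<times> Y) (\<lambda>p. blinfun_scaleR_left (case p of (x, y) \<Rightarrow> G x y))"
      by (rule bounded_linear.continuous_on[OF bounded_linear_blinfun_scaleR_left cont])
    then show "continuous (at (x0, \<beta> x0) within X \<times> Y) (\<lambda>(x, y). blinfun_scaleR_left (G x y))"
      using mem(1) unfolding continuous_on_eq_continuous_within case_prod_beta by blast
  qed (use assms in auto)
  then have "((\<lambda>(x, y). F x y) has_derivative (\<lambda>(tx, ty). A tx + ty *\<^sub>R G x0 (\<beta> x0))) (at (x0, \<beta> x0))"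
    using at_within_open[OF mem] by (simp add: case_prod_beta)
  moreover have "((\<lambda>x. (x, \<beta> x)) has_derivative (\<lambda>h. (h, B h))) (at x0)"
    by (intro has_derivative_Pair has_derivative_ident B)
  ultimately show ?thesis
    using has_derivative_compose[of "\<lambda>x. (x, \<beta> x)" "\<lambda>h. (h, B h)" x0 UNIV "\<lambda>(x, y). F x y"
        "\<lambda>(tx, ty). A tx + ty *\<^sub>R G x0 (\<beta> x0)"] by simp
qed

lemma has_derivative_coord_step:
  fixes \<eta> :: "'a::real_normed_vector \<Rightarrow> cvec"
  assumes \<Omega>: "Cn_open n \<Omega>" and f: "Ck_Cn (Suc k) n \<Omega> f" and j: "j < n" and d: "d \<in> {1, \<i>}"
    and X: "open X" "x0 \<in> X" and cont: "\<And>i. continuous_on X (\<lambda>x. \<eta> x i)"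
    and \<eta>: "\<eta> x0 \<in> \<Omega>" "\<And>x. x \<in> X \<Longrightarrow> \<eta> x \<in> Cn n"
    and A: "((\<lambda>x. f (\<eta> x)) has_derivative A) (at x0)"
    and B: "(\<beta> has_derivative B) (at x0)" and \<beta>: "\<beta> x0 = 0"
  shows "((\<lambda>x. f ((\<eta> x)(j := \<eta> x j + of_real (\<beta> x) * d))) has_derivative
          (\<lambda>h. A h + B h *\<^sub>R pd j d f (\<eta> x0))) (at x0)"
proof -
  define p where "p = (\<lambda>(x, s::real). (\<eta> x)(j := \<eta> x j + of_real s * d))"
  have \<eta>c: "continuous_on X \<eta>" using cont by (rule continuous_on_coordinatewise_then_product)
  have pc: "continuous_on (X \<times> UNIV) p"
    unfolding p_def case_prod_beta
    by (intro continuous_intros continuous_on_compose2[OF \<eta>c] continuous_on_compose2[OF cont]) auto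
  have "open {w \<in> X \<times> UNIV. p w \<in> \<Omega>}"
  proof (rule open_Cn_preimage[OF \<Omega>])
    show "continuous_on (X \<times> UNIV) (\<lambda>w. p w i)" for i
      by (rule continuous_on_product_then_coordinatewise[OF pc])
    show "p w \<in> Cn n" if "w \<in> X \<times> UNIV" for w
      using that \<eta>(2) j by (auto simp: p_def Cn_def)
  qed (use X in \<open>auto intro: open_Times\<close>)
  moreover have "(x0, 0) \<in> {w \<in> X \<times> UNIV. p w \<in> \<Omega>}" using X \<eta>(1) by (simp add: p_def)
  ultimately obtain X' Y' where XY: "open X'" "open Y'" "(x0, 0) \<in> X' \<times> Y'"
    "X' \<times> Y' \<subseteq> {w \<in> X \<times> UNIV. p w \<in> \<Omega>}" by (rule open_prod_elim)
  \<comment> \<open>The previous lemma wants a product neighbourhood whose second factor is convex,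
    hence a ball inside \<open>Y'\<close>.\<close>
  then obtain e where e: "e > 0" "ball 0 e \<subseteq> Y'" by (metis mem_Times_iff open_contains_ball snd_conv)
  have in\<Omega>: "p (x, s) \<in> \<Omega>" "x \<in> X" if "x \<in> X'" "s \<in> ball 0 e" for x s
  proof -
    have "(x, s) \<in> X' \<times> Y'" using that e(2) by blast
    then show "p (x, s) \<in> \<Omega>" "x \<in> X" using XY(4) by blast+
  qed
  have "((\<lambda>x. f (p (x, \<beta> x))) has_derivative (\<lambda>h. A h + B h *\<^sub>R pd j d f (p (x0, \<beta> x0)))) (at x0)"
  proof (rule has_derivative_real_step[where X = X' and Y = "ball 0 e" and \<beta> = \<beta>])
    show "((\<lambda>x. f (p (x, \<beta> x0))) has_derivative A) (at x0)" using A by (simp add: \<beta> p_def)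
    show "((\<lambda>s. f (p (x, s))) has_vector_derivative pd j d f (p (x, y))) (at y)"
      if "x \<in> X'" "y \<in> ball 0 e" for x y
      using pd_has_vector_derivative_at[OF f _ j d, of "\<eta> x" y] in\<Omega>[OF that] by (simp add: p_def)
    have "continuous_on (p ` (X' \<times> ball 0 e)) (pd j d f)"
      using Ck_Cn_continuous[OF Ck_Cn_pd[OF f j d]] by (rule continuous_on_subset) (use in\<Omega> in auto)
    moreover have "continuous_on (X' \<times> ball 0 e) p" using pc by (rule continuous_on_subset) (use in\<Omega> in auto)
    ultimately have "continuous_on (X' \<times> ball 0 e) (pd j d f \<circ> p)" by (rule continuous_on_compose[rotated])
    then show "continuous_on (X' \<times> ball 0 e) (\<lambda>(x, y). pd j d f (p (x, y)))"
      by (simp add: o_def case_prod_beta)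
  qed (use XY e B \<beta> in auto)
  then show ?thesis by (simp add: p_def \<beta>)
qed

text \<open>The differential in one complex variable, split into its dz and d(cnj z) parts; it turns
  the two real steps of the chain rule into Wirtinger form.\<close>

lemma wirt_sum_eq:
  "Re h *\<^sub>R pd j 1 f z + Im h *\<^sub>R pd j \<i> f z = wirt j f z * h + wirt_bar j f z * cnj h"
proof -
  have "wirt j f z * h + wirt_bar j f z * cnj h
      = wirt j f z * (Re h + \<i> * Im h) + wirt_bar j f z * (Re h - \<i> * Im h)"
  proof -
    have "h = Re h + \<i> * Im h" "cnj h = Re h - \<i> * Im h" by (simp_all add: complex_eq_iff)
    then show ?thesis by (intro arg_cong2[where f = "(+)"] arg_cong2[where f = "(*)"] refl)
  qed
  also have "\<dots> = Re h *\<^sub>R pd j 1 f z + Im h *\<^sub>R pd j \<i> f z"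
    by (simp add: wirt_def wirt_bar_def field_simps scaleR_conv_of_real)
  finally show ?thesis by simp
qed

lemma Cn_chain_rule:
  fixes \<gamma> :: "'a::real_normed_vector \<Rightarrow> cvec"
  assumes \<Omega>: "Cn_open n \<Omega>" and f: "Ck_Cn (Suc k) n \<Omega> f" and X: "open X" "x0 \<in> X"
    and cont: "\<And>i. i < n \<Longrightarrow> continuous_on X (\<lambda>x. \<gamma> x i)"
    and \<gamma>: "\<And>x. x \<in> X \<Longrightarrow> \<gamma> x \<in> \<Omega>"
    and D: "\<And>i. i < n \<Longrightarrow> ((\<lambda>x. \<gamma> x i) has_derivative \<gamma>' i) (at x0)"
  shows "((\<lambda>x. f (\<gamma> x)) has_derivative
     (\<lambda>h. \<Sum>i<n. wirt i f (\<gamma> x0) * \<gamma>' i h + wirt_bar i f (\<gamma> x0) * cnj (\<gamma>' i h))) (at x0)"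
proof -
  define z0 where "z0 = \<gamma> x0"
  have z0: "z0 \<in> \<Omega>" "z0 \<in> Cn n" using \<gamma> X Cn_openD[OF \<Omega>] by (auto simp: z0_def)
  \<comment> \<open>\<open>\<zeta> m\<close> follows \<open>\<gamma>\<close> in the coordinates
    below \<open>m\<close> and is frozen at \<open>\<gamma> x0\<close> in the rest, so each
    induction step releases one complex coordinate.\<close>
  define \<zeta> where "\<zeta> = (\<lambda>m x i. if i < m then \<gamma> x i else z0 i)"
  have \<zeta>0: "\<zeta> m x0 = z0" for m by (auto simp: \<zeta>_def z0_def)
  have "((\<lambda>x. f (\<zeta> m x)) has_derivative
     (\<lambda>h. \<Sum>i<m. wirt i f z0 * \<gamma>' i h + wirt_bar i f z0 * cnj (\<gamma>' i h))) (at x0)" if "m \<le> n" for m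
    using that
  proof (induction m)
    case 0
    then show ?case by (simp add: \<zeta>_def)
  next
    case (Suc m)
    then have m: "m < n" by simp
    define \<beta> where "\<beta> = (\<lambda>x. \<gamma> x m - z0 m)"
    \<comment> \<open>The real part moves first and the imaginary part afterwards, because
      \<open>has_derivative_coord_step\<close> handles one real direction. Both partial derivatives
      are taken at \<open>z0\<close>, since \<open>\<eta> x0 = z0\<close>.\<close>
    define \<eta> where "\<eta> = (\<lambda>x. (\<zeta> m x)(m := \<zeta> m x m + of_real (Re (\<beta> x)) * 1))"
    have \<beta>: "(\<beta> has_derivative \<gamma>' m) (at x0)" "\<beta> x0 = 0"
      using D[OF m] by (auto simp: \<beta>_def z0_def intro!: derivative_eq_intros)
    have c1: "continuous_on X (\<lambda>x. \<zeta> m x i)" for i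
      using cont[of i] m by (cases "i < m") (auto simp: \<zeta>_def)
    have c2: "continuous_on X (\<lambda>x. \<eta> x i)" for i
      using c1 cont[OF m] by (cases "i = m") (auto simp: \<eta>_def \<beta>_def \<zeta>_def intro!: continuous_intros)
    have m1: "\<zeta> m x \<in> Cn n" for x using m z0(2) by (auto simp: \<zeta>_def Cn_def)
    then have m2: "\<eta> x \<in> Cn n" for x unfolding \<eta>_def using m by (intro Cn_upd)
    have \<eta>0: "\<eta> x0 = z0" by (simp add: \<eta>_def \<zeta>0 \<beta>)
    have s1: "((\<lambda>x. f (\<eta> x)) has_derivative
       (\<lambda>h. (\<Sum>i<m. wirt i f z0 * \<gamma>' i h + wirt_bar i f z0 * cnj (\<gamma>' i h)) + Re (\<gamma>' m h) *\<^sub>R pd m 1 f (\<zeta> m x0))) (at x0)"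
      unfolding \<eta>_def
      by (rule has_derivative_coord_step[OF \<Omega> f m _ X c1])
         (use z0 m1 Suc \<beta> has_derivative_Re[OF \<beta>(1)] in \<open>simp_all add: \<zeta>0\<close>)
    have s2: "((\<lambda>x. f ((\<eta> x)(m := \<eta> x m + of_real (Im (\<beta> x)) * \<i>))) has_derivative
       (\<lambda>h. (\<Sum>i<m. wirt i f z0 * \<gamma>' i h + wirt_bar i f z0 * cnj (\<gamma>' i h)) + Re (\<gamma>' m h) *\<^sub>R pd m 1 f (\<zeta> m x0)
          + Im (\<gamma>' m h) *\<^sub>R pd m \<i> f (\<eta> x0))) (at x0)"
      by (rule has_derivative_coord_step[OF \<Omega> f m _ X c2])
         (use z0 m2 s1 \<beta> has_derivative_Im[OF \<beta>(1)] in \<open>simp_all add: \<eta>0\<close>)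
    have "(\<eta> x)(m := \<eta> x m + of_real (Im (\<beta> x)) * \<i>) = \<zeta> (Suc m) x" for x
    proof -
      have "complex_of_real (Re (\<beta> x)) + of_real (Im (\<beta> x)) * \<i> = \<beta> x" by (simp add: complex_eq_iff)
      then have "z0 m + complex_of_real (Re (\<beta> x)) + of_real (Im (\<beta> x)) * \<i> = \<gamma> x m"
        by (simp add: \<beta>_def add.assoc)
      then show ?thesis by (auto simp: \<eta>_def \<zeta>_def fun_eq_iff less_Suc_eq)
    qed
    then show ?case
      using s2 by (simp add: \<zeta>0 \<eta>0 add.assoc wirt_sum_eq)
  qed
  from this[of n] have "((\<lambda>x. f (\<zeta> n x)) has_derivative
     (\<lambda>h. \<Sum>i<n. wirt i f z0 * \<gamma>' i h + wirt_bar i f z0 * cnj (\<gamma>' i h))) (at x0)" by simp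
  moreover
  have "\<zeta> n x = \<gamma> x" if "x \<in> X" for x
    using z0(2) Cn_openD[OF \<Omega> \<gamma>[OF that]] by (auto simp: \<zeta>_def Cn_def)
  then have "f (\<zeta> n x) = f (\<gamma> x)" if "x \<in> X" for x using that by simp
  ultimately show ?thesis
    unfolding z0_def[symmetric] by (rule has_derivative_transform_within_open[OF _ X])
qed

text \<open>By the fundamental theorem \<open>G s t - G s 0\<close> is the integral of
  \<open>Gt s\<close>. Differentiating under the integral sign in \<open>s\<close> writes
  \<open>Gs t\<close> as \<open>Gs 0\<close> plus the integral of \<open>Gts 0\<close>, whose
  derivative at 0 is \<open>Gts 0 0\<close>. Continuity is asked of one mixed derivative only; the
  other merely has to exist at 0.\<close>

lemma second_derivatives_commute:
  fixes G :: "real \<Rightarrow> real \<Rightarrow> complex"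
  assumes a: "a > 0"
    and Gs: "\<And>t. \<bar>t\<bar> \<le> a \<Longrightarrow> ((\<lambda>s. G s t) has_vector_derivative Gs t) (at 0)"
    and Gt: "\<And>s t. \<bar>s\<bar> \<le> a \<Longrightarrow> \<bar>t\<bar> \<le> a \<Longrightarrow> ((\<lambda>t. G s t) has_vector_derivative Gt s t) (at t)"
    and Gts: "\<And>s t. \<bar>s\<bar> \<le> a \<Longrightarrow> \<bar>t\<bar> \<le> a \<Longrightarrow> ((\<lambda>s. Gt s t) has_vector_derivative Gts s t) (at s)"
    and cont: "continuous_on ({-a..a} \<times> {-a..a}) (\<lambda>(s, t). Gts s t)"
    and D: "(Gs has_vector_derivative D) (at 0)"
  shows "D = Gts 0 0"
proof -
  have eq: "Gs t = Gs 0 + integral {0..t} (Gts 0)" if t: "t \<in> {0..a}" for t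
  proof -
    have ftc: "(Gt s has_integral G s t - G s 0) {0..t}" if "s \<in> {-a..a}" for s
    proof (rule fundamental_theorem_of_calculus)
      show "(G s has_vector_derivative Gt s x) (at x within {0..t})" if "x \<in> {0..t}" for x
        by (rule has_vector_derivative_at_within[OF Gt]) (use that t \<open>s \<in> _\<close> in auto)
    qed (use t in auto)
    have "((\<lambda>s. integral (cbox 0 t) (Gt s)) has_vector_derivative integral (cbox 0 t) (Gts 0)) (at 0 within {-a..a})"
    proof (rule leibniz_rule_vector_derivative)
      show "continuous_on ({-a..a} \<times> cbox 0 t) (\<lambda>(s, t). Gts s t)"
        using cont by (rule continuous_on_subset) (use t in auto)
      show "((\<lambda>s. Gt s u) has_vector_derivative Gts s u) (at s within {-a..a})"
        if "s \<in> {-a..a}" "u \<in> cbox 0 t" for s u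
        by (rule has_vector_derivative_at_within[OF Gts]) (use that t in auto)
      show "Gt s integrable_on cbox 0 t" if "s \<in> {-a..a}" for s
        using has_integral_integrable[OF ftc[OF that]] by simp
    qed (use a in auto)
    moreover have "integral (cbox 0 t) (Gt s) = G s t - G s 0" if "s \<in> {-a..a}" for s
      using ftc[OF that] by (simp add: integral_unique)
    ultimately have "((\<lambda>s. G s t - G s 0) has_vector_derivative integral {0..t} (Gts 0)) (at 0 within {-a..a})"
      using has_vector_derivative_transform[of 0 "{-a..a}" "\<lambda>s. G s t - G s 0" "\<lambda>s. integral (cbox 0 t) (Gt s)"] a
      by simp
    moreover have "((\<lambda>s. G s t - G s 0) has_vector_derivative Gs t - Gs 0) (at 0 within {-a..a})"
      using has_vector_derivative_at_within[OF has_vector_derivative_diff[OF Gs[of t] Gs[of 0]]] t a by auto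
    ultimately have "integral {0..t} (Gts 0) = Gs t - Gs 0"
      using vector_derivative_unique_within_closed_interval[of "-a" a 0] a by fastforce
    then show ?thesis by simp
  qed
  \<comment> \<open>The integral formula is available for \<open>t\<close> in \<open>{0..a}\<close>;
    a one-sided derivative at 0 already determines \<open>D\<close>.\<close>
  have "continuous_on {0..a} (\<lambda>t. case (0, t) of (s, t) \<Rightarrow> Gts s t)"
    by (rule continuous_on_compose2[OF cont]) (use a in \<open>auto intro!: continuous_intros\<close>)
  then have "((\<lambda>t. integral {0..t} (Gts 0)) has_vector_derivative Gts 0 0) (at 0 within {0..a})"
    using a by (intro integral_has_vector_derivative) auto
  then have "((\<lambda>t. Gs 0 + integral {0..t} (Gts 0)) has_vector_derivative Gts 0 0) (at 0 within {0..a})"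
    using has_vector_derivative_add[OF has_vector_derivative_const[of "Gs 0"]] by fastforce
  then have "(Gs has_vector_derivative Gts 0 0) (at 0 within {0..a})"
    using has_vector_derivative_transform[of 0 "{0..a}" Gs, OF _ eq] a by simp
  moreover have "(Gs has_vector_derivative D) (at 0 within {0..a})"
    using D by (rule has_vector_derivative_at_within)
  ultimately show ?thesis
    using vector_derivative_unique_within_closed_interval[of 0 a 0] a by fastforce
qed

lemma pd_commute:
  assumes \<Omega>: "Cn_open n \<Omega>" and f: "Ck_Cn (Suc (Suc k)) n \<Omega> f" and z: "z \<in> \<Omega>"
    and j: "j < n" "d \<in> {1, \<i>}" and l: "l < n" "e \<in> {1, \<i>}"
  shows "pd l e (pd j d f) z = pd j d (pd l e f) z"
proof -
  \<comment> \<open>Adding both increments coordinatewise, rather than nesting two updates, also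
    covers the case \<open>j = l\<close>.\<close>
  define p where "p = (\<lambda>(s::real) (t::real) i. z i + (if i = j then of_real s * d else 0) + (if i = l then of_real t * e else 0))"
  have pj: "(p s t)(j := p s t j + of_real s' * d) = p (s + s') t" for s s' t
    by (auto simp: p_def fun_eq_iff algebra_simps)
  have pl: "(p s t)(l := p s t l + of_real t' * e) = p s (t + t')" for s t t'
    by (auto simp: p_def fun_eq_iff algebra_simps)
  have p0: "p 0 0 = z" by (auto simp: p_def)
  have pc: "continuous_on UNIV (\<lambda>(s, t). p s t)"
    unfolding p_def case_prod_beta
  proof (rule continuous_on_coordinatewise_then_product)
    fix i show "continuous_on UNIV (\<lambda>x. z i + (if i = j then complex_of_real (fst x) * d else 0) +
        (if i = l then complex_of_real (snd x) * e else 0))"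
      by (cases "i = j"; cases "i = l") (auto intro!: continuous_intros)
  qed
  have "open {w \<in> UNIV. (\<lambda>(s, t). p s t) w \<in> \<Omega>}"
  proof (rule open_Cn_preimage[OF \<Omega> open_UNIV])
    show "continuous_on UNIV (\<lambda>w. (\<lambda>(s, t). p s t) w i)" for i
      by (rule continuous_on_product_then_coordinatewise[OF pc])
    show "(\<lambda>(s, t). p s t) w \<in> Cn n" for w
      using Cn_openD[OF \<Omega> z] j(1) l(1) by (cases w) (simp add: p_def Cn_def)
  qed
  moreover have "(0, 0) \<in> {w \<in> UNIV. (\<lambda>(s, t). p s t) w \<in> \<Omega>}" using z p0 by simp
  ultimately obtain X Y where XY: "open X" "open Y" "(0, 0) \<in> X \<times> Y" "X \<times> Y \<subseteq> {w \<in> UNIV. (\<lambda>(s, t). p s t) w \<in> \<Omega>}"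
    by (rule open_prod_elim)
  obtain a1 where a1: "a1 > 0" "cball 0 a1 \<subseteq> X" using XY by (metis mem_Times_iff open_contains_cball fst_conv)
  obtain a2 where a2: "a2 > 0" "cball 0 a2 \<subseteq> Y" using XY by (metis mem_Times_iff open_contains_cball snd_conv)
  define a where "a = min a1 a2"
  have a: "a > 0" using a1 a2 by (simp add: a_def)
  have in\<Omega>: "p s t \<in> \<Omega>" if "\<bar>s\<bar> \<le> a" "\<bar>t\<bar> \<le> a" for s t
  proof -
    have "s \<in> X" "t \<in> Y" using that a1 a2 by (auto simp: a_def subset_iff dist_real_def)
    then show ?thesis using XY by auto
  qed
  have "pd l e (pd j d f) z = pd j d (pd l e f) (p 0 0)"
  proof (rule second_derivatives_commute[OF a, where G = "\<lambda>s t. f (p s t)" and Gs = "\<lambda>t. pd j d f (p 0 t)"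
        and Gt = "\<lambda>s t. pd l e f (p s t)" and Gts = "\<lambda>s t. pd j d (pd l e f) (p s t)"])
    show "((\<lambda>s. f (p s t)) has_vector_derivative pd j d f (p 0 t)) (at 0)" if "\<bar>t\<bar> \<le> a" for t
      using pd_has_vector_derivative[OF f in\<Omega>[of 0 t] j] that a by (simp add: pj)
    show "((\<lambda>t. f (p s t)) has_vector_derivative pd l e f (p s t)) (at t)" if "\<bar>s\<bar> \<le> a" "\<bar>t\<bar> \<le> a" for s t
      using pd_has_vector_derivative_at[OF f _ l, of "p s 0" t] in\<Omega>[of s t] that by (simp add: pl)
    show "((\<lambda>s. pd l e f (p s t)) has_vector_derivative pd j d (pd l e f) (p s t)) (at s)"
      if "\<bar>s\<bar> \<le> a" "\<bar>t\<bar> \<le> a" for s t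
      using pd_has_vector_derivative_at[OF Ck_Cn_pd[OF f l] _ j, of "p 0 t" s] in\<Omega>[of s t] that by (simp add: pj)
    show "((\<lambda>t. pd j d f (p 0 t)) has_vector_derivative pd l e (pd j d f) z) (at 0)"
      using pd_has_vector_derivative[OF Ck_Cn_pd[OF f j] z l] pl[of 0 0] by (simp add: p0)
    have "continuous_on \<Omega> (pd j d (pd l e f))" by (rule Ck_Cn_continuous[OF Ck_Cn_pd[OF Ck_Cn_pd[OF f l] j]])
    then have "continuous_on ({-a..a} \<times> {-a..a}) (\<lambda>w. pd j d (pd l e f) ((\<lambda>(s, t). p s t) w))"
      by (rule continuous_on_compose2[OF _ continuous_on_subset[OF pc]]) (auto intro!: in\<Omega>)
    then show "continuous_on ({-a..a} \<times> {-a..a}) (\<lambda>(s, t). pd j d (pd l e f) (p s t))"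
      by (simp add: case_prod_beta)
  qed
  then show ?thesis by (simp add: p0)
qed

section \<open>The maximum principle\<close>

definition has_deriv2 :: "(real \<Rightarrow> real) \<Rightarrow> real \<Rightarrow> bool" where
  "has_deriv2 g p \<longleftrightarrow>
     (\<exists>g'. (\<forall>\<^sub>F t in nhds 0. (g has_real_derivative g' t) (at t)) \<and> (g' has_real_derivative p) (at 0))"

text \<open>Second derivatives are asked for only along the two coordinate lines through
  \<open>w\<close>; this is all that a local maximum needs to force
  \<open>L \<le> 0\<close>.\<close>

definition has_laplacian :: "(complex \<Rightarrow> real) \<Rightarrow> complex \<Rightarrow> real \<Rightarrow> bool" where
  "has_laplacian g w L \<longleftrightarrow>
     (\<exists>p q. has_deriv2 (\<lambda>t. g (w + of_real t)) p \<and> has_deriv2 (\<lambda>t. g (w + of_real t * \<i>)) q \<and> L = p + q)"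

lemma has_deriv2I:
  "\<forall>\<^sub>F t in nhds 0. (g has_real_derivative g' t) (at t) \<Longrightarrow> (g' has_real_derivative p) (at 0) \<Longrightarrow> has_deriv2 g p"
  unfolding has_deriv2_def by blast

lemma has_deriv2_add:
  assumes "has_deriv2 f p" "has_deriv2 g q"
  shows "has_deriv2 (\<lambda>t. f t + g t) (p + q)"
proof -
  obtain f' g' where f: "\<forall>\<^sub>F t in nhds 0. (f has_real_derivative f' t) (at t)" "(f' has_real_derivative p) (at 0)"
    and g: "\<forall>\<^sub>F t in nhds 0. (g has_real_derivative g' t) (at t)" "(g' has_real_derivative q) (at 0)"
    using assms unfolding has_deriv2_def by blast
  have "\<forall>\<^sub>F t in nhds 0. ((\<lambda>t. f t + g t) has_real_derivative f' t + g' t) (at t)"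
    using f(1) g(1) by eventually_elim (rule DERIV_add)
  then show ?thesis using DERIV_add[OF f(2) g(2)] by (rule has_deriv2I)
qed

lemma has_deriv2_cmult:
  assumes "has_deriv2 f p"
  shows "has_deriv2 (\<lambda>t. c * f t) (c * p)"
proof -
  obtain f' where f: "\<forall>\<^sub>F t in nhds 0. (f has_real_derivative f' t) (at t)" "(f' has_real_derivative p) (at 0)"
    using assms unfolding has_deriv2_def by blast
  have "\<forall>\<^sub>F t in nhds 0. ((\<lambda>t. c * f t) has_real_derivative c * f' t) (at t)"
    using f(1) by eventually_elim (rule DERIV_cmult)
  then show ?thesis using DERIV_cmult[OF f(2)] by (rule has_deriv2I)
qed

lemma has_deriv2_cong:
  assumes "has_deriv2 f p" "\<forall>\<^sub>F t in nhds 0. f t = g t"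
  shows "has_deriv2 g p"
proof -
  obtain f' where f: "\<forall>\<^sub>F t in nhds 0. (f has_real_derivative f' t) (at t)" "(f' has_real_derivative p) (at 0)"
    using assms unfolding has_deriv2_def by blast
  have "\<forall>\<^sub>F t in nhds 0. (g has_real_derivative f' t) (at t)"
    using f(1) eventually_eventually[THEN iffD2, OF assms(2)]
  proof eventually_elim
    case (elim t)
    then show ?case using DERIV_cong_ev[OF refl elim(2) refl] by blast
  qed
  then show ?thesis using f(2) by (rule has_deriv2I)
qed

lemma has_deriv2_const: "has_deriv2 (\<lambda>t. c) 0"
  unfolding has_deriv2_def by (rule exI[of _ "\<lambda>t. 0"]) auto

text \<open>The first derivative vanishes at the maximum. If \<open>p\<close> were positive, it
  would be positive just to the right, and the mean value theorem would push \<open>g\<close> above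
  \<open>g 0\<close>.\<close>

lemma has_deriv2_local_max:
  assumes "has_deriv2 g p" "\<forall>\<^sub>F t in nhds 0. g t \<le> g 0"
  shows "p \<le> 0"
proof (rule ccontr)
  assume "\<not> p \<le> 0"
  obtain g' where g: "\<forall>\<^sub>F t in nhds 0. (g has_real_derivative g' t) (at t)" "(g' has_real_derivative p) (at 0)"
    using assms unfolding has_deriv2_def by blast
  have "\<forall>\<^sub>F t in nhds 0. (g has_real_derivative g' t) (at t) \<and> g t \<le> g 0"
    using g(1) assms(2) by eventually_elim simp
  then obtain e where e: "e > 0" "\<And>t. \<bar>t\<bar> < e \<Longrightarrow> (g has_real_derivative g' t) (at t) \<and> g t \<le> g 0"
    unfolding eventually_nhds_metric by (auto simp: dist_real_def)
  have g0: "g' 0 = 0"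
    by (rule DERIV_local_max[of g "g' 0" 0 e]) (use e in auto)
  obtain d where d: "d > 0" "\<And>h. h > 0 \<Longrightarrow> h < d \<Longrightarrow> g' 0 < g' h"
    using DERIV_pos_inc_right[OF g(2)] \<open>\<not> p \<le> 0\<close> by auto
  define t where "t = min e d / 2"
  have t: "0 < t" "t < e" "t < d" using e d by (auto simp: t_def min_def)
  obtain s where s: "0 < s" "s < t" "g t - g 0 = (t - 0) * g' s"
    using MVT2[of 0 t g g'] t e by auto
  have "g' s > 0" using d(2)[of s] g0 s t by auto
  then have "(t - 0) * g' s > 0" using t by simp
  then have "g t > g 0" using s(3) by linarith
  then show False using e(2)[of t] t by auto
qed

lemma has_laplacian_add:
  "has_laplacian f w K \<Longrightarrow> has_laplacian g w L \<Longrightarrow> has_laplacian (\<lambda>w. f w + g w) w (K + L)"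
proof -
  assume "has_laplacian f w K" "has_laplacian g w L"
  then obtain p q p' q' where
    f: "has_deriv2 (\<lambda>t. f (w + of_real t)) p" "has_deriv2 (\<lambda>t. f (w + of_real t * \<i>)) q" "K = p + q"
    and g: "has_deriv2 (\<lambda>t. g (w + of_real t)) p'" "has_deriv2 (\<lambda>t. g (w + of_real t * \<i>)) q'" "L = p' + q'"
    unfolding has_laplacian_def by blast
  have "K + L = (p + p') + (q + q')" using f(3) g(3) by simp
  then show ?thesis
    unfolding has_laplacian_def using has_deriv2_add[OF f(1) g(1)] has_deriv2_add[OF f(2) g(2)] by blast
qed

lemma has_laplacian_cmult:
  "has_laplacian f w K \<Longrightarrow> has_laplacian (\<lambda>w. c * f w) w (c * K)"
proof -
  assume "has_laplacian f w K"
  then obtain p q where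
    f: "has_deriv2 (\<lambda>t. f (w + of_real t)) p" "has_deriv2 (\<lambda>t. f (w + of_real t * \<i>)) q" "K = p + q"
    unfolding has_laplacian_def by blast
  have "c * K = c * p + c * q" using f(3) by (simp add: distrib_left)
  then show ?thesis
    unfolding has_laplacian_def using has_deriv2_cmult[OF f(1)] has_deriv2_cmult[OF f(2)] by blast
qed

lemma eventually_nhds_line:
  fixes w d :: complex
  assumes "\<forall>\<^sub>F w' in nhds w. P w'"
  shows "\<forall>\<^sub>F t::real in nhds 0. P (w + of_real t * d)"
proof -
  have "continuous (at 0) (\<lambda>t::real. w + of_real t * d)" by (intro continuous_intros)
  then have "filterlim (\<lambda>t::real. w + of_real t * d) (nhds w) (at 0)"
    by (simp add: continuous_within)
  then have "\<forall>\<^sub>F t::real in at 0. P (w + of_real t * d)"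
    using assms by (simp add: filterlim_iff)
  moreover have "P w" using assms by (rule eventually_nhds_x_imp_x)
  ultimately show ?thesis by (simp add: eventually_nhds_conv_at)
qed

lemma has_laplacian_cong:
  assumes "has_laplacian f w L" "\<forall>\<^sub>F w' in nhds w. f w' = g w'"
  shows "has_laplacian g w L"
proof -
  obtain p q where pq: "has_deriv2 (\<lambda>t. f (w + of_real t)) p" "has_deriv2 (\<lambda>t. f (w + of_real t * \<i>)) q" "L = p + q"
    using assms(1) by (auto simp: has_laplacian_def)
  have "has_deriv2 (\<lambda>t. g (w + of_real t)) p" "has_deriv2 (\<lambda>t. g (w + of_real t * \<i>)) q"
    using has_deriv2_cong[OF pq(1)] has_deriv2_cong[OF pq(2)]
      eventually_nhds_line[OF assms(2), of 1] eventually_nhds_line[OF assms(2), of \<i>] by auto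
  then show ?thesis unfolding has_laplacian_def pq(3) by blast
qed

lemma has_laplacian_local_max:
  assumes "has_laplacian g w L" "\<forall>\<^sub>F w' in nhds w. g w' \<le> g w"
  shows "L \<le> 0"
proof -
  obtain p q where pq: "has_deriv2 (\<lambda>t. g (w + of_real t)) p" "has_deriv2 (\<lambda>t. g (w + of_real t * \<i>)) q" "L = p + q"
    using assms(1) by (auto simp: has_laplacian_def)
  have "p \<le> 0" "q \<le> 0"
    using has_deriv2_local_max[OF pq(1)] has_deriv2_local_max[OF pq(2)]
      eventually_nhds_line[OF assms(2), of 1] eventually_nhds_line[OF assms(2), of \<i>] by auto
  then show ?thesis using pq by simp
qed

text \<open>The maximum test applied to \<open>g\<close> and to its negative. It later turns
  constancy of the potential into vanishing of a Levi form.\<close>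

lemma has_laplacian_locally_const:
  assumes "has_laplacian g w L" "\<forall>\<^sub>F w' in nhds w. g w' = c"
  shows "L = 0"
proof -
  have gw: "g w = c" using assms(2) by (rule eventually_nhds_x_imp_x)
  have "L \<le> 0"
    by (rule has_laplacian_local_max[OF assms(1)])
       (use assms(2) in \<open>rule eventually_mono, auto simp: gw\<close>)
  moreover have "(-1) * L \<le> 0"
    by (rule has_laplacian_local_max[OF has_laplacian_cmult[OF assms(1)]])
       (use assms(2) in \<open>rule eventually_mono, auto simp: gw\<close>)
  ultimately show ?thesis by simp
qed

text \<open>\<open>x + t\<close> is the moving real coordinate and \<open>y\<close> stands for the
  square of the other one, so a single computation serves both directions.\<close>

lemma has_deriv2_gaussian:
  "has_deriv2 (\<lambda>t. exp (- \<alpha> * ((x + t)\<^sup>2 + y))) ((4 * \<alpha>\<^sup>2 * x\<^sup>2 - 2 * \<alpha>) * exp (- \<alpha> * (x\<^sup>2 + y)))"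
proof -
  have 1: "((\<lambda>t. exp (- \<alpha> * ((x + t)\<^sup>2 + y))) has_real_derivative - 2 * \<alpha> * (x + t) * exp (- \<alpha> * ((x + t)\<^sup>2 + y))) (at t)" for t
    by (auto intro!: derivative_eq_intros simp: algebra_simps)
  have 2: "((\<lambda>t. - 2 * \<alpha> * (x + t) * exp (- \<alpha> * ((x + t)\<^sup>2 + y))) has_real_derivative
      - 2 * \<alpha> * exp (- \<alpha> * ((x + 0)\<^sup>2 + y)) + (- 2 * \<alpha> * (x + 0) * exp (- \<alpha> * ((x + 0)\<^sup>2 + y))) * (- 2 * \<alpha> * (x + 0))) (at 0)"
    by (rule derivative_eq_intros 1 refl | simp)+
  have "- 2 * \<alpha> * exp (- \<alpha> * ((x + 0)\<^sup>2 + y)) + (- 2 * \<alpha> * (x + 0) * exp (- \<alpha> * ((x + 0)\<^sup>2 + y))) * (- 2 * \<alpha> * (x + 0))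
      = (4 * \<alpha>\<^sup>2 * x\<^sup>2 - 2 * \<alpha>) * exp (- \<alpha> * (x\<^sup>2 + y))"
    by (simp add: algebra_simps power2_eq_square)
  with 1 2 show ?thesis unfolding has_deriv2_def
    by (intro exI[of _ "\<lambda>t. - 2 * \<alpha> * (x + t) * exp (- \<alpha> * ((x + t)\<^sup>2 + y))"]) (simp del: mult_minus_left)
qed

lemma has_laplacian_gaussian:
  "has_laplacian (\<lambda>w. exp (- \<alpha> * (cmod (w - q))\<^sup>2)) w
     ((4 * \<alpha>\<^sup>2 * (cmod (w - q))\<^sup>2 - 4 * \<alpha>) * exp (- \<alpha> * (cmod (w - q))\<^sup>2))"
proof -
  let ?x = "Re (w - q)" and ?y = "Im (w - q)"
  have c: "(cmod (w + of_real t - q))\<^sup>2 = (?x + t)\<^sup>2 + ?y\<^sup>2"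
    "(cmod (w + of_real t * \<i> - q))\<^sup>2 = (?y + t)\<^sup>2 + ?x\<^sup>2" "(cmod (w - q))\<^sup>2 = ?x\<^sup>2 + ?y\<^sup>2"
    for t by (simp_all add: cmod_power2 algebra_simps)
  show ?thesis unfolding has_laplacian_def c
    by (rule exI, rule exI, rule conjI[OF has_deriv2_gaussian conjI[OF has_deriv2_gaussian]])
       (simp add: algebra_simps)
qed

text \<open>The Hopf barrier: \<open>exp (- \<alpha> |w - q|\<^sup>2)\<close> is strictly subharmonic near the touching point \<open>p\<close>.\<close>

lemma hopf_touching_point:
  assumes D: "open D" and cont: "continuous_on D g"
    and lap: "\<And>w. w \<in> D \<Longrightarrow> \<exists>L\<ge>0. has_laplacian g w L"
    and le: "\<And>w. w \<in> D \<Longrightarrow> g w \<le> M" and p: "p \<in> D" "g p = M" "cmod (p - q) = \<rho>" and \<rho>: "\<rho> > 0"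
    and lt: "\<And>w. w \<in> cball q \<rho> - {p} \<Longrightarrow> g w < M"
  shows False
proof -
  obtain e0 where e0: "e0 > 0" "cball p e0 \<subseteq> D" using D p by (meson open_contains_cball)
  \<comment> \<open>Within half the radius of \<open>p\<close>, points keep distance at least
    \<open>\<rho> / 2\<close> from the centre \<open>q\<close>, where the Gaussian fails to be
    subharmonic.\<close>
  define e where "e = min e0 (\<rho> / 2)"
  have e: "e > 0" "e \<le> \<rho> / 2" "cball p e \<subseteq> D" using e0 \<rho> by (auto simp: e_def)
  \<comment> \<open>Chosen so that \<open>\<alpha>\<close> times the squared distance to
    \<open>q\<close> is at least 2 from distance \<open>\<rho> / 2\<close> on; the Laplacian of the
    Gaussian is positive as soon as this product exceeds 1.\<close>
  define \<alpha> where "\<alpha> = 8 / \<rho>\<^sup>2"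
  define b where "b = (\<lambda>w. exp (- \<alpha> * (cmod (w - q))\<^sup>2) + (- exp (- \<alpha> * \<rho>\<^sup>2)))"
  have \<alpha>: "\<alpha> > 0" using \<rho> by (simp add: \<alpha>_def)
  \<comment> \<open>The part of the small circle inside the disc around \<open>q\<close>. There
    \<open>g\<close> stays below some \<open>m < M\<close> by compactness, while on the rest of the
    circle \<open>b\<close> is negative; either way the perturbed function stays below
    \<open>M\<close> on the circle.\<close>
  define K where "K = sphere p e \<inter> cball q \<rho>"
  have gK: "continuous_on K g" by (rule continuous_on_subset[OF cont]) (use e in \<open>auto simp: K_def\<close>)
  have "\<exists>m<M. \<forall>w\<in>K. g w \<le> m"
  proof (cases "K = {}")
    case True then show ?thesis by (intro exI[of _ "M - 1"]) auto
  next
    case False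
    have "compact K" by (auto simp: K_def)
    then obtain w where w: "w \<in> K" "\<forall>v\<in>K. g v \<le> g w"
      using continuous_attains_sup[OF _ False gK] by blast
    have "g w < M" by (rule lt) (use w e in \<open>auto simp: K_def\<close>)
    then show ?thesis using w by blast
  qed
  then obtain m where m: "m < M" "\<And>w. w \<in> K \<Longrightarrow> g w \<le> m" by blast
  \<comment> \<open>Half of the gap: since \<open>b \<le> 1\<close>, the perturbation cannot lift
    \<open>g\<close> up to \<open>M\<close> on \<open>K\<close>.\<close>
  define \<epsilon> where "\<epsilon> = (M - m) / 2"
  have \<epsilon>: "\<epsilon> > 0" "m + \<epsilon> < M" using m by (auto simp: \<epsilon>_def field_simps)
  define G where "G = (\<lambda>w. g w + \<epsilon> * b w)"
  have Gp: "G p = M" using p by (simp add: G_def b_def)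
  have Gs: "G w < M" if "w \<in> sphere p e" for w
  proof (cases "w \<in> cball q \<rho>")
    case True
    have "- \<alpha> * (cmod (w - q))\<^sup>2 \<le> 0" using \<alpha> by simp
    then have "b w \<le> 1" unfolding b_def by (smt (verit) exp_gt_zero exp_le_one_iff)
    then have "\<epsilon> * b w \<le> \<epsilon>" using \<epsilon> by (simp add: mult_left_le)
    moreover have "g w \<le> m" using m(2)[of w] that True by (simp add: K_def)
    ultimately have "g w + \<epsilon> * b w \<le> m + \<epsilon>" by linarith
    then show ?thesis using \<epsilon>(2) by (simp add: G_def)
  next
    case False
    then have "\<rho>\<^sup>2 < (cmod (w - q))\<^sup>2"
      using \<rho> by (intro power_strict_mono) (auto simp: dist_norm norm_minus_commute)
    then have "b w < 0" using \<alpha> by (simp add: b_def)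
    then have "\<epsilon> * b w < 0" using \<epsilon> by (simp add: mult_pos_neg)
    moreover have "w \<in> D" using that e by auto
    ultimately show ?thesis using le[of w] by (simp add: G_def)
  qed
  have Gc: "continuous_on (cball p e) G" unfolding G_def b_def
    by (intro continuous_intros continuous_on_subset[OF cont] e)
  obtain w where w: "w \<in> cball p e" "\<And>v. v \<in> cball p e \<Longrightarrow> G v \<le> G w"
    using continuous_attains_sup[OF _ _ Gc] e(1) by (metis cball_eq_empty compact_cball not_less_iff_gr_or_eq)
  have "G w \<ge> M" using w(2)[of p] Gp e(1) by simp
  then have wb: "w \<in> ball p e" using Gs[of w] w(1) by (force simp: dist_norm)
  have "\<forall>\<^sub>F v in nhds w. v \<in> ball p e" using wb by (intro eventually_nhds_in_open) auto
  then have max: "\<forall>\<^sub>F v in nhds w. G v \<le> G w" by (rule eventually_mono) (auto intro: w(2))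
  obtain L where L: "L \<ge> 0" "has_laplacian g w L" using lap[of w] w(1) e by blast
  define B where "B = (4 * \<alpha>\<^sup>2 * (cmod (w - q))\<^sup>2 - 4 * \<alpha>) * exp (- \<alpha> * (cmod (w - q))\<^sup>2)"
  have hc: "has_laplacian (\<lambda>w. - exp (- \<alpha> * \<rho>\<^sup>2)) w 0"
    unfolding has_laplacian_def using has_deriv2_const by (intro exI[of _ 0]) simp
  have "has_laplacian b w (B + 0)"
    unfolding b_def B_def by (rule has_laplacian_add[OF has_laplacian_gaussian hc])
  then have "has_laplacian G w (L + \<epsilon> * B)"
    unfolding G_def by (intro has_laplacian_add L has_laplacian_cmult) simp
  from has_laplacian_local_max[OF this max] have "L + \<epsilon> * B \<le> 0" .
  moreover have "B > 0"
  proof -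
    have "\<rho> \<le> cmod (w - q) + cmod (w - p)"
      using norm_triangle_ineq4[of "w - q" "w - p"] p(3) by simp
    moreover have "cmod (w - p) < \<rho> / 2" using wb e(2) by (auto simp: dist_norm norm_minus_commute)
    ultimately have "\<rho> / 2 \<le> cmod (w - q)" by simp
    then have "(\<rho> / 2)\<^sup>2 \<le> (cmod (w - q))\<^sup>2" using \<rho> by (intro power_mono) auto
    then have "\<alpha> * (\<rho> / 2)\<^sup>2 \<le> \<alpha> * (cmod (w - q))\<^sup>2" using \<alpha> by simp
    moreover have "\<alpha> * (\<rho> / 2)\<^sup>2 = 2" using \<rho> by (simp add: \<alpha>_def power_divide)
    ultimately have "\<alpha> * (cmod (w - q))\<^sup>2 > 1" by simp
    then have "\<alpha> * (\<alpha> * (cmod (w - q))\<^sup>2) > \<alpha> * 1" using \<alpha> by (intro mult_strict_left_mono)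
    then have "4 * \<alpha>\<^sup>2 * (cmod (w - q))\<^sup>2 - 4 * \<alpha> > 0" by (simp add: power2_eq_square mult.assoc)
    then show ?thesis by (simp add: B_def)
  qed
  ultimately show False using L(1) \<epsilon>(1) by (smt (verit) mult_pos_pos)
qed

text \<open>The set where the maximum is attained is closed. If it were not open, a point
  \<open>q\<close> off it but close to it would have a nearest point \<open>p'\<close> in it, and a
  disc touching the set in \<open>p'\<close> alone contradicts
  \<open>hopf_touching_point\<close>.\<close>

lemma strong_maximum_principle:
  assumes D: "open D" "connected D" and cont: "continuous_on D g"
    and lap: "\<And>w. w \<in> D \<Longrightarrow> \<exists>L\<ge>0. has_laplacian g w L"
    and p: "p \<in> D" and le: "\<And>w. w \<in> D \<Longrightarrow> g w \<le> g p" and w: "w \<in> D"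
  shows "g w = g p"
proof -
  define S where "S = {w \<in> D. g w = g p}"
  have "closedin (top_of_set D) S"
    unfolding S_def by (rule continuous_closedin_preimage_constant[OF cont])
  moreover have "open S"
    unfolding open_contains_ball
  proof
    fix y assume y: "y \<in> S"
    then have yD: "y \<in> D" by (simp add: S_def)
    then obtain R where R: "R > 0" "cball y R \<subseteq> D" using D(1) by (meson open_contains_cball)
    \<comment> \<open>A quarter of \<open>R\<close> leaves room: a point no farther from
      \<open>q\<close> than its nearest point is still within \<open>2 * r\<close> of
      \<open>y\<close>, inside \<open>D\<close>.\<close>
    define r where "r = R / 4"
    have r: "r > 0" using R by (simp add: r_def)
    have "ball y r \<subseteq> S"
    proof (rule subsetI, rule ccontr)
      fix q assume q: "q \<in> ball y r" "q \<notin> S"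
      \<comment> \<open>Cut down to a closed ball, the level set is closed in the whole plane, so a
        nearest point exists.\<close>
      define K where "K = {x \<in> cball y (2 * r). g x = g p}"
      have sub: "cball y (2 * r) \<subseteq> D" using R by (auto simp: r_def)
      have KS: "K = S \<inter> cball y (2 * r)" using sub by (auto simp: K_def S_def)
      have "closed K" unfolding K_def
        by (rule continuous_closed_preimage_constant[OF continuous_on_subset[OF cont sub]]) auto
      moreover have yK: "y \<in> K" using y r by (simp add: KS)
      ultimately obtain p' where p': "p' \<in> K" "\<And>x. x \<in> K \<Longrightarrow> dist q p' \<le> dist q x"
        using distance_attains_inf[of K q] by blast
      define \<rho> where "\<rho> = dist q p'"
      have \<rho>r: "\<rho> < r" using p'(2)[OF yK] q(1) by (simp add: \<rho>_def dist_commute)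
      have \<rho>: "\<rho> > 0" using p'(1) q(2) by (auto simp: \<rho>_def KS)
      have inD: "x \<in> cball y (2 * r)" if "dist q x \<le> \<rho>" for x
        using that \<rho>r q(1) dist_triangle[of y x q] by simp
      have notS: "g x < g p" if "dist q x < \<rho>" for x
      proof -
        have "x \<notin> K" using p'(2)[of x] that by (auto simp: \<rho>_def)
        then show ?thesis using le[of x] inD[of x] that sub by (force simp: K_def)
      qed
      \<comment> \<open>The circle around \<open>q\<close> may meet the level set in several points.
        The closed disc with diameter from \<open>q\<close> to \<open>p'\<close> meets that circle
        in \<open>p'\<close> only and otherwise lies inside it; the parallelogram law proves
        this.\<close>
      define q' where "q' = (q + p') / 2"
      have q'1: "cmod (p' - q') = \<rho> / 2"
      proof -
        have "p' - q' = (p' - q) / 2" by (simp add: q'_def field_simps)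
        then have "cmod (p' - q') = cmod (p' - q) / 2" by (simp only: norm_divide) simp
        then show ?thesis by (simp add: \<rho>_def dist_norm norm_minus_commute)
      qed
      show False
      proof (rule hopf_touching_point[OF D(1) cont lap le _ _ q'1])
        show "p' \<in> D" "g p' = g p" using p'(1) sub by (auto simp: K_def)
        show "g x < g p" if x: "x \<in> cball q' (\<rho> / 2) - {p'}" for x
        proof (rule notS)
          have par: "(cmod (x - q))\<^sup>2 + (cmod (x - p'))\<^sup>2 = 2 * (cmod (x - q'))\<^sup>2 + 2 * (cmod (p' - q'))\<^sup>2"
            unfolding q'_def cmod_power2 by (simp add: field_simps power2_eq_square)
          have "cmod (x - q') \<le> \<rho> / 2" using x by (auto simp: dist_norm norm_minus_commute)
          then have "(cmod (x - q'))\<^sup>2 \<le> (\<rho> / 2)\<^sup>2" by (intro power_mono) auto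
          then have "(cmod (x - q))\<^sup>2 + (cmod (x - p'))\<^sup>2 \<le> \<rho>\<^sup>2"
            using par q'1 by (simp add: power_divide)
          moreover have "(cmod (x - p'))\<^sup>2 > 0" using x by auto
          ultimately have "(cmod (x - q))\<^sup>2 < \<rho>\<^sup>2" by linarith
          then show "dist q x < \<rho>" using \<rho> by (simp add: dist_norm norm_minus_commute power2_less_imp_less)
        qed
      qed (use \<rho> in auto)
    qed
    then show "\<exists>e>0. ball y e \<subseteq> S" using r by blast
  qed
  moreover have "S \<subseteq> D" by (auto simp: S_def)
  ultimately have "S = {} \<or> S = D"
    using D connected_clopen[of D] by (metis openin_open_eq)
  moreover have "p \<in> S" using p by (simp add: S_def)
  ultimately show ?thesis using w by (auto simp: S_def)
qed

text \<open>A point is reached from \<open>z\<close> by changing one coordinate at a time; on each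
  of these discs the one-variable principle applies, with the maximum at the point reached
  before.\<close>

lemma polydisc_maximum_principle:
  fixes V :: "cvec \<Rightarrow> real"
  assumes cont: "continuous_on (polydisc n z \<delta>) V" and z: "z \<in> Cn n" "\<delta> > 0"
    and lap: "\<And>z' i. z' \<in> polydisc n z \<delta> \<Longrightarrow> i < n \<Longrightarrow> \<exists>L\<ge>0. has_laplacian (\<lambda>w. V (z'(i := w))) (z' i) L"
    and le: "\<And>z'. z' \<in> polydisc n z \<delta> \<Longrightarrow> V z' \<le> V z" and z': "z' \<in> polydisc n z \<delta>"
  shows "V z' = V z"
proof -
  have "\<forall>z'\<in>polydisc n z \<delta>. (\<forall>i. m \<le> i \<longrightarrow> i < n \<longrightarrow> z' i = z i) \<longrightarrow> V z' = V z" if "m \<le> n" for m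
    using that
  proof (induction m)
    case 0
    have "z' = z" if "z' \<in> polydisc n z \<delta>" "\<forall>i. i < n \<longrightarrow> z' i = z i" for z'
    proof
      fix i show "z' i = z i" using that z by (cases "i < n") (auto simp: polydisc_def Cn_def)
    qed
    then show ?case by auto
  next
    case (Suc m)
    show ?case
    proof (intro ballI impI)
      fix y assume y: "y \<in> polydisc n z \<delta>" "\<forall>i. Suc m \<le> i \<longrightarrow> i < n \<longrightarrow> y i = z i"
      have m: "m < n" using Suc by simp
      have upd: "y(m := w) \<in> polydisc n z \<delta>" if "w \<in> ball (z m) \<delta>" for w
        using y(1) that m by (auto simp: polydisc_def dist_commute intro: Cn_upd)
      have base: "V (y(m := z m)) = V z"
      proof -
        have "\<forall>i. m \<le> i \<longrightarrow> i < n \<longrightarrow> (y(m := z m)) i = z i" using y(2) by (simp add: Suc_le_eq)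
        then show ?thesis using Suc.IH m upd[of "z m"] z by simp
      qed
      have "V (y(m := y m)) = V (y(m := z m))"
      proof (rule strong_maximum_principle[of "ball (z m) \<delta>" "\<lambda>w. V (y(m := w))"])
        show "continuous_on (ball (z m) \<delta>) (\<lambda>w. V (y(m := w)))"
          by (rule continuous_on_compose2[OF cont])
             (use upd in \<open>auto intro: continuous_on_upd[OF continuous_on_id continuous_on_const]\<close>)
        show "\<exists>L\<ge>0. has_laplacian (\<lambda>w. V (y(m := w))) w L" if "w \<in> ball (z m) \<delta>" for w
          using lap[OF upd[OF that] m] by simp
        show "V (y(m := w)) \<le> V (y(m := z m))" if "w \<in> ball (z m) \<delta>" for w
          using le[OF upd[OF that]] base by simp
        show "y m \<in> ball (z m) \<delta>" using y(1) m by (auto simp: polydisc_def dist_commute)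
      qed (use z in auto)
      then show "V y = V z" using base by simp
    qed
  qed
  from this[of n] z' show ?thesis by simp
qed

lemma connected_polydisc: "connected (polydisc n z \<delta>)"
proof -
  define X where "X = (\<lambda>i. if i < n then ball (z i) \<delta> else {0::complex})"
  have "polydisc n z \<delta> = (\<Pi>\<^sub>E i\<in>UNIV. X i)"
    by (auto simp: polydisc_def X_def Cn_def PiE_iff dist_commute split: if_splits)
  moreover have "connectedin (product_topology (\<lambda>i. euclidean) UNIV) (\<Pi>\<^sub>E i\<in>UNIV. X i)"
    by (simp add: connectedin_PiE X_def)
  ultimately show ?thesis by (simp add: euclidean_product_topology)
qed

section \<open>Charts as homeomorphisms onto relatively open sets\<close>

context
  fixes M :: "'a cmanifold" and V \<phi>
  assumes M: "complex_manifold M" and chart: "(V, \<phi>) \<in> catlas M"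
begin

lemma chart_open: "openin (ctop M) V"
  and chart_image_open: "Cn_open (cdim M) (\<phi> ` V)"
  and chart_homeo: "homeomorphic_map (subtopology (ctop M) V) (top_of_set (\<phi> ` V)) \<phi>"
  using M chart unfolding complex_manifold_def by auto

lemma chart_topspace: "topspace (subtopology (ctop M) V) = V"
  using openin_subset[OF chart_open] by auto

lemma chart_inj: "inj_on \<phi> V"
  using homeomorphic_imp_injective_map[OF chart_homeo] unfolding chart_topspace .

lemma chart_inv: "x \<in> V \<Longrightarrow> inv_into V \<phi> (\<phi> x) = x"
  using chart_inj by simp

lemma chart_inv_homeo: "homeomorphic_map (top_of_set (\<phi> ` V)) (subtopology (ctop M) V) (inv_into V \<phi>)"
proof -
  obtain g where g: "homeomorphic_maps (subtopology (ctop M) V) (top_of_set (\<phi> ` V)) \<phi> g"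
    using chart_homeo by (auto simp: homeomorphic_map_maps)
  then have "homeomorphic_map (top_of_set (\<phi> ` V)) (subtopology (ctop M) V) g"
    using homeomorphic_maps_map homeomorphic_maps_sym by blast
  moreover have "g z = inv_into V \<phi> z" if "z \<in> topspace (top_of_set (\<phi> ` V))" for z
    using that g chart_topspace chart_inv unfolding homeomorphic_maps_def by auto
  ultimately show ?thesis by (rule homeomorphic_map_eq)
qed

lemma chart_preimage_open:
  assumes "Cn_open (cdim M) \<Omega>" "\<Omega> \<subseteq> \<phi> ` V"
  shows "openin (ctop M) {x \<in> V. \<phi> x \<in> \<Omega>}"
proof -
  have "openin (top_of_set (\<phi> ` V)) \<Omega>"
    using assms by (metis openin_subset_trans openin_imp_subset chart_image_open)
  with homeomorphic_imp_continuous_map[OF chart_homeo]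
  have "openin (subtopology (ctop M) V) {x \<in> topspace (subtopology (ctop M) V). \<phi> x \<in> \<Omega>}"
    by (rule openin_continuous_map_preimage)
  then show ?thesis unfolding chart_topspace using chart_open openin_open_subtopology by blast
qed

lemma chart_image_open_Int:
  assumes "openin (ctop M) W"
  shows "Cn_open (cdim M) (\<phi> ` (V \<inter> W))"
proof -
  have "openin (subtopology (ctop M) V) (V \<inter> W)"
    using assms by (metis Int_commute openin_subtopology_Int)
  then have "openin (top_of_set (\<phi> ` V)) (\<phi> ` (V \<inter> W))"
    using chart_homeo homeomorphic_imp_open_map open_map_def by blast
  then show ?thesis using chart_image_open openin_trans by blast
qed

end

text \<open>On a component, which is compact, the continuous \<open>v\<close> has a maximum; the
  polydisc principle makes the set of maximum points open, and connectedness does the rest. The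
  neighbourhood in \<open>loc\<close> may depend on the point, because different points will need
  different affine pieces of the projective bundle.\<close>

lemma compact_mfd_max_principle:
  fixes v :: "'a \<Rightarrow> real"
  assumes M: "complex_manifold M" and cpt: "compact_space (ctop M)"
    and loc: "\<And>V \<phi> x. (V, \<phi>) \<in> catlas M \<Longrightarrow> x \<in> V \<Longrightarrow>
       \<exists>\<Omega>. Cn_open (cdim M) \<Omega> \<and> \<phi> x \<in> \<Omega> \<and> \<Omega> \<subseteq> \<phi> ` V \<and> continuous_on \<Omega> (\<lambda>z. v (inv_into V \<phi> z)) \<and>
         (\<forall>z\<in>\<Omega>. \<forall>i<cdim M. \<exists>L\<ge>0. has_laplacian (\<lambda>w. v (inv_into V \<phi> (z(i := w)))) (z i) L)"
    and xy: "connected_component_of (ctop M) x y"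
  shows "v x = v y"
proof -
  let ?X = "ctop M" and ?n = "cdim M"
  \<comment> \<open>All local information for one polydisc neighbourhood: connectedness will make
    components open, continuity will glue, and the last clause is the local maximum
    principle.\<close>
  have nbhd: "\<exists>B. openin ?X B \<and> y \<in> B \<and> connectedin ?X B \<and>
      continuous_map (subtopology ?X B) euclideanreal v \<and>
      ((\<forall>u\<in>B. v u \<le> v y) \<longrightarrow> (\<forall>u\<in>B. v u = v y))" if y: "y \<in> topspace ?X" for y
  proof -
    obtain V \<phi> where V: "(V, \<phi>) \<in> catlas M" "y \<in> V"
      using M y unfolding complex_manifold_def by blast
    note chart = M V(1)
    obtain \<Omega> where \<Omega>: "Cn_open ?n \<Omega>" "\<phi> y \<in> \<Omega>" "\<Omega> \<subseteq> \<phi> ` V" "continuous_on \<Omega> (\<lambda>z. v (inv_into V \<phi> z))"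
      "\<And>z i. z \<in> \<Omega> \<Longrightarrow> i < ?n \<Longrightarrow> \<exists>L\<ge>0. has_laplacian (\<lambda>w. v (inv_into V \<phi> (z(i := w)))) (z i) L"
      using loc[OF V] by blast
    obtain \<delta> where \<delta>: "\<delta> > 0" "polydisc ?n (\<phi> y) \<delta> \<subseteq> \<Omega>"
      using Cn_open_contains_polydisc[OF \<Omega>(1,2)] .
    define P where "P = polydisc ?n (\<phi> y) \<delta>"
    define B where "B = {x \<in> V. \<phi> x \<in> P}"
    have yC: "\<phi> y \<in> Cn ?n" using Cn_openD[OF \<Omega>(1,2)] .
    have PV: "P \<subseteq> \<phi> ` V" using \<delta> \<Omega>(3) by (auto simp: P_def)
    have B1: "openin ?X B" unfolding B_def
      by (rule chart_preimage_open[OF chart]) (use PV in \<open>auto simp: P_def Cn_open_polydisc\<close>)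
    have B2: "y \<in> B" using V centre_in_polydisc[OF yC \<delta>(1)] by (simp add: B_def P_def)
    have Beq: "B = inv_into V \<phi> ` P"
    proof
      show "B \<subseteq> inv_into V \<phi> ` P" using chart_inv[OF chart] by (force simp: B_def)
      show "inv_into V \<phi> ` P \<subseteq> B" using PV by (auto simp: B_def inv_into_into f_inv_into_f)
    qed
    have "connectedin (top_of_set (\<phi> ` V)) P"
      using connected_polydisc PV by (auto simp: connectedin_subtopology P_def)
    then have "connectedin (subtopology ?X V) B" unfolding Beq
      by (rule connectedin_continuous_map_image[OF homeomorphic_imp_continuous_map[OF chart_inv_homeo[OF chart]]])
    then have B3: "connectedin ?X B" by (simp add: connectedin_subtopology)
    have BV: "B \<subseteq> V" by (auto simp: B_def)
    have "continuous_map (subtopology ?X V) (top_of_set (\<phi> ` V)) \<phi>"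
      by (rule homeomorphic_imp_continuous_map[OF chart_homeo[OF chart]])
    then have "continuous_map (subtopology ?X V) euclidean \<phi>"
      using continuous_map_in_subtopology by blast
    then have "continuous_map (subtopology ?X B) euclidean \<phi>"
      using BV continuous_map_from_subtopology_mono by blast
    then have "continuous_map (subtopology ?X B) (top_of_set P) \<phi>"
      by (simp add: continuous_map_in_subtopology B_def image_subset_iff)
    moreover have "continuous_map (top_of_set P) euclideanreal (\<lambda>z. v (inv_into V \<phi> z))"
      using continuous_on_subset[OF \<Omega>(4)] \<delta>(2) by (simp add: P_def)
    ultimately have "continuous_map (subtopology ?X B) euclideanreal ((\<lambda>z. v (inv_into V \<phi> z)) \<circ> \<phi>)"
      by (rule continuous_map_compose)
    then have B4: "continuous_map (subtopology ?X B) euclideanreal v"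
      by (rule continuous_map_eq) (use chart_inv[OF chart] in \<open>auto simp: B_def\<close>)
    have B5: "v u = v y" if le: "\<forall>u\<in>B. v u \<le> v y" and u: "u \<in> B" for u
    proof -
      have "v (inv_into V \<phi> (\<phi> u)) = v (inv_into V \<phi> (\<phi> y))"
      proof (rule polydisc_maximum_principle[of ?n "\<phi> y" \<delta> "\<lambda>z. v (inv_into V \<phi> z)"])
        show "continuous_on (polydisc ?n (\<phi> y) \<delta>) (\<lambda>z. v (inv_into V \<phi> z))"
          by (rule continuous_on_subset[OF \<Omega>(4) \<delta>(2)])
        show "\<exists>L\<ge>0. has_laplacian (\<lambda>w. v (inv_into V \<phi> (z'(i := w)))) (z' i) L"
          if "z' \<in> polydisc ?n (\<phi> y) \<delta>" "i < ?n" for z' i using \<Omega>(5) \<delta>(2) that by blast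
        show "v (inv_into V \<phi> z') \<le> v (inv_into V \<phi> (\<phi> y))" if "z' \<in> polydisc ?n (\<phi> y) \<delta>" for z'
          using le that Beq chart_inv[OF chart V(2)] by (simp add: P_def)
      qed (use yC \<delta> u in \<open>auto simp: B_def P_def\<close>)
      then show ?thesis using chart_inv[OF chart] V u by (simp add: B_def)
    qed
    show ?thesis using B1 B2 B3 B4 B5 by blast
  qed
  have vcont: "continuous_map ?X euclideanreal v"
    unfolding continuous_map_def
  proof (intro conjI allI impI)
    fix U :: "real set" assume U: "openin euclideanreal U"
    show "openin ?X {x \<in> topspace ?X. v x \<in> U}"
    proof (subst openin_subopen, intro ballI)
      fix y assume y: "y \<in> {x \<in> topspace ?X. v x \<in> U}"
      obtain B where B: "openin ?X B" "y \<in> B" "continuous_map (subtopology ?X B) euclideanreal v"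
      proof -
        have "y \<in> topspace ?X" using y by simp
        from nbhd[OF this] that show ?thesis by blast
      qed
      have "openin (subtopology ?X B) {x \<in> topspace (subtopology ?X B). v x \<in> U}"
        using B(3) U by (rule openin_continuous_map_preimage)
      then have "openin ?X {x \<in> topspace (subtopology ?X B). v x \<in> U}"
        using B(1) openin_open_subtopology by blast
      then show "\<exists>T. openin ?X T \<and> y \<in> T \<and> T \<subseteq> {x \<in> topspace ?X. v x \<in> U}"
        using B y by (intro exI[of _ "{x \<in> topspace (subtopology ?X B). v x \<in> U}"]) auto
    qed
  qed auto
  define C where "C = connected_component_of_set ?X x"
  have xC: "x \<in> C" "y \<in> C" using xy by (auto simp: C_def connected_component_of_refl connected_component_in_topspace)
  have CX: "C \<subseteq> topspace ?X" unfolding C_def by (rule connected_component_of_subset_topspace)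
  have Cconn: "connectedin ?X C" unfolding C_def by (rule connectedin_connected_component_of)
  have "compactin ?X C" unfolding C_def
    by (rule closedin_compact_space[OF cpt closedin_connected_component_of])
  then have "compact (v ` C)" using image_compactin[OF _ vcont] by simp
  then obtain p where p: "p \<in> C" "\<And>u. u \<in> C \<Longrightarrow> v u \<le> v p"
    using compact_attains_sup[of "v ` C"] xC(1) by blast
  have inC: "B \<subseteq> C" if "connectedin ?X B" "u \<in> B" "u \<in> C" for B u
    using that connected_component_of_maximal[of ?X B u] connected_component_of_trans[of ?X x u]
    unfolding C_def by blast
  define S where "S = {u \<in> C. v u = v p}"
  have Sopen: "openin ?X S"
  proof (subst openin_subopen, intro ballI)
    fix u assume u: "u \<in> S"
    obtain B where B: "openin ?X B" "u \<in> B" "connectedin ?X B" "(\<forall>w\<in>B. v w \<le> v u) \<longrightarrow> (\<forall>w\<in>B. v w = v u)"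
    proof -
      have "u \<in> topspace ?X" using u CX by (auto simp: S_def)
      from nbhd[OF this] that show ?thesis by blast
    qed
    have uC: "u \<in> C" "v u = v p" using u by (simp_all add: S_def)
    have BC: "B \<subseteq> C" by (rule inC[OF B(3,2) uC(1)])
    then have "\<forall>w\<in>B. v w \<le> v u" using p(2) uC(2) by (simp add: subset_iff)
    then have "\<forall>w\<in>B. v w = v u" using B(4) by (rule mp[rotated])
    then have "B \<subseteq> S" using BC uC(2) unfolding S_def by (simp add: subset_iff)
    then show "\<exists>T. openin ?X T \<and> u \<in> T \<and> T \<subseteq> S" using B by blast
  qed
  have Copen: "openin ?X C"
  proof (subst openin_subopen, intro ballI)
    fix u assume u: "u \<in> C"
    obtain B where "openin ?X B" "u \<in> B" "connectedin ?X B"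
      using nbhd[OF subsetD[OF CX u]] by blast
    then show "\<exists>T. openin ?X T \<and> u \<in> T \<and> T \<subseteq> C" using inC[of B u] u by blast
  qed
  have "openin ?X {u \<in> topspace ?X. v u \<in> - {v p}}"
    by (rule openin_continuous_map_preimage[OF vcont]) auto
  then have "openin ?X (C \<inter> {u \<in> topspace ?X. v u \<in> - {v p}})" using Copen by blast
  moreover have "C \<inter> {u \<in> topspace ?X. v u \<in> - {v p}} = C - S" using CX by (auto simp: S_def)
  ultimately have "openin ?X (C - S)" by simp
  moreover have "\<not> (openin ?X S \<and> openin ?X (C - S) \<and> C \<subseteq> S \<union> (C - S) \<and> S \<inter> (C - S) \<inter> C = {} \<and>
      S \<inter> C \<noteq> {} \<and> (C - S) \<inter> C \<noteq> {})"
    using Cconn unfolding connectedin by blast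
  moreover have "S \<inter> C \<noteq> {}" using p(1) by (auto simp: S_def)
  ultimately have "C - S = {}" using Sopen by blast
  then have "v u = v p" if "u \<in> C" for u using that by (auto simp: S_def)
  then show ?thesis using xC by simp
qed

section \<open>Levi forms along holomorphic discs\<close>

lemma Ck_Cn_wirt:
  assumes \<Omega>: "Cn_open n \<Omega>" and f: "Ck_Cn (Suc k) n \<Omega> f" and j: "j < n"
  shows "Ck_Cn k n \<Omega> (wirt j f)" "Ck_Cn k n \<Omega> (wirt_bar j f)"
proof -
  have "Ck_Cn k n \<Omega> (\<lambda>z. (1/2) * pd j 1 f z + c * pd j \<i> f z)" for c
    by (intro Ck_Cn_add Ck_Cn_mult Ck_Cn_const \<Omega> Ck_Cn_pd[OF f j]) auto
  note Ck = this
  show "Ck_Cn k n \<Omega> (wirt j f)"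
    by (rule Ck_Cn_cong[OF \<Omega> _ Ck[of "- \<i> / 2"]]) (simp add: wirt_def diff_divide_distrib)
  show "Ck_Cn k n \<Omega> (wirt_bar j f)"
    by (rule Ck_Cn_cong[OF \<Omega> _ Ck[of "\<i> / 2"]]) (simp add: wirt_bar_def add_divide_distrib)
qed

lemma pd_wirt:
  assumes f: "Ck_Cn (Suc (Suc k)) n \<Omega> f" and z: "z \<in> \<Omega>" and l: "l < n" "e \<in> {1, \<i>}" and j: "j < n"
  shows "pd l e (wirt j f) z = (pd l e (pd j 1 f) z - \<i> * pd l e (pd j \<i> f) z) / 2"
    and "pd l e (wirt_bar j f) z = (pd l e (pd j 1 f) z + \<i> * pd l e (pd j \<i> f) z) / 2"
proof -
  have 1: "((\<lambda>t::real. pd j 1 f (z(l := z l + of_real t * e))) has_vector_derivative pd l e (pd j 1 f) z) (at 0)"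
    by (rule pd_has_vector_derivative[OF Ck_Cn_pd[OF f j] z l]) simp
  have 2: "((\<lambda>t::real. pd j \<i> f (z(l := z l + of_real t * e))) has_vector_derivative pd l e (pd j \<i> f) z) (at 0)"
    by (rule pd_has_vector_derivative[OF Ck_Cn_pd[OF f j] z l]) simp
  show "pd l e (wirt j f) z = (pd l e (pd j 1 f) z - \<i> * pd l e (pd j \<i> f) z) / 2"
    using has_vector_derivative_divide[OF has_vector_derivative_diff[OF 1 has_vector_derivative_mult_right[OF 2, of \<i>]], of 2]
    by (intro pd_eqI) (simp add: wirt_def)
  show "pd l e (wirt_bar j f) z = (pd l e (pd j 1 f) z + \<i> * pd l e (pd j \<i> f) z) / 2"
    using has_vector_derivative_divide[OF has_vector_derivative_add[OF 1 has_vector_derivative_mult_right[OF 2, of \<i>]], of 2]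
    by (intro pd_eqI) (simp add: wirt_bar_def)
qed

lemma wirt_commute:
  assumes \<Omega>: "Cn_open n \<Omega>" and f: "Ck_Cn (Suc (Suc k)) n \<Omega> f" and z: "z \<in> \<Omega>" and jl: "j < n" "l < n"
  shows "wirt_bar j (wirt l f) z = wirt l (wirt_bar j f) z"
proof -
  have c: "pd j d (pd l e f) z = pd l e (pd j d f) z" if "d \<in> {1, \<i>}" "e \<in> {1, \<i>}" for d e
    using pd_commute[OF \<Omega> f z jl(2) that(2) jl(1) that(1)] .
  show ?thesis
    unfolding wirt_bar_def[of j "wirt l f"] wirt_def[of l "wirt_bar j f"]
    using jl by (simp add: pd_wirt[OF f z] c field_simps)
qed

lemma cnj_pd:
  assumes f: "Ck_Cn (Suc k) n \<Omega> f" and z: "z \<in> \<Omega>" and j: "j < n" "d \<in> {1, \<i>}"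
  shows "cnj (pd j d f z) = pd j d (\<lambda>z. cnj (f z)) z"
  using bounded_linear.has_vector_derivative[OF bounded_linear_cnj pd_has_vector_derivative[OF f z j]]
  by (intro pd_eqI[symmetric])

lemma cnj_wirt:
  assumes f: "Ck_Cn (Suc k) n \<Omega> f" and z: "z \<in> \<Omega>" and j: "j < n"
  shows "cnj (wirt j f z) = wirt_bar j (\<lambda>z. cnj (f z)) z" "cnj (wirt_bar j f z) = wirt j (\<lambda>z. cnj (f z)) z"
  by (simp_all add: wirt_def wirt_bar_def cnj_pd[OF f z j])

text \<open>For a real function conjugation exchanges the two kinds of Wirtinger derivative, and
  these commute.\<close>

lemma levi_hermitian:
  assumes \<Omega>: "Cn_open n \<Omega>" and f: "Ck_Cn (Suc (Suc k)) n \<Omega> f" and z: "z \<in> \<Omega>" and jl: "j < n" "l < n"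
    and real: "\<And>z. z \<in> \<Omega> \<Longrightarrow> cnj (f z) = f z"
  shows "cnj (wirt j (wirt_bar l f) z) = wirt l (wirt_bar j f) z"
proof -
  have "cnj (wirt j (wirt_bar l f) z) = wirt_bar j (\<lambda>z. cnj (wirt_bar l f z)) z"
    by (rule cnj_wirt(1)[OF Ck_Cn_wirt(2)[OF \<Omega> f jl(2)] z jl(1)])
  also have "\<dots> = wirt_bar j (wirt l f) z"
  proof (rule wirt_cong(2)[OF \<Omega> _ z jl(1)])
    fix y assume y: "y \<in> \<Omega>"
    have "cnj (wirt_bar l f y) = wirt l (\<lambda>z. cnj (f z)) y" by (rule cnj_wirt(2)[OF f y jl(2)])
    also have "\<dots> = wirt l f y" by (rule wirt_cong(1)[OF \<Omega> real y jl(2)])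
    finally show "cnj (wirt_bar l f y) = wirt l f y" .
  qed
  also have "\<dots> = wirt l (wirt_bar j f) z" by (rule wirt_commute[OF \<Omega> f z jl])
  finally show ?thesis .
qed

text \<open>The equality case of Cauchy-Schwarz. Moving the null vector \<open>g\<close> by
  \<open>t\<close> times \<open>\<eta>\<close>, its image under the matrix, gives the form the value
  \<open>2 * t * S + t\<^sup>2 * Re (Q \<eta> \<eta>)\<close>; if \<open>S\<close> were positive,
  the linear term would win for small negative \<open>t\<close>.\<close>

lemma psd_null_vector:
  fixes T :: "nat \<Rightarrow> nat \<Rightarrow> complex"
  assumes herm: "\<And>j k. j < n \<Longrightarrow> k < n \<Longrightarrow> cnj (T j k) = T k j"
    and psd: "\<And>\<xi>. 0 \<le> Re (\<Sum>j<n. \<Sum>k<n. T j k * \<xi> j * cnj (\<xi> k))"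
    and null: "Re (\<Sum>j<n. \<Sum>k<n. T j k * g j * cnj (g k)) = 0" and k: "k < n"
  shows "(\<Sum>j<n. T j k * g j) = 0"
proof -
  define \<eta> where "\<eta> = (\<lambda>k. \<Sum>j<n. T j k * g j)"
  define Q where "Q = (\<lambda>\<xi> \<zeta>. \<Sum>j<n. \<Sum>k<n. T j k * \<xi> j * cnj (\<zeta> k))"
  define S where "S = (\<Sum>k<n. (cmod (\<eta> k))\<^sup>2)"
  have S: "(\<Sum>k<n. \<eta> k * cnj (\<eta> k)) = of_real S"
    unfolding S_def of_real_sum by (intro sum.cong refl) (metis complex_norm_square)
  have Q1: "Q g \<eta> = of_real S"
  proof -
    have "Q g \<eta> = (\<Sum>k<n. \<eta> k * cnj (\<eta> k))"
      unfolding Q_def by (subst sum.swap) (simp add: \<eta>_def sum_distrib_right)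
    then show ?thesis by (simp add: S)
  qed
  have Q2: "Q \<eta> g = of_real S"
  proof -
    have "Q \<eta> g = (\<Sum>j<n. \<eta> j * (\<Sum>k<n. T j k * cnj (g k)))"
      unfolding Q_def by (simp add: sum_distrib_left mult_ac)
    also have "\<dots> = (\<Sum>j<n. \<eta> j * cnj (\<eta> j))"
      by (intro sum.cong refl arg_cong2[where f = "(*)"]) (simp add: \<eta>_def herm)
    finally show ?thesis by (simp add: S)
  qed
  have exp: "Re (Q (\<lambda>i. g i + of_real t * \<eta> i) (\<lambda>i. g i + of_real t * \<eta> i)) = 2 * t * S + t\<^sup>2 * Re (Q \<eta> \<eta>)" for t :: real
  proof -
    have "Q (\<lambda>i. g i + of_real t * \<eta> i) (\<lambda>i. g i + of_real t * \<eta> i)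
        = Q g g + of_real t * Q g \<eta> + of_real t * Q \<eta> g + of_real (t\<^sup>2) * Q \<eta> \<eta>"
      unfolding Q_def
      by (simp add: algebra_simps sum.distrib sum_distrib_left power2_eq_square)
    then have "Re (Q (\<lambda>i. g i + of_real t * \<eta> i) (\<lambda>i. g i + of_real t * \<eta> i))
        = Re (Q g g) + t * S + t * S + t\<^sup>2 * Re (Q \<eta> \<eta>)"
      unfolding Q1 Q2 by simp
    then show ?thesis using null by (simp add: Q_def)
  qed
  have S0: "S \<ge> 0" by (simp add: S_def sum_nonneg)
  have "S = 0"
  proof (rule ccontr)
    assume "S \<noteq> 0"
    then have Sp: "S > 0" using S0 by simp
    \<comment> \<open>\<open>a\<close> bounds the quadratic coefficient and is positive whatever the
      sign of \<open>q\<close>, so that \<open>t = - S / a\<close> makes the form at most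
      \<open>- (S\<^sup>2 / a)\<close>.\<close>
    define q a where "q = Re (Q \<eta> \<eta>)" and "a = \<bar>q\<bar> + 1"
    have a: "a > 0" "q \<le> a" by (auto simp: a_def)
    have "0 \<le> 2 * (- S / a) * S + (- S / a)\<^sup>2 * q"
      using psd[of "\<lambda>i. g i + of_real (- S / a) * \<eta> i"] exp[of "- S / a"] by (simp add: Q_def q_def)
    also have "\<dots> \<le> 2 * (- S / a) * S + (- S / a)\<^sup>2 * a"
      using a by (intro add_left_mono mult_left_mono) auto
    also have "\<dots> = - (S\<^sup>2 / a)" using a by (simp add: power2_eq_square field_simps)
    also have "\<dots> < 0" using Sp a by simp
    finally show False by simp
  qed
  then have "\<forall>k\<in>{..<n}. (cmod (\<eta> k))\<^sup>2 = 0" unfolding S_def by (subst (asm) sum_nonneg_eq_0_iff) auto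
  then show ?thesis using k by (simp add: \<eta>_def)
qed

section \<open>Laplacians of real parts and of logarithms of moduli\<close>

lemma has_real_derivative_line:
  fixes F :: "complex \<Rightarrow> complex"
  assumes "(F has_derivative F') (at (w + of_real t * d))"
  shows "((\<lambda>t. Re (F (w + of_real t * d))) has_real_derivative Re (F' d)) (at t)"
proof -
  have "((\<lambda>t::real. w + of_real t * d) has_derivative (\<lambda>h. of_real h * d)) (at t)"
    by (auto intro!: derivative_eq_intros)
  from has_derivative_compose[OF this assms]
  have "((\<lambda>t. F (w + of_real t * d)) has_derivative (\<lambda>h. F' (of_real h * d))) (at t)" .
  then have 1: "((\<lambda>t. Re (F (w + of_real t * d))) has_derivative (\<lambda>h. Re (F' (of_real h * d)))) (at t)"
    by (rule has_derivative_Re)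
  have "F' (of_real h * d) = h *\<^sub>R F' d" for h
    using linear_scale[OF has_derivative_linear[OF assms], of h d] by (simp add: scaleR_conv_of_real)
  then have "(\<lambda>h. Re (F' (of_real h * d))) = (\<lambda>h. Re (F' d) * h)" by (simp add: fun_eq_iff mult.commute)
  with 1 show ?thesis by (simp add: has_field_derivative_def)
qed

text \<open>The terms of the second derivative that are quadratic in the direction \<open>d\<close>,
  or in its conjugate, cancel between the directions 1 and \<i>; the mixed coefficients
  \<open>b\<close> and \<open>a'\<close> remain. Keeping both avoids any appeal to symmetry of
  second derivatives.\<close>

lemma has_laplacian_Re:
  fixes F A B :: "complex \<Rightarrow> complex"
  assumes D: "open D" "w \<in> D"
    and F: "\<And>w. w \<in> D \<Longrightarrow> (F has_derivative (\<lambda>h. A w * h + B w * cnj h)) (at w)"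
    and A: "(A has_derivative (\<lambda>h. a * h + b * cnj h)) (at w)"
    and B: "(B has_derivative (\<lambda>h. a' * h + b' * cnj h)) (at w)"
  shows "has_laplacian (\<lambda>w. Re (F w)) w (2 * Re (b + a'))"
proof -
  have "has_deriv2 (\<lambda>t. Re (F (w + of_real t * d))) (Re ((a * d + b * cnj d) * d + (a' * d + b' * cnj d) * cnj d))" for d
  proof (rule has_deriv2I[where g' = "\<lambda>t. Re (A (w + of_real t * d) * d + B (w + of_real t * d) * cnj d)"])
    have "\<forall>\<^sub>F w' in nhds w. w' \<in> D" using D by (rule eventually_nhds_in_open)
    then have "\<forall>\<^sub>F t::real in nhds 0. w + of_real t * d \<in> D" by (rule eventually_nhds_line)
    then show "\<forall>\<^sub>F t in nhds 0. ((\<lambda>t. Re (F (w + of_real t * d))) has_real_derivative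
        Re (A (w + of_real t * d) * d + B (w + of_real t * d) * cnj d)) (at t)"
      by eventually_elim (rule has_real_derivative_line[OF F])
    have "((\<lambda>w. A w * d + B w * cnj d) has_derivative (\<lambda>h. (a * h + b * cnj h) * d + (a' * h + b' * cnj h) * cnj d)) (at w)"
      by (intro has_derivative_add has_derivative_mult_left A B)
    then show "((\<lambda>t. Re (A (w + of_real t * d) * d + B (w + of_real t * d) * cnj d)) has_real_derivative
        Re ((a * d + b * cnj d) * d + (a' * d + b' * cnj d) * cnj d)) (at 0)"
      by (intro has_real_derivative_line[where F = "\<lambda>w. A w * d + B w * cnj d"]) simp
  qed
  note h2 = this
  have "has_deriv2 (\<lambda>t. Re (F (w + of_real t))) (Re (a + b + (a' + b')))" using h2[of 1] by simp
  moreover have "has_deriv2 (\<lambda>t. Re (F (w + of_real t * \<i>))) (Re (- a + b + (a' - b')))"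
    using h2[of \<i>] by (simp add: algebra_simps)
  moreover have "2 * Re (b + a') = Re (a + b + (a' + b')) + Re (- a + b + (a' - b'))" by simp
  ultimately show ?thesis unfolding has_laplacian_def by blast
qed

lemma has_laplacian_Re_holomorphic:
  assumes D: "open D" "w \<in> D" and F: "F holomorphic_on D"
  shows "has_laplacian (\<lambda>w. Re (F w)) w 0"
proof -
  have 1: "(F has_derivative (\<lambda>h. deriv F w * h + 0 * cnj h)) (at w)" if "w \<in> D" for w
    using holomorphic_derivI[OF F D(1) that] by (simp add: has_field_derivative_def)
  have 2: "(deriv F has_derivative (\<lambda>h. deriv (deriv F) w * h + 0 * cnj h)) (at w)"
    using holomorphic_derivI[OF holomorphic_deriv[OF F D(1)] D] by (simp add: has_field_derivative_def)
  have 3: "((\<lambda>w. 0) has_derivative (\<lambda>h. 0 * h + 0 * cnj h)) (at w)" by simp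
  show ?thesis using has_laplacian_Re[OF D 1 2 3] by simp
qed

lemma has_laplacian_ln_cmod:
  assumes D: "open D" "w \<in> D" and l: "l holomorphic_on D" "l w \<noteq> 0"
  shows "has_laplacian (\<lambda>w. 2 * ln (cmod (l w))) w 0"
proof -
  \<comment> \<open>Dividing by \<open>l w\<close> brings the values near \<open>w\<close> into the
    unit disc around 1, away from the branch cut of \<open>Ln\<close>; the constant is added back at
    the end.\<close>
  define S where "S = (\<lambda>v. l v / l w)"
  have Sh: "S holomorphic_on D" unfolding S_def using l by (intro holomorphic_intros) auto
  define D' where "D' = D \<inter> S -` ball 1 1"
  have D': "open D'" "w \<in> D'"
    unfolding D'_def using D l continuous_on_open_vimage[OF D(1)] holomorphic_on_imp_continuous_on[OF Sh]
    by (auto simp: S_def Int_commute)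
  have S1: "S v \<notin> \<real>\<^sub>\<le>\<^sub>0" if "v \<in> D'" for v
  proof
    assume "S v \<in> \<real>\<^sub>\<le>\<^sub>0"
    then have "Re (1 - S v) \<ge> 1" by (auto simp: complex_nonpos_Reals_iff)
    then have "cmod (1 - S v) \<ge> 1" using complex_Re_le_cmod[of "1 - S v"] by linarith
    then show False using that by (auto simp: D'_def dist_norm)
  qed
  have "(\<lambda>v. Ln (S v)) holomorphic_on D'"
    using S1 by (intro holomorphic_intros holomorphic_on_subset[OF Sh]) (auto simp: D'_def)
  then have lap: "has_laplacian (\<lambda>v. Re (Ln (S v))) w 0" by (rule has_laplacian_Re_holomorphic[OF D'])
  have c: "has_laplacian (\<lambda>v. ln (cmod (l w))) w 0"
    unfolding has_laplacian_def using has_deriv2_const by (intro exI[of _ 0]) simp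
  have "has_laplacian (\<lambda>v. 2 * (ln (cmod (l w)) + Re (Ln (S v)))) w (2 * (0 + 0))"
    by (rule has_laplacian_cmult[OF has_laplacian_add[OF c lap]])
  then have "has_laplacian (\<lambda>v. 2 * (ln (cmod (l w)) + Re (Ln (S v)))) w 0" by simp
  then show ?thesis
  proof (rule has_laplacian_cong)
    have "\<forall>\<^sub>F v in nhds w. v \<in> D'" using D' by (rule eventually_nhds_in_open)
    then show "\<forall>\<^sub>F v in nhds w. 2 * (ln (cmod (l w)) + Re (Ln (S v))) = 2 * ln (cmod (l v))"
    proof eventually_elim
      case (elim v)
      then have "S v \<noteq> 0" using S1 by fastforce
      then have lv: "l v \<noteq> 0" by (auto simp: S_def)
      have "Re (Ln (S v)) = ln (cmod (S v))" using \<open>S v \<noteq> 0\<close> by (rule Re_Ln)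
      also have "\<dots> = ln (cmod (l v)) - ln (cmod (l w))"
        using lv l(2) by (simp add: S_def norm_divide ln_div)
      finally show ?case by simp
    qed
  qed
qed

text \<open>Meant for images of coordinate discs of the base under a local section; pulling back to
  the disc turns a Levi form into a Laplacian in one variable.\<close>

locale holo_disc =
  fixes n :: nat and \<Omega> :: "cvec set" and D :: "complex set" and \<gamma> :: "complex \<Rightarrow> cvec"
  assumes \<Omega>: "Cn_open n \<Omega>" and D: "open D" and \<gamma>: "\<And>w. w \<in> D \<Longrightarrow> \<gamma> w \<in> \<Omega>"
    and hol: "\<And>i. i < n \<Longrightarrow> (\<lambda>w. \<gamma> w i) holomorphic_on D"
begin

definition g :: "nat \<Rightarrow> complex \<Rightarrow> complex" where "g i = deriv (\<lambda>w. \<gamma> w i)"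

lemma has_derivative_comp:
  assumes F: "Ck_Cn (Suc k) n \<Omega> F" and w: "w \<in> D"
  shows "((\<lambda>w. F (\<gamma> w)) has_derivative
     (\<lambda>h. (\<Sum>i<n. wirt i F (\<gamma> w) * g i w) * h + (\<Sum>i<n. wirt_bar i F (\<gamma> w) * cnj (g i w)) * cnj h)) (at w)"
proof -
  have "((\<lambda>w. F (\<gamma> w)) has_derivative
     (\<lambda>h. \<Sum>i<n. wirt i F (\<gamma> w) * (g i w * h) + wirt_bar i F (\<gamma> w) * cnj (g i w * h))) (at w)"
  proof (rule Cn_chain_rule[OF \<Omega> F D w _ \<gamma>])
    show "continuous_on D (\<lambda>x. \<gamma> x i)" if "i < n" for i
      using hol[OF that] by (rule holomorphic_on_imp_continuous_on)
    show "((\<lambda>x. \<gamma> x i) has_derivative (*) (g i w)) (at w)" if "i < n" for i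
      using holomorphic_derivI[OF hol[OF that] D w] by (simp add: g_def has_field_derivative_def)
  qed
  then show ?thesis by (simp add: sum.distrib sum_distrib_right mult.assoc)
qed

lemma g_has_derivative:
  assumes "i < n" "w \<in> D"
  shows "(g i has_derivative (\<lambda>h. deriv (g i) w * h)) (at w)"
  using holomorphic_derivI[OF holomorphic_deriv[OF hol[OF assms(1)] D] D assms(2)]
  by (simp add: g_def has_field_derivative_def)

definition levi :: "(cvec \<Rightarrow> complex) \<Rightarrow> complex \<Rightarrow> complex" where
  "levi f w = (\<Sum>j<n. \<Sum>k<n. wirt j (wirt_bar k f) (\<gamma> w) * g j w * cnj (g k w))"

text \<open>As \<open>\<gamma>\<close> is holomorphic, its second derivatives contribute only to the
  unmixed second derivatives of the composition. The mixed ones computed from \<open>A\<close> and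
  from \<open>B\<close> agree by \<open>wirt_commute\<close>.\<close>

lemma has_laplacian_comp:
  assumes f: "Ck_Cn (Suc (Suc k)) n \<Omega> f" and w: "w \<in> D"
  shows "has_laplacian (\<lambda>w. Re (f (\<gamma> w))) w (4 * Re (levi f w))"
proof -
  define A where "A = (\<lambda>w. \<Sum>i<n. wirt i f (\<gamma> w) * g i w)"
  define B where "B = (\<lambda>w. \<Sum>i<n. wirt_bar i f (\<gamma> w) * cnj (g i w))"
  define \<alpha> where "\<alpha> = (\<lambda>F. \<Sum>j<n. wirt j F (\<gamma> w) * g j w)"
  define \<beta> where "\<beta> = (\<lambda>F. \<Sum>j<n. wirt_bar j F (\<gamma> w) * cnj (g j w))"
  have dA: "((\<lambda>w. wirt i f (\<gamma> w)) has_derivative (\<lambda>h. \<alpha> (wirt i f) * h + \<beta> (wirt i f) * cnj h)) (at w)"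
    and dB: "((\<lambda>w. wirt_bar i f (\<gamma> w)) has_derivative (\<lambda>h. \<alpha> (wirt_bar i f) * h + \<beta> (wirt_bar i f) * cnj h)) (at w)"
    if "i < n" for i
    unfolding \<alpha>_def \<beta>_def
    by (rule has_derivative_comp[OF Ck_Cn_wirt(1)[OF \<Omega> f that] w] has_derivative_comp[OF Ck_Cn_wirt(2)[OF \<Omega> f that] w])+
  have cg: "((\<lambda>w. cnj (g i w)) has_derivative (\<lambda>h. cnj (deriv (g i) w * h))) (at w)" if "i < n" for i
    using bounded_linear.has_derivative[OF bounded_linear_cnj g_has_derivative[OF that w]] .
  have "(A has_derivative (\<lambda>h. \<Sum>i<n. wirt i f (\<gamma> w) * (deriv (g i) w * h)
        + (\<alpha> (wirt i f) * h + \<beta> (wirt i f) * cnj h) * g i w)) (at w)"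
    unfolding A_def by (intro has_derivative_sum has_derivative_mult dA g_has_derivative w) auto
  moreover have "(\<lambda>h. \<Sum>i<n. wirt i f (\<gamma> w) * (deriv (g i) w * h)
        + (\<alpha> (wirt i f) * h + \<beta> (wirt i f) * cnj h) * g i w)
      = (\<lambda>h. (\<Sum>i<n. wirt i f (\<gamma> w) * deriv (g i) w + \<alpha> (wirt i f) * g i w) * h
        + (\<Sum>i<n. \<beta> (wirt i f) * g i w) * cnj h)"
    by (simp add: fun_eq_iff sum_distrib_left sum_distrib_right sum.distrib algebra_simps)
  ultimately have A': "(A has_derivative (\<lambda>h. (\<Sum>i<n. wirt i f (\<gamma> w) * deriv (g i) w + \<alpha> (wirt i f) * g i w) * h
        + (\<Sum>i<n. \<beta> (wirt i f) * g i w) * cnj h)) (at w)" by simp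
  have "(B has_derivative (\<lambda>h. \<Sum>i<n. wirt_bar i f (\<gamma> w) * cnj (deriv (g i) w * h)
        + (\<alpha> (wirt_bar i f) * h + \<beta> (wirt_bar i f) * cnj h) * cnj (g i w))) (at w)"
    unfolding B_def by (intro has_derivative_sum has_derivative_mult dB cg) auto
  moreover have "(\<lambda>h. \<Sum>i<n. wirt_bar i f (\<gamma> w) * cnj (deriv (g i) w * h)
        + (\<alpha> (wirt_bar i f) * h + \<beta> (wirt_bar i f) * cnj h) * cnj (g i w))
      = (\<lambda>h. (\<Sum>i<n. \<alpha> (wirt_bar i f) * cnj (g i w)) * h
        + (\<Sum>i<n. wirt_bar i f (\<gamma> w) * cnj (deriv (g i) w) + \<beta> (wirt_bar i f) * cnj (g i w)) * cnj h)"
    by (simp add: fun_eq_iff sum_distrib_left sum_distrib_right sum.distrib algebra_simps)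
  ultimately have B': "(B has_derivative (\<lambda>h. (\<Sum>i<n. \<alpha> (wirt_bar i f) * cnj (g i w)) * h
        + (\<Sum>i<n. wirt_bar i f (\<gamma> w) * cnj (deriv (g i) w) + \<beta> (wirt_bar i f) * cnj (g i w)) * cnj h)) (at w)" by simp
  have F: "((\<lambda>w. f (\<gamma> w)) has_derivative (\<lambda>h. A w * h + B w * cnj h)) (at w)" if "w \<in> D" for w
    unfolding A_def B_def by (rule has_derivative_comp[OF f that])
  have 1: "(\<Sum>i<n. \<alpha> (wirt_bar i f) * cnj (g i w)) = levi f w"
    unfolding levi_def \<alpha>_def by (subst sum.swap) (simp add: sum_distrib_right)
  have 2: "(\<Sum>i<n. \<beta> (wirt i f) * g i w) = levi f w"
  proof -
    have "(\<Sum>i<n. \<beta> (wirt i f) * g i w) = (\<Sum>i<n. \<Sum>j<n. wirt_bar j (wirt i f) (\<gamma> w) * cnj (g j w) * g i w)"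
      by (simp add: \<beta>_def sum_distrib_right)
    also have "\<dots> = levi f w"
      unfolding levi_def
    proof (intro sum.cong refl)
      fix i j assume "i \<in> {..<n}" "j \<in> {..<n}"
      then show "wirt_bar j (wirt i f) (\<gamma> w) * cnj (g j w) * g i w = wirt i (wirt_bar j f) (\<gamma> w) * g i w * cnj (g j w)"
        using wirt_commute[OF \<Omega> f \<gamma>[OF w], of j i] by simp
    qed
    finally show ?thesis .
  qed
  from has_laplacian_Re[OF D w F A' B'] show ?thesis by (simp add: 1 2)
qed

text \<open>The antiholomorphic derivative of \<open>wirt l f\<close> along the disc is the
  conjugate of entry \<open>l\<close> of the Levi matrix applied to the velocity. The velocity is a
  null vector, so \<open>psd_null_vector\<close> makes this entry vanish, and the remaining
  derivative is complex linear.\<close>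

lemma wirt_comp_field_differentiable:
  assumes f: "Ck_Cn (Suc (Suc k)) n \<Omega> f" and w: "w \<in> D"
    and real: "\<And>z. z \<in> \<Omega> \<Longrightarrow> cnj (f z) = f z"
    and psd: "\<And>\<xi>. 0 \<le> Re (\<Sum>j<n. \<Sum>k<n. wirt j (wirt_bar k f) (\<gamma> w) * \<xi> j * cnj (\<xi> k))"
    and null: "Re (levi f w) = 0" and l: "l < n"
  shows "(\<lambda>w. wirt l f (\<gamma> w)) field_differentiable (at w)"
proof -
  have herm: "cnj (wirt j (wirt_bar k f) (\<gamma> w)) = wirt k (wirt_bar j f) (\<gamma> w)" if "j < n" "k < n" for j k
    by (rule levi_hermitian[OF \<Omega> f \<gamma>[OF w] that real])
  have "(\<Sum>j<n. wirt j (wirt_bar l f) (\<gamma> w) * g j w) = 0"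
    by (rule psd_null_vector[OF herm psd null[unfolded levi_def] l])
  then have "cnj (\<Sum>j<n. wirt j (wirt_bar l f) (\<gamma> w) * g j w) = 0" by simp
  moreover have "cnj (\<Sum>j<n. wirt j (wirt_bar l f) (\<gamma> w) * g j w) = (\<Sum>j<n. wirt_bar j (wirt l f) (\<gamma> w) * cnj (g j w))"
    using herm[of _ l] wirt_commute[OF \<Omega> f \<gamma>[OF w]] l by (simp del: sum.lessThan_Suc)
  ultimately have z: "(\<Sum>j<n. wirt_bar j (wirt l f) (\<gamma> w) * cnj (g j w)) = 0" by simp
  have "((\<lambda>w. wirt l f (\<gamma> w)) has_derivative (\<lambda>h. (\<Sum>i<n. wirt i (wirt l f) (\<gamma> w) * g i w) * h)) (at w)"
    using has_derivative_comp[OF Ck_Cn_wirt(1)[OF \<Omega> f l] w] by (simp add: z)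
  then show ?thesis unfolding field_differentiable_def has_field_derivative_def by blast
qed

end

section \<open>Hyperplanes and linear functionals\<close>

text \<open>Off the fibre the values of a functional are arbitrary, so functionals are compared on
  \<open>fib E x\<close> throughout.\<close>

definition lin_on :: "('x, 'v) vbundle \<Rightarrow> 'x \<Rightarrow> ('v \<Rightarrow> complex) \<Rightarrow> bool" where
  "lin_on E x \<xi> \<longleftrightarrow>
     (\<forall>u\<in>fib E x. \<forall>v\<in>fib E x. \<xi> (vadd E x u v) = \<xi> u + \<xi> v) \<and>
     (\<forall>c. \<forall>u\<in>fib E x. \<xi> (vscale E x c u) = c * \<xi> u)"

text \<open>For a nonzero functional these are the cosets of its kernel, that is, the elements of
  the tautological fibre over that kernel.\<close>

definition lev :: "('x, 'v) vbundle \<Rightarrow> 'x \<Rightarrow> ('v \<Rightarrow> complex) \<Rightarrow> complex \<Rightarrow> 'v set" where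
  "lev E x \<xi> c = {v \<in> fib E x. \<xi> v = c}"

definition cofun :: "('x, 'v) vbundle \<Rightarrow> ('x \<Rightarrow> 'v \<Rightarrow> cvec) \<Rightarrow> 'x \<Rightarrow> cvec \<Rightarrow> 'v \<Rightarrow> complex" where
  "cofun E \<psi> x b v = (\<Sum>j<vrank E. b j * \<psi> x v j)"

lemma lin_onD:
  "lin_on E x \<xi> \<Longrightarrow> u \<in> fib E x \<Longrightarrow> v \<in> fib E x \<Longrightarrow> \<xi> (vadd E x u v) = \<xi> u + \<xi> v"
  "lin_on E x \<xi> \<Longrightarrow> u \<in> fib E x \<Longrightarrow> \<xi> (vscale E x c u) = c * \<xi> u"
  by (auto simp: lin_on_def)

lemma lev_cong: "(\<And>v. v \<in> fib E x \<Longrightarrow> \<xi> v = \<xi>' v) \<Longrightarrow> lev E x \<xi> c = lev E x \<xi>' c"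
  by (auto simp: lev_def)

lemma cunit_Cn: "k < n \<Longrightarrow> cunit k \<in> Cn n"
  by (auto simp: cunit_def Cn_def)

lemma linear_on_Cn:
  fixes f :: "cvec \<Rightarrow> complex"
  assumes add: "\<And>a b. a \<in> Cn r \<Longrightarrow> b \<in> Cn r \<Longrightarrow> f (\<lambda>i. a i + b i) = f a + f b"
    and scale: "\<And>c a. a \<in> Cn r \<Longrightarrow> f (\<lambda>i. c * a i) = c * f a" and a: "a \<in> Cn r"
  shows "f a = (\<Sum>j<r. a j * f (cunit j))"
proof -
  have "f a = (\<Sum>j<m. a j * f (cunit j))" if "m \<le> r" "a \<in> Cn m" for m a
    using that
  proof (induction m arbitrary: a)
    case 0
    then have "a = (\<lambda>i. 0 * (0::complex))" by (auto simp: Cn_def)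
    then have "f a = 0 * f (\<lambda>i. 0)" using scale[of "\<lambda>i. 0" 0] by (simp add: Cn_def)
    then show ?case by simp
  next
    case (Suc m)
    define b where "b = a(m := 0)"
    have b: "b \<in> Cn m" using Suc.prems by (auto simp: b_def Cn_def)
    have br: "b \<in> Cn r" using b Suc.prems by (auto simp: Cn_def)
    have mr: "cunit m \<in> Cn r" "(\<lambda>i. a m * cunit m i) \<in> Cn r" using Suc.prems by (auto simp: Cn_def cunit_def)
    have "a = (\<lambda>i. b i + a m * cunit m i)" by (auto simp: b_def cunit_def)
    then have "f a = f (\<lambda>i. b i + a m * cunit m i)" by simp
    also have "\<dots> = f b + a m * f (cunit m)" using add[OF br mr(2)] scale[OF mr(1)] by simp
    also have "f b = (\<Sum>j<m. a j * f (cunit j))"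
    proof -
      have "f b = (\<Sum>j<m. b j * f (cunit j))" using Suc.IH[OF _ b] Suc.prems by simp
      also have "\<dots> = (\<Sum>j<m. a j * f (cunit j))" by (intro sum.cong) (auto simp: b_def)
      finally show ?thesis .
    qed
    finally show ?case by simp
  qed
  then show ?thesis using a by blast
qed

text \<open>The reindexing by which \<open>proj_chart\<close> leaves out the index
  \<open>k\<close>.\<close>

definition skip :: "nat \<Rightarrow> nat \<Rightarrow> nat" where "skip k i = (if i < k then i else i + 1)"
definition unskip :: "nat \<Rightarrow> nat \<Rightarrow> nat" where "unskip k j = (if j < k then j else j - 1)"

lemma unskip_skip [simp]: "unskip k (skip k i) = i" and skip_neq: "skip k i \<noteq> k"
  by (auto simp: skip_def unskip_def)

lemma skip_unskip: "j \<noteq> k \<Longrightarrow> skip k (unskip k j) = j"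
  by (auto simp: skip_def unskip_def)

lemma skip_less: "i < r - 1 \<Longrightarrow> k < r \<Longrightarrow> skip k i < r"
  by (auto simp: skip_def)

lemma unskip_less: "j < r \<Longrightarrow> j \<noteq> k \<Longrightarrow> k < r \<Longrightarrow> unskip k j < r - 1"
  by (auto simp: unskip_def)

lemma sum_skip:
  fixes f :: "nat \<Rightarrow> complex"
  assumes "k < r"
  shows "(\<Sum>j<r. f j) = f k + (\<Sum>i<r-1. f (skip k i))"
proof -
  have "(\<Sum>j<r. f j) = f k + (\<Sum>j\<in>{..<r} - {k}. f j)" using assms by (simp add: sum.remove)
  also have "(\<Sum>j\<in>{..<r} - {k}. f j) = (\<Sum>i<r-1. f (skip k i))"
    by (rule sum.reindex_bij_witness[of _ "skip k" "unskip k"])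
       (use assms in \<open>auto simp: skip_unskip skip_neq skip_less unskip_less[simplified]\<close>)
  finally show ?thesis .
qed

locale hol_bundle =
  fixes R :: "'a cmanifold" and E :: "('a, 'v) vbundle"
  assumes M: "complex_manifold R" and E: "holomorphic_vbundle R E"
begin

abbreviation "r \<equiv> vrank E"
abbreviation "n \<equiv> cdim R"
abbreviation "X \<equiv> topspace (ctop R)"
abbreviation "N \<equiv> cdim R + (vrank E - 1)"

lemma fib_closed:
  assumes "x \<in> X"
  shows "vzero E x \<in> fib E x" "u \<in> fib E x \<Longrightarrow> v \<in> fib E x \<Longrightarrow> vadd E x u v \<in> fib E x"
    "u \<in> fib E x \<Longrightarrow> vscale E x c u \<in> fib E x"
  using E assms unfolding holomorphic_vbundle_def by auto

lemma triv_exists: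
  assumes "x \<in> X" obtains U \<psi> where "(U, \<psi>) \<in> trivs E" "x \<in> U"
proof -
  have "(\<Union>(U, \<psi>)\<in>trivs E. U) = X" using E unfolding holomorphic_vbundle_def by (elim conjE)
  then have "x \<in> (\<Union>(U, \<psi>)\<in>trivs E. U)" using assms by simp
  then show ?thesis using that by auto
qed

lemma triv_open: "(U, \<psi>) \<in> trivs E \<Longrightarrow> openin (ctop R) U"
  using E unfolding holomorphic_vbundle_def by auto

lemma trivD:
  assumes "(U, \<psi>) \<in> trivs E" "x \<in> U"
  shows "x \<in> X" "bij_betw (\<psi> x) (fib E x) (Cn r)" "\<psi> x (vzero E x) = (\<lambda>i. 0)"
    "u \<in> fib E x \<Longrightarrow> v \<in> fib E x \<Longrightarrow> \<psi> x (vadd E x u v) = (\<lambda>i. \<psi> x u i + \<psi> x v i)"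
    "u \<in> fib E x \<Longrightarrow> \<psi> x (vscale E x c u) = (\<lambda>i. c * \<psi> x u i)"
proof -
  show "x \<in> X" using openin_subset[OF triv_open[OF assms(1)]] assms(2) by auto
  have "\<forall>(U, \<psi>)\<in>trivs E. openin (ctop R) U \<and>
        (\<forall>x\<in>U.
           bij_betw (\<psi> x) (fib E x) (Cn (vrank E)) \<and>
           \<psi> x (vzero E x) = (\<lambda>i. 0) \<and>
           (\<forall>u\<in>fib E x. \<forall>v\<in>fib E x. \<psi> x (vadd E x u v) = (\<lambda>i. \<psi> x u i + \<psi> x v i)) \<and>
           (\<forall>c. \<forall>u\<in>fib E x. \<psi> x (vscale E x c u) = (\<lambda>i. c * \<psi> x u i)))"
    using E unfolding holomorphic_vbundle_def by (elim conjE)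
  from bspec[OF this assms(1), simplified, THEN conjunct2, rule_format, OF assms(2)]
  show "bij_betw (\<psi> x) (fib E x) (Cn r)" "\<psi> x (vzero E x) = (\<lambda>i. 0)"
    "u \<in> fib E x \<Longrightarrow> v \<in> fib E x \<Longrightarrow> \<psi> x (vadd E x u v) = (\<lambda>i. \<psi> x u i + \<psi> x v i)"
    "u \<in> fib E x \<Longrightarrow> \<psi> x (vscale E x c u) = (\<lambda>i. c * \<psi> x u i)" by auto
qed

text \<open>The fibres come with operations but without vector space axioms. Identities between
  their elements are checked in the coordinates of a trivialisation and brought back by this
  lemma.\<close>

lemma triv_inj:
  assumes "(U, \<psi>) \<in> trivs E" "x \<in> U" "u \<in> fib E x" "v \<in> fib E x" "\<psi> x u = \<psi> x v"
  shows "u = v"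
  using bij_betw_imp_inj_on[OF trivD(2)[OF assms(1,2)]] assms by (auto dest: inj_onD)

lemma frame_fib:
  assumes "(U, \<psi>) \<in> trivs E" "x \<in> U" "k < r"
  shows "frame E \<psi> k x \<in> fib E x" "\<psi> x (frame E \<psi> k x) = cunit k"
  unfolding frame_def using trivD(2)[OF assms(1,2)] cunit_Cn[OF assms(3)]
  by (auto simp: bij_betw_def intro: inv_into_into f_inv_into_f)

lemma vadd_diff_cancel:
  assumes "x \<in> X" "u \<in> fib E x" "v \<in> fib E x"
  shows "vadd E x v (vadd E x u (vscale E x (-1) v)) = u"
proof -
  obtain U \<psi> where T: "(U, \<psi>) \<in> trivs E" "x \<in> U" using triv_exists[OF assms(1)] .
  show ?thesis
    by (rule triv_inj[OF T]) (use assms fib_closed[OF assms(1)] trivD[OF T] in auto)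
qed

lemma lin_zero: "lin_on E x \<xi> \<Longrightarrow> x \<in> X \<Longrightarrow> \<xi> (vzero E x) = 0"
proof -
  assume a: "lin_on E x \<xi>" "x \<in> X"
  obtain U \<psi> where T: "(U, \<psi>) \<in> trivs E" "x \<in> U" using triv_exists[OF a(2)] .
  have "vscale E x 0 (vzero E x) = vzero E x"
    by (rule triv_inj[OF T]) (use fib_closed[OF a(2)] trivD[OF T] in auto)
  then show ?thesis using lin_onD(2)[OF a(1) fib_closed(1)[OF a(2)], of 0] by simp
qed

lemma lin_cofun: "(U, \<psi>) \<in> trivs E \<Longrightarrow> x \<in> U \<Longrightarrow> lin_on E x (cofun E \<psi> x b)"
  unfolding lin_on_def cofun_def
  by (auto simp: trivD algebra_simps sum.distrib sum_distrib_left)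

lemma cofun_frame: "(U, \<psi>) \<in> trivs E \<Longrightarrow> x \<in> U \<Longrightarrow> k < r \<Longrightarrow> cofun E \<psi> x b (frame E \<psi> k x) = b k"
  by (simp add: cofun_def frame_fib cunit_def if_distrib cong: if_cong)

lemma lin_eq_cofun:
  assumes T: "(U, \<psi>) \<in> trivs E" "x \<in> U" and \<xi>: "lin_on E x \<xi>" and v: "v \<in> fib E x"
  shows "\<xi> v = cofun E \<psi> x (\<lambda>j. \<xi> (frame E \<psi> j x)) v"
proof -
  let ?i = "inv_into (fib E x) (\<psi> x)"
  note xX = trivD(1)[OF T] and bij = trivD(2)[OF T]
  have i: "?i a \<in> fib E x" "\<psi> x (?i a) = a" if "a \<in> Cn r" for a
    using bij that by (auto simp: bij_betw_def intro: inv_into_into f_inv_into_f)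
  have vC: "\<psi> x v \<in> Cn r" using bij v by (auto simp: bij_betw_def)
  have "\<xi> (?i (\<psi> x v)) = (\<Sum>j<r. \<psi> x v j * \<xi> (?i (cunit j)))"
  proof (rule linear_on_Cn[where f = "\<lambda>a. \<xi> (?i a)"])
    fix a b assume ab: "a \<in> Cn r" "b \<in> Cn r"
    then have s: "(\<lambda>i. a i + b i) \<in> Cn r" by (auto simp: Cn_def)
    have "?i (\<lambda>i. a i + b i) = vadd E x (?i a) (?i b)"
      by (rule triv_inj[OF T]) (use i ab s fib_closed[OF xX] trivD[OF T] in auto)
    then show "\<xi> (?i (\<lambda>i. a i + b i)) = \<xi> (?i a) + \<xi> (?i b)" using lin_onD(1)[OF \<xi>] i ab by simp
  next
    fix c a assume a: "a \<in> Cn r"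
    then have s: "(\<lambda>i. c * a i) \<in> Cn r" by (auto simp: Cn_def)
    have "?i (\<lambda>i. c * a i) = vscale E x c (?i a)"
      by (rule triv_inj[OF T]) (use i a s fib_closed[OF xX] trivD[OF T] in auto)
    then show "\<xi> (?i (\<lambda>i. c * a i)) = c * \<xi> (?i a)" using lin_onD(2)[OF \<xi>] i a by simp
  qed (rule vC)
  moreover have "?i (\<psi> x v) = v" using bij v by (simp add: bij_betw_def)
  ultimately show ?thesis by (simp add: cofun_def frame_def mult.commute)
qed

lemma lin_ext:
  assumes T: "(U, \<psi>) \<in> trivs E" "x \<in> U" and \<xi>: "lin_on E x \<xi>" "lin_on E x \<xi>'" and v: "v \<in> fib E x"
    and "\<And>j. j < r \<Longrightarrow> \<xi> (frame E \<psi> j x) = \<xi>' (frame E \<psi> j x)"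
  shows "\<xi> v = \<xi>' v"
  using lin_eq_cofun[OF T \<xi>(1) v] lin_eq_cofun[OF T \<xi>(2) v] assms(6) by (simp add: cofun_def)

lemma coset_eq_lev:
  assumes x: "x \<in> X" and \<xi>: "lin_on E x \<xi>" and v: "v \<in> fib E x"
  shows "vadd E x v ` lev E x \<xi> 0 = lev E x \<xi> (\<xi> v)"
proof
  show "vadd E x v ` lev E x \<xi> 0 \<subseteq> lev E x \<xi> (\<xi> v)"
    using v fib_closed[OF x] lin_onD[OF \<xi>] by (auto simp: lev_def)
  show "lev E x \<xi> (\<xi> v) \<subseteq> vadd E x v ` lev E x \<xi> 0"
  proof
    fix u assume u: "u \<in> lev E x \<xi> (\<xi> v)"
    then have "vadd E x u (vscale E x (-1) v) \<in> lev E x \<xi> 0"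
      using v fib_closed[OF x] lin_onD[OF \<xi>] by (auto simp: lev_def)
    then show "u \<in> vadd E x v ` lev E x \<xi> 0"
      using vadd_diff_cancel[OF x, of u v] u v by (force simp: lev_def)
  qed
qed

lemma lev_nonempty:
  assumes x: "x \<in> X" and \<xi>: "lin_on E x \<xi>" and e: "e \<in> fib E x" "\<xi> e \<noteq> 0"
  shows "vscale E x (c / \<xi> e) e \<in> lev E x \<xi> c"
  using e fib_closed[OF x] lin_onD[OF \<xi>] by (auto simp: lev_def)

lemma lev_inj:
  assumes x: "x \<in> X" and \<xi>: "lin_on E x \<xi>" and e: "e \<in> fib E x" "\<xi> e \<noteq> 0"
    and "lev E x \<xi> c = lev E x \<xi> c'"
  shows "c = c'"
  using lev_nonempty[OF x \<xi> e, of c] assms(5) by (auto simp: lev_def)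

lemma hyperplane_lev:
  assumes x: "x \<in> X" and \<xi>: "lin_on E x \<xi>" and e: "e \<in> fib E x" "\<xi> e \<noteq> 0"
  shows "hyperplane E x (lev E x \<xi> 0)"
  unfolding hyperplane_def
proof (intro conjI)
  show "\<exists>e\<in>fib E x - lev E x \<xi> 0. \<forall>v\<in>fib E x. \<exists>c. \<exists>w\<in>lev E x \<xi> 0. v = vadd E x (vscale E x c e) w"
  proof (rule bexI[of _ e], rule ballI)
    fix v assume v: "v \<in> fib E x"
    let ?c = "\<xi> v / \<xi> e"
    have ce: "vscale E x ?c e \<in> fib E x" using e fib_closed[OF x] by auto
    have "v \<in> lev E x \<xi> (\<xi> (vscale E x ?c e))" using v e lin_onD[OF \<xi>] by (simp add: lev_def)
    then show "\<exists>c. \<exists>w\<in>lev E x \<xi> 0. v = vadd E x (vscale E x c e) w"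
      unfolding coset_eq_lev[OF x \<xi> ce, symmetric] by blast
  qed (use e in \<open>auto simp: lev_def\<close>)
qed (use fib_closed[OF x] lin_onD[OF \<xi>] lin_zero[OF \<xi> x] in \<open>auto simp: lev_def\<close>)

text \<open>The functional is the coefficient of \<open>e\<close> when a vector is decomposed along
  \<open>e\<close> and \<open>H\<close>. The coefficient is unique, since otherwise \<open>e\<close>
  would be a combination of elements of \<open>H\<close>.\<close>

lemma hyperplane_imp_lev:
  assumes x: "x \<in> X" and H: "hyperplane E x H"
  obtains \<xi> where "lin_on E x \<xi>" "H = lev E x \<xi> 0"
proof -
  obtain U \<psi> where T: "(U, \<psi>) \<in> trivs E" "x \<in> U" using triv_exists[OF x] .
  note cl = fib_closed[OF x]
  have H1: "H \<subseteq> fib E x" "\<And>u v. u \<in> H \<Longrightarrow> v \<in> H \<Longrightarrow> vadd E x u v \<in> H" "\<And>c u. u \<in> H \<Longrightarrow> vscale E x c u \<in> H" "vzero E x \<in> H"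
    using H by (auto simp: hyperplane_def)
  obtain e where e: "e \<in> fib E x" "e \<notin> H" "\<And>v. v \<in> fib E x \<Longrightarrow> \<exists>c. \<exists>w\<in>H. v = vadd E x (vscale E x c e) w"
    using H unfolding hyperplane_def by blast
  have uniq: "c = c'" if w: "w \<in> H" "w' \<in> H" and eq: "vadd E x (vscale E x c e) w = vadd E x (vscale E x c' e) w'" for c c' w w'
  proof (rule ccontr)
    assume ne: "c \<noteq> c'"
    have wf: "w \<in> fib E x" "w' \<in> fib E x" using w H1 by auto
    have "\<psi> x (vadd E x (vscale E x c e) w) = \<psi> x (vadd E x (vscale E x c' e) w')" using eq by simp
    then have eq': "c * \<psi> x e i + \<psi> x w i = c' * \<psi> x e i + \<psi> x w' i" for i
      using e wf cl trivD[OF T] by (simp add: fun_eq_iff)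
    have "e = vscale E x (1 / (c - c')) (vadd E x w' (vscale E x (-1) w))"
    proof (rule triv_inj[OF T])
      show "\<psi> x e = \<psi> x (vscale E x (1 / (c - c')) (vadd E x w' (vscale E x (-1) w)))"
      proof
        fix i
        have "(c - c') * \<psi> x e i = \<psi> x w' i - \<psi> x w i" using eq'[of i] by (simp add: algebra_simps)
        then show "\<psi> x e i = \<psi> x (vscale E x (1 / (c - c')) (vadd E x w' (vscale E x (-1) w))) i"
          using ne wf cl trivD[OF T] by (simp add: field_simps)
      qed
    qed (use e wf cl in auto)
    then show False using e(2) H1 w by metis
  qed
  define \<xi> where "\<xi> v = (THE c. \<exists>w\<in>H. v = vadd E x (vscale E x c e) w)" for v
  have \<xi>: "\<xi> v = c" if "w \<in> H" "v = vadd E x (vscale E x c e) w" for v c w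
    unfolding \<xi>_def using that uniq by (intro the_equality) blast+
  have lin: "lin_on E x \<xi>"
    unfolding lin_on_def
  proof (intro conjI ballI allI)
    fix u v assume uv: "u \<in> fib E x" "v \<in> fib E x"
    obtain c w where u: "w \<in> H" "u = vadd E x (vscale E x c e) w" using e(3)[OF uv(1)] by blast
    obtain c' w' where v: "w' \<in> H" "v = vadd E x (vscale E x c' e) w'" using e(3)[OF uv(2)] by blast
    have wf: "w \<in> fib E x" "w' \<in> fib E x" using u v H1 by auto
    have "vadd E x u v = vadd E x (vscale E x (c + c') e) (vadd E x w w')"
      by (rule triv_inj[OF T]) (use u v wf uv e cl trivD[OF T] in \<open>auto simp: algebra_simps\<close>)
    then have "\<xi> (vadd E x u v) = c + c'" by (rule \<xi>[rotated]) (use H1 u v in auto)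
    then show "\<xi> (vadd E x u v) = \<xi> u + \<xi> v" using \<xi>[OF u] \<xi>[OF v] by simp
  next
    fix b u assume uv: "u \<in> fib E x"
    obtain c w where u: "w \<in> H" "u = vadd E x (vscale E x c e) w" using e(3)[OF uv(1)] by blast
    have wf: "w \<in> fib E x" using u H1 by auto
    have "vscale E x b u = vadd E x (vscale E x (b * c) e) (vscale E x b w)"
      by (rule triv_inj[OF T]) (use u wf uv e cl trivD[OF T] in \<open>auto simp: algebra_simps\<close>)
    then have "\<xi> (vscale E x b u) = b * c" by (rule \<xi>[rotated]) (use H1 u in auto)
    then show "\<xi> (vscale E x b u) = b * \<xi> u" using \<xi>[OF u] by simp
  qed
  have z: "vadd E x (vscale E x 0 e) w = w" if "w \<in> fib E x" for w
    by (rule triv_inj[OF T]) (use that e cl trivD[OF T] in auto)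
  have "H = lev E x \<xi> 0"
  proof
    show "H \<subseteq> lev E x \<xi> 0" using \<xi>[of _ _ 0] z H1 by (force simp: lev_def)
    show "lev E x \<xi> 0 \<subseteq> H"
    proof
      fix v assume v: "v \<in> lev E x \<xi> 0"
      obtain c w where w: "w \<in> H" "v = vadd E x (vscale E x c e) w" using e(3)[of v] v by (auto simp: lev_def)
      then have "c = 0" using \<xi>[OF w] v by (simp add: lev_def)
      then show "v \<in> H" using w z H1 by auto
    qed
  qed
  with lin that show ?thesis by blast
qed

end

section \<open>The projective bundle and its tautological metric\<close>

context hol_bundle
begin

definition trunc :: "cvec \<Rightarrow> cvec" where "trunc \<zeta> = (\<lambda>i. if i < n then \<zeta> i else 0)"

text \<open>\<open>pt k z b\<close> is the point of the affine chart \<open>k\<close> over \<open>z\<close> with homogeneous fibre coordinates \<open>b\<close>;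
  \<open>coef k\<close> recovers these coordinates, normalised to be 1 at index \<open>k\<close>.\<close>

definition pt :: "nat \<Rightarrow> cvec \<Rightarrow> cvec \<Rightarrow> cvec" where
  "pt k z b = (\<lambda>i. if i < n then z i else if i < N then b (skip k (i - n)) / b k else 0)"

definition coef :: "nat \<Rightarrow> cvec \<Rightarrow> cvec" where
  "coef k \<zeta> = (\<lambda>j. if j = k then 1 else if j < r then \<zeta> (n + unskip k j) else 0)"

lemma pt_coef: "\<zeta> \<in> Cn N \<Longrightarrow> k < r \<Longrightarrow> pt k (trunc \<zeta>) (coef k \<zeta>) = \<zeta>"
  by (auto simp: pt_def trunc_def coef_def Cn_def fun_eq_iff skip_neq skip_less)

lemma coef_pt: "k < r \<Longrightarrow> j < r \<Longrightarrow> b k \<noteq> 0 \<Longrightarrow> coef k (pt k z b) j = b j / b k"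
  using unskip_less[of j r k] by (auto simp: pt_def coef_def skip_unskip)

lemma trunc_pt: "z \<in> Cn n \<Longrightarrow> trunc (pt k z b) = z"
  by (auto simp: trunc_def pt_def Cn_def)

lemma pt_Cn: "pt k z b \<in> Cn N"
  by (auto simp: pt_def Cn_def)

lemma affine_coord_lev:
  assumes T: "(U, \<psi>) \<in> trivs E" "x \<in> U" and kj: "k < r" "j < r" and \<xi>: "lin_on E x \<xi>" "\<xi> (frame E \<psi> k x) \<noteq> 0"
  shows "affine_coord E \<psi> k x (lev E x \<xi> 0) j = \<xi> (frame E \<psi> j x) / \<xi> (frame E \<psi> k x)"
proof -
  note fib_closed[OF trivD(1)[OF T]] frame_fib[OF T]
  then have "vadd E x (frame E \<psi> j x) (vscale E x (- c) (frame E \<psi> k x)) \<in> lev E x \<xi> 0 \<longleftrightarrow>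
      \<xi> (frame E \<psi> j x) - c * \<xi> (frame E \<psi> k x) = 0" for c
    using kj lin_onD[OF \<xi>(1)] by (simp add: lev_def)
  moreover have "\<xi> (frame E \<psi> j x) - c * \<xi> (frame E \<psi> k x) = 0 \<longleftrightarrow> c = \<xi> (frame E \<psi> j x) / \<xi> (frame E \<psi> k x)" for c
    using \<xi>(2) by (auto simp: field_simps)
  ultimately show ?thesis unfolding affine_coord_def by simp
qed

lemma proj_chart_lev:
  assumes T: "(U, \<psi>) \<in> trivs E" "x \<in> U" and k: "k < r" and \<xi>: "lin_on E x \<xi>" "\<xi> (frame E \<psi> k x) \<noteq> 0"
  shows "proj_chart R E \<phi> \<psi> k (x, lev E x \<xi> 0) = pt k (\<phi> x) (\<lambda>j. \<xi> (frame E \<psi> j x))"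
proof
  fix i
  show "proj_chart R E \<phi> \<psi> k (x, lev E x \<xi> 0) i = pt k (\<phi> x) (\<lambda>j. \<xi> (frame E \<psi> j x)) i"
    using affine_coord_lev[OF T k _ \<xi>, of "skip k (i - n)"] skip_less[of "i - n" r k] k
    by (auto simp: proj_chart_def pt_def Let_def skip_def)
qed

end

section \<open>Affine charts of the projective bundle\<close>

locale affine_piece = hol_bundle R E for R :: "'a cmanifold" and E :: "('a, 'v) vbundle" +
  fixes V \<phi> U \<psi> k
  assumes chart: "(V, \<phi>) \<in> catlas R" and triv: "(U, \<psi>) \<in> trivs E" and k: "k < vrank E"
begin

abbreviation "P \<equiv> proj_piece E (V \<inter> U) \<psi> k"
abbreviation "\<theta> \<equiv> proj_chart R E \<phi> \<psi> k"
abbreviation "fr \<equiv> frame E \<psi>"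

text \<open>The image of the chart, by \<open>theta_image\<close>; in this form its openness is
  visible.\<close>

definition Om :: "cvec set" where "Om = {\<zeta> \<in> Cn N. trunc \<zeta> \<in> \<phi> ` (V \<inter> U)}"
definition bpt :: "cvec \<Rightarrow> 'a" where "bpt \<zeta> = inv_into V \<phi> (trunc \<zeta>)"

lemma VU_open: "Cn_open n (\<phi> ` (V \<inter> U))"
  by (rule chart_image_open_Int[OF M chart triv_open[OF triv]])

lemma phi_Cn: "x \<in> V \<Longrightarrow> \<phi> x \<in> Cn n"
  using Cn_openD[OF chart_image_open[OF M chart]] by blast

lemma Om_open: "Cn_open N Om"
proof -
  obtain T where T: "open T" "\<phi> ` (V \<inter> U) = Cn n \<inter> T" using VU_open by (auto simp: openin_open)
  have "continuous_on UNIV trunc"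
  proof (rule continuous_on_coordinatewise_then_product)
    fix i show "continuous_on UNIV (\<lambda>x. trunc x i)"
      by (cases "i < n") (auto simp: trunc_def intro: continuous_on_product_then_coordinatewise continuous_on_id)
  qed
  then have "open (trunc -` T)" using T(1) by (simp add: continuous_on_open_vimage)
  moreover have "Om = Cn N \<inter> trunc -` T"
    using T(2) by (auto simp: Om_def) (auto simp: trunc_def Cn_def)
  ultimately show ?thesis by (auto simp: openin_open)
qed

lemma bpt: "\<zeta> \<in> Om \<Longrightarrow> bpt \<zeta> \<in> V \<inter> U" "\<zeta> \<in> Om \<Longrightarrow> \<phi> (bpt \<zeta>) = trunc \<zeta>"
  using chart_inv[OF M chart] by (auto simp: Om_def bpt_def)

lemma pt_Om: "x \<in> V \<inter> U \<Longrightarrow> pt k (\<phi> x) b \<in> Om"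
  using phi_Cn pt_Cn[of k "\<phi> x" b] by (auto simp: Om_def trunc_pt)

lemma bpt_pt: "x \<in> V \<inter> U \<Longrightarrow> bpt (pt k (\<phi> x) b) = x"
  using phi_Cn chart_inv[OF M chart] by (auto simp: bpt_def trunc_pt)

lemma piece_mem:
  assumes x: "x \<in> V \<inter> U" and \<xi>: "lin_on E x \<xi>" "\<xi> (fr k x) \<noteq> 0"
  shows "(x, lev E x \<xi> 0) \<in> P"
  using x hyperplane_lev[OF trivD(1)[OF triv] \<xi>(1) frame_fib(1)[OF triv _ k] \<xi>(2)] \<xi>(2)
  by (auto simp: proj_piece_def lev_def)

lemma piece_elim:
  assumes "(x, H) \<in> P"
  obtains \<xi> where "x \<in> V \<inter> U" "lin_on E x \<xi>" "\<xi> (fr k x) = 1" "H = lev E x \<xi> 0"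
proof -
  have x: "x \<in> V \<inter> U" "x \<in> U" and H: "hyperplane E x H" "fr k x \<notin> H" using assms by (auto simp: proj_piece_def)
  obtain \<xi> where \<xi>: "lin_on E x \<xi>" "H = lev E x \<xi> 0"
    using hyperplane_imp_lev[OF trivD(1)[OF triv x(2)] H(1)] .
  have ne: "\<xi> (fr k x) \<noteq> 0" using \<xi> H(2) frame_fib(1)[OF triv x(2) k] by (auto simp: lev_def)
  have "lin_on E x (\<lambda>v. \<xi> v / \<xi> (fr k x))"
    using \<xi>(1) by (auto simp: lin_on_def add_divide_distrib)
  moreover have "H = lev E x (\<lambda>v. \<xi> v / \<xi> (fr k x)) 0" using \<xi>(2) ne by (auto simp: lev_def)
  ultimately show ?thesis using that[OF x(1)] ne by simp
qed

lemma theta_inj: "inj_on \<theta> P"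
proof (rule inj_onI)
  fix p q assume p: "p \<in> P" and q: "q \<in> P" and eq: "\<theta> p = \<theta> q"
  obtain x H where p': "p = (x, H)" by (cases p)
  obtain y K where q': "q = (y, K)" by (cases q)
  obtain \<xi> where \<xi>: "x \<in> V \<inter> U" "lin_on E x \<xi>" "\<xi> (fr k x) = 1" "H = lev E x \<xi> 0"
    using piece_elim[OF p[unfolded p']] .
  obtain \<eta> where \<eta>: "y \<in> V \<inter> U" "lin_on E y \<eta>" "\<eta> (fr k y) = 1" "K = lev E y \<eta> 0"
    using piece_elim[OF q[unfolded q']] .
  have eq': "pt k (\<phi> x) (\<lambda>j. \<xi> (fr j x)) = pt k (\<phi> y) (\<lambda>j. \<eta> (fr j y))"
    using eq proj_chart_lev[OF triv _ k \<xi>(2)] proj_chart_lev[OF triv _ k \<eta>(2)] \<xi> \<eta> by (simp add: p' q')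
  have "x = bpt (pt k (\<phi> x) (\<lambda>j. \<xi> (fr j x)))" using bpt_pt[OF \<xi>(1)] by simp
  also have "\<dots> = y" unfolding eq' by (rule bpt_pt[OF \<eta>(1)])
  finally have xy: "x = y" .
  have "\<xi> (fr j x) = \<eta> (fr j x)" if "j < r" for j
    using coef_pt[OF k that, of "\<lambda>j. \<xi> (fr j x)" "\<phi> x"] coef_pt[OF k that, of "\<lambda>j. \<eta> (fr j y)" "\<phi> y"] eq' \<xi>(3) \<eta>(3)
    by (simp add: xy)
  then have "\<xi> v = \<eta> v" if "v \<in> fib E x" for v
    using lin_ext[OF triv _ \<xi>(2) _ that, of \<eta>] \<eta>(2) \<xi>(1) by (simp add: xy)
  then have "H = K" unfolding \<xi>(4) \<eta>(4) xy[symmetric] by (rule lev_cong)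
  then show "p = q" by (simp add: p' q' xy)
qed

lemma inv_theta:
  assumes "\<zeta> \<in> Om"
  defines "x \<equiv> bpt \<zeta>"
  shows "inv_into P \<theta> \<zeta> = (x, lev E x (cofun E \<psi> x (coef k \<zeta>)) 0)"
    and "(x, lev E x (cofun E \<psi> x (coef k \<zeta>)) 0) \<in> P" "\<zeta> \<in> \<theta> ` P"
proof -
  have x: "x \<in> V \<inter> U" "x \<in> U" "\<phi> x = trunc \<zeta>" using bpt[OF assms(1)] by (auto simp: x_def)
  let ?\<xi> = "cofun E \<psi> x (coef k \<zeta>)"
  note lin = lin_cofun[OF triv x(2)] and cf = cofun_frame[OF triv x(2)]
  have one: "?\<xi> (fr k x) = 1" using cf[OF k] by (simp add: coef_def)
  show mem: "(x, lev E x ?\<xi> 0) \<in> P" by (rule piece_mem[OF x(1) lin]) (simp add: one)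
  have "\<theta> (x, lev E x ?\<xi> 0) = pt k (\<phi> x) (\<lambda>j. ?\<xi> (fr j x))"
    by (rule proj_chart_lev[OF triv x(2) k lin]) (simp add: one)
  also have "\<dots> = pt k (trunc \<zeta>) (coef k \<zeta>)"
    unfolding x(3) pt_def using cf k skip_less[of _ r k] by (auto simp: fun_eq_iff)
  also have "\<dots> = \<zeta>" using assms(1) by (intro pt_coef k) (auto simp: Om_def)
  finally have th: "\<theta> (x, lev E x ?\<xi> 0) = \<zeta>" .
  show "inv_into P \<theta> \<zeta> = (x, lev E x ?\<xi> 0)" by (rule inv_into_f_eq[OF theta_inj mem th])
  show "\<zeta> \<in> \<theta> ` P" using mem th by force
qed

lemma theta_image: "\<theta> ` P = Om"
proof
  show "\<theta> ` P \<subseteq> Om"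
  proof
    fix \<zeta> assume "\<zeta> \<in> \<theta> ` P"
    then obtain x H where xH: "(x, H) \<in> P" "\<zeta> = \<theta> (x, H)" by auto
    obtain \<xi> where \<xi>: "x \<in> V \<inter> U" "lin_on E x \<xi>" "\<xi> (fr k x) = 1" "H = lev E x \<xi> 0"
      using piece_elim[OF xH(1)] .
    have "\<zeta> = pt k (\<phi> x) (\<lambda>j. \<xi> (fr j x))"
      unfolding xH(2) \<xi>(4) by (rule proj_chart_lev[OF triv _ k \<xi>(2)]) (use \<xi> in auto)
    then show "\<zeta> \<in> Om" using pt_Om[OF \<xi>(1)] by simp
  qed
  show "Om \<subseteq> \<theta> ` P" using inv_theta(3) by blast
qed

lemma proj_atlas_mem: "(P, \<theta>) \<in> proj_atlas R E"
  unfolding proj_atlas_def using chart triv k by blast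

lemma atlas_mem: "(P, \<theta>) \<in> catlas (proj_bundle R E)"
  using proj_atlas_mem by (simp add: proj_bundle_def)

definition \<tau> :: "'a \<times> 'v set \<Rightarrow> 'v set \<Rightarrow> cvec" where
  "\<tau> = (\<lambda>(x, H) A i. if i = 0 then (THE c. vscale E x c (fr k x) \<in> A) else 0)"

lemma taut_triv: "(proj_piece E U \<psi> k, \<tau>) \<in> trivs (taut_line_bundle E)"
  unfolding taut_line_bundle_def \<tau>_def using triv k by auto

lemma taut_fib:
  assumes x: "x \<in> U" and \<xi>: "lin_on E x \<xi>" "\<xi> (fr k x) \<noteq> 0"
  shows "fib (taut_line_bundle E) (x, lev E x \<xi> 0) = range (lev E x \<xi>)"
proof -
  note xX = trivD(1)[OF triv x]
  have "lev E x \<xi> c \<in> {vadd E x v ` lev E x \<xi> 0 | v. v \<in> fib E x}" for c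
  proof -
    have v: "vscale E x (c / \<xi> (fr k x)) (fr k x) \<in> lev E x \<xi> c"
      by (rule lev_nonempty[OF xX \<xi>(1) frame_fib(1)[OF triv x k] \<xi>(2)])
    then have "lev E x \<xi> c = vadd E x (vscale E x (c / \<xi> (fr k x)) (fr k x)) ` lev E x \<xi> 0"
      using coset_eq_lev[OF xX \<xi>(1)] by (simp add: lev_def)
    then show ?thesis using v by (auto simp: lev_def)
  qed
  moreover have "vadd E x v ` lev E x \<xi> 0 \<in> range (lev E x \<xi>)" if "v \<in> fib E x" for v
    using coset_eq_lev[OF xX \<xi>(1) that] by simp
  ultimately show ?thesis by (auto simp: taut_line_bundle_def)
qed

text \<open>\<open>\<tau>\<close> measures a coset in units of the class of the frame vector
  \<open>fr k x\<close>, so the unit is the coset on which \<open>\<xi>\<close> has its value at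
  that vector.\<close>

lemma frame_taut:
  assumes x: "x \<in> U" and \<xi>: "lin_on E x \<xi>" "\<xi> (fr k x) \<noteq> 0"
  shows "frame (taut_line_bundle E) \<tau> 0 (x, lev E x \<xi> 0) = lev E x \<xi> (\<xi> (fr k x))"
proof -
  note xX = trivD(1)[OF triv x] and f = frame_fib(1)[OF triv x k]
  have tau: "\<tau> (x, lev E x \<xi> 0) (lev E x \<xi> c) = (\<lambda>i. if i = 0 then c / \<xi> (fr k x) else 0)" for c
  proof -
    have "vscale E x b (fr k x) \<in> lev E x \<xi> c \<longleftrightarrow> b = c / \<xi> (fr k x)" for b
      using fib_closed(3)[OF xX f] lin_onD(2)[OF \<xi>(1) f] \<xi>(2) by (auto simp: lev_def field_simps)
    then show ?thesis by (simp add: \<tau>_def fun_eq_iff)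
  qed
  have inj: "inj_on (\<tau> (x, lev E x \<xi> 0)) (range (lev E x \<xi>))"
  proof (rule inj_onI, clarify)
    fix c c' assume "\<tau> (x, lev E x \<xi> 0) (lev E x \<xi> c) = \<tau> (x, lev E x \<xi> 0) (lev E x \<xi> c')"
    from fun_cong[OF this, of 0] show "lev E x \<xi> c = lev E x \<xi> c'" using \<xi>(2) by (simp add: tau)
  qed
  show ?thesis unfolding frame_def[of "taut_line_bundle E"] taut_fib[OF assms]
    by (rule inv_into_f_eq[OF inj]) (use \<xi>(2) in \<open>auto simp: tau cunit_def\<close>)
qed

lemma piece_topspace: "(x, H) \<in> P \<Longrightarrow> (x, H) \<in> topspace (ctop (proj_bundle R E))"
proof -
  assume xH: "(x, H) \<in> P"
  have "\<theta> (x, H) \<in> Cn N" using theta_image xH by (auto simp: Om_def)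
  \<comment> \<open>The topology is given by generators; taking all of \<open>Cn N\<close> as the
    open set exhibits a generator that contains the point.\<close>
  then have "\<exists>S\<in>{P \<inter> \<theta> -` \<Omega> | P \<theta> \<Omega>. (P, \<theta>) \<in> proj_atlas R E \<and> Cn_open N \<Omega>}. (x, H) \<in> S"
    using xH proj_atlas_mem by (intro bexI[of _ "P \<inter> \<theta> -` Cn N"] CollectI exI conjI) auto
  then show ?thesis by (simp add: proj_bundle_def topology_generated_by_topspace)
qed

end

context hol_bundle
begin

lemma affine_piece_exists:
  assumes x: "x \<in> X" and \<xi>: "lin_on E x \<xi>" "v \<in> fib E x" "\<xi> v \<noteq> 0"
  obtains V \<phi> U \<psi> k where "affine_piece R E V \<phi> U \<psi> k" "x \<in> V" "x \<in> U" "\<xi> (frame E \<psi> k x) \<noteq> 0"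
proof -
  obtain U \<psi> where T: "(U, \<psi>) \<in> trivs E" "x \<in> U" using triv_exists[OF x] .
  have "(\<Union>(V, \<phi>)\<in>catlas R. V) = X" using M unfolding complex_manifold_def by (elim conjE)
  then have "x \<in> (\<Union>(V, \<phi>)\<in>catlas R. V)" using x by simp
  then obtain V \<phi> where V: "(V, \<phi>) \<in> catlas R" "x \<in> V" by auto
  have "\<exists>k<r. \<xi> (frame E \<psi> k x) \<noteq> 0"
  proof (rule ccontr)
    assume "\<not> ?thesis"
    then have "cofun E \<psi> x (\<lambda>j. \<xi> (frame E \<psi> j x)) v = 0" by (simp add: cofun_def)
    then show False using lin_eq_cofun[OF T \<xi>(1,2)] \<xi>(3) by simp
  qed
  then obtain k where k: "k < r" "\<xi> (frame E \<psi> k x) \<noteq> 0" by blast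
  have "affine_piece R E V \<phi> U \<psi> k" using V T k hol_bundle_axioms by (simp add: affine_piece_def affine_piece_axioms_def)
  then show ?thesis using that V T k by blast
qed

end

section \<open>The metric as a function on nonzero functionals\<close>

locale bundle_metric = hol_bundle R E for R :: "'a cmanifold" and E :: "('a, 'v) vbundle" +
  fixes h
  assumes h: "hermitian_metric (proj_bundle R E) (taut_line_bundle E) h"
begin

text \<open>The coset where \<open>\<xi>\<close> is 1 is the basis vector of the quotient line
  selected by \<open>\<xi>\<close>. Multiplying \<open>\<xi>\<close> by \<open>c\<close> divides
  this vector by \<open>c\<close>, which is why minus the logarithm of its squared length grows by
  \<open>2 * ln (cmod c)\<close>.\<close>

definition uf :: "'a \<Rightarrow> ('v \<Rightarrow> complex) \<Rightarrow> real" where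
  "uf x \<xi> = - ln (Re (h (x, lev E x \<xi> 0) (lev E x \<xi> 1) (lev E x \<xi> 1)))"

lemma uf_cong: "(\<And>v. v \<in> fib E x \<Longrightarrow> \<xi> v = \<xi>' v) \<Longrightarrow> uf x \<xi> = uf x \<xi>'"
  unfolding uf_def by (simp add: lev_cong[of E x \<xi> \<xi>'])

lemma metric_facts:
  assumes x: "x \<in> X" and \<xi>: "lin_on E x \<xi>" "v \<in> fib E x" "\<xi> v \<noteq> 0"
  shows "Re (h (x, lev E x \<xi> 0) (lev E x \<xi> 1) (lev E x \<xi> 1)) > 0"
    and "c \<noteq> 0 \<Longrightarrow> uf x (\<lambda>v. c * \<xi> v) = uf x \<xi> + 2 * ln (cmod c)"
proof -
  let ?p = "(x, lev E x \<xi> 0)" and ?L = "taut_line_bundle E"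
  obtain V \<phi> U \<psi> k where pc: "affine_piece R E V \<phi> U \<psi> k" and xV: "x \<in> V" "x \<in> U" and kne: "\<xi> (frame E \<psi> k x) \<noteq> 0"
    using affine_piece_exists[OF x \<xi>] .
  interpret affine_piece R E V \<phi> U \<psi> k by (rule pc)
  have top: "?p \<in> topspace (ctop (proj_bundle R E))"
    by (rule piece_topspace[OF piece_mem[OF _ \<xi>(1) kne]]) (use xV in auto)
  have fibL: "fib ?L ?p = range (lev E x \<xi>)" by (rule taut_fib[OF xV(2) \<xi>(1) kne])
  have "\<forall>x\<in>topspace (ctop (proj_bundle R E)).
        (\<forall>u\<in>fib ?L x. \<forall>v\<in>fib ?L x. \<forall>w\<in>fib ?L x. h x (vadd ?L x u v) w = h x u w + h x v w) \<and>
        (\<forall>c. \<forall>u\<in>fib ?L x. \<forall>w\<in>fib ?L x. h x (vscale ?L x c u) w = c * h x u w) \<and>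
        (\<forall>u\<in>fib ?L x. \<forall>w\<in>fib ?L x. h x w u = cnj (h x u w)) \<and>
        (\<forall>u\<in>fib ?L x. u \<noteq> vzero ?L x \<longrightarrow> Re (h x u u) > 0)"
    using h unfolding hermitian_metric_def by (elim conjE)
  from bspec[OF this top]
  have h1: "\<And>c u w. u \<in> fib ?L ?p \<Longrightarrow> w \<in> fib ?L ?p \<Longrightarrow> h ?p (vscale ?L ?p c u) w = c * h ?p u w"
    and h2: "\<And>u w. u \<in> fib ?L ?p \<Longrightarrow> w \<in> fib ?L ?p \<Longrightarrow> h ?p w u = cnj (h ?p u w)"
    and h3: "\<And>u. u \<in> fib ?L ?p \<Longrightarrow> u \<noteq> vzero ?L ?p \<Longrightarrow> Re (h ?p u u) > 0" by blast+
  have z: "vzero ?L ?p = lev E x \<xi> 0" by (simp add: taut_line_bundle_def)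
  have "lev E x \<xi> 1 \<noteq> lev E x \<xi> 0" using lev_inj[OF x \<xi>(1,2,3), of 1 0] by auto
  then show pos: "Re (h ?p (lev E x \<xi> 1) (lev E x \<xi> 1)) > 0" using h3[of "lev E x \<xi> 1"] by (simp add: fibL z)
  have sc: "vscale ?L ?p s (lev E x \<xi> 1) = lev E x \<xi> s" for s
  proof -
    have "vscale ?L ?p s (lev E x \<xi> 1) = {vadd E x (vscale E x s a) w | a w. a \<in> lev E x \<xi> 1 \<and> w \<in> lev E x \<xi> 0}"
      by (simp add: taut_line_bundle_def)
    also have "\<dots> = (\<Union>a\<in>lev E x \<xi> 1. vadd E x (vscale E x s a) ` lev E x \<xi> 0)" by blast
    also have "\<dots> = (\<Union>a\<in>lev E x \<xi> 1. lev E x \<xi> s)"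
    proof (rule SUP_cong[OF refl])
      fix a assume a: "a \<in> lev E x \<xi> 1"
      then have af: "a \<in> fib E x" "\<xi> a = 1" by (auto simp: lev_def)
      show "vadd E x (vscale E x s a) ` lev E x \<xi> 0 = lev E x \<xi> s"
        using coset_eq_lev[OF x \<xi>(1) fib_closed(3)[OF x af(1)], of s] lin_onD(2)[OF \<xi>(1) af(1), of s] af(2) by simp
    qed
    also have "\<dots> = lev E x \<xi> s" using lev_nonempty[OF x \<xi>(1,2,3), of 1] by blast
    finally show ?thesis .
  qed
  show "uf x (\<lambda>v. c * \<xi> v) = uf x \<xi> + 2 * ln (cmod c)" if c: "c \<noteq> 0"
  proof -
    let ?A = "lev E x \<xi> 1"
    have l0: "lev E x (\<lambda>v. c * \<xi> v) 0 = lev E x \<xi> 0" using c by (auto simp: lev_def)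
    have l1: "lev E x (\<lambda>v. c * \<xi> v) 1 = lev E x \<xi> (1 / c)" using c by (auto simp: lev_def field_simps)
    have AL: "?A \<in> fib ?L ?p" "lev E x \<xi> (1 / c) \<in> fib ?L ?p" by (auto simp: fibL)
    have "h ?p (lev E x \<xi> (1 / c)) (lev E x \<xi> (1 / c)) = (1 / c) * h ?p ?A (lev E x \<xi> (1 / c))"
      using h1[OF AL, of "1 / c"] by (simp add: sc)
    also have "h ?p ?A (lev E x \<xi> (1 / c)) = cnj (h ?p (lev E x \<xi> (1 / c)) ?A)" by (rule h2[OF AL(2,1)])
    also have "h ?p (lev E x \<xi> (1 / c)) ?A = (1 / c) * h ?p ?A ?A" using h1[OF AL(1,1), of "1 / c"] by (simp add: sc)
    also have "(1 / c) * cnj ((1 / c) * h ?p ?A ?A) = of_real ((cmod (1 / c))\<^sup>2) * cnj (h ?p ?A ?A)"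
      by (simp only: complex_cnj_mult complex_norm_square mult.assoc)
    finally have "Re (h ?p (lev E x \<xi> (1 / c)) (lev E x \<xi> (1 / c))) = (cmod (1 / c))\<^sup>2 * Re (h ?p ?A ?A)"
      by simp
    then have "uf x (\<lambda>v. c * \<xi> v) = - ln ((cmod (1 / c))\<^sup>2 * Re (h ?p ?A ?A))"
      unfolding uf_def l0 l1 by simp
    also have "\<dots> = - (ln ((cmod (1 / c))\<^sup>2) + ln (Re (h ?p ?A ?A)))"
      using pos c by (simp add: ln_mult)
    also have "ln ((cmod (1 / c))\<^sup>2) = - 2 * ln (cmod c)" using c by (simp add: norm_divide ln_div ln_realpow power_divide)
    finally show ?thesis by (simp add: uf_def)
  qed
qed

end

locale piece_metric = affine_piece R E V \<phi> U \<psi> k + bundle_metric R E h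
  for R :: "'a cmanifold" and E :: "('a, 'v) vbundle" and V \<phi> U \<psi> k h
begin

text \<open>Spelled exactly like the potential inside \<open>chern_curvature\<close>, so that the
  curvature hypothesis becomes one on \<open>wt\<close>. By \<open>wt_eq_uf\<close> it is
  \<open>uf\<close> at the functional normalised to 1 on \<open>fr k\<close>.\<close>

definition wt :: "cvec \<Rightarrow> complex" where
  "wt = (\<lambda>z. let x = inv_into P \<theta> z; e = frame (taut_line_bundle E) \<tau> 0 x in of_real (- ln (Re (h x e e))))"

lemma inv_frame:
  assumes "\<zeta> \<in> Om"
  defines "\<xi> \<equiv> cofun E \<psi> (bpt \<zeta>) (coef k \<zeta>)"
  shows "inv_into P \<theta> \<zeta> = (bpt \<zeta>, lev E (bpt \<zeta>) \<xi> 0)"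
    "frame (taut_line_bundle E) \<tau> 0 (bpt \<zeta>, lev E (bpt \<zeta>) \<xi> 0) = lev E (bpt \<zeta>) \<xi> 1"
    "lin_on E (bpt \<zeta>) \<xi>" "\<xi> (fr k (bpt \<zeta>)) = 1" "bpt \<zeta> \<in> X" "fr k (bpt \<zeta>) \<in> fib E (bpt \<zeta>)"
proof -
  have x: "bpt \<zeta> \<in> U" using bpt[OF assms(1)] by auto
  show "inv_into P \<theta> \<zeta> = (bpt \<zeta>, lev E (bpt \<zeta>) \<xi> 0)" unfolding \<xi>_def by (rule inv_theta(1)[OF assms(1)])
  show lin: "lin_on E (bpt \<zeta>) \<xi>" unfolding \<xi>_def by (rule lin_cofun[OF triv x])
  show one: "\<xi> (fr k (bpt \<zeta>)) = 1" unfolding \<xi>_def using cofun_frame[OF triv x k] by (simp add: coef_def)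
  show "frame (taut_line_bundle E) \<tau> 0 (bpt \<zeta>, lev E (bpt \<zeta>) \<xi> 0) = lev E (bpt \<zeta>) \<xi> 1"
    using frame_taut[OF x lin] by (simp add: one)
  show "bpt \<zeta> \<in> X" "fr k (bpt \<zeta>) \<in> fib E (bpt \<zeta>)" using trivD(1)[OF triv x] frame_fib(1)[OF triv x k] .
qed

lemma wt_eq_uf: "\<zeta> \<in> Om \<Longrightarrow> wt \<zeta> = of_real (uf (bpt \<zeta>) (cofun E \<psi> (bpt \<zeta>) (coef k \<zeta>)))"
  using inv_frame[of \<zeta>] by (simp add: wt_def uf_def Let_def)

lemma wt_real: "\<zeta> \<in> Om \<Longrightarrow> cnj (wt \<zeta>) = wt \<zeta>"
  by (simp add: wt_eq_uf)

lemma piece_Int: "P \<inter> proj_piece E U \<psi> k = P"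
  by (auto simp: proj_piece_def)

lemma wt_Ck: "Ck_Cn m N Om wt"
proof -
  define f where "f = (\<lambda>z. h (inv_into P \<theta> z) (frame (taut_line_bundle E) \<tau> 0 (inv_into P \<theta> z))
      (frame (taut_line_bundle E) \<tau> 0 (inv_into P \<theta> z)))"
  have "\<forall>(U, \<psi>)\<in>trivs (taut_line_bundle E). \<forall>j<vrank (taut_line_bundle E). \<forall>k<vrank (taut_line_bundle E).
        mfd_smooth (proj_bundle R E) U (\<lambda>x. h x (frame (taut_line_bundle E) \<psi> j x) (frame (taut_line_bundle E) \<psi> k x))"
    using h unfolding hermitian_metric_def by (elim conjE)
  from bspec[OF this taut_triv] have "mfd_smooth (proj_bundle R E) (proj_piece E U \<psi> k)
      (\<lambda>x. h x (frame (taut_line_bundle E) \<tau> 0 x) (frame (taut_line_bundle E) \<tau> 0 x))"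
    by (simp add: taut_line_bundle_def)
  then have "smooth_Cn (cdim (proj_bundle R E)) (\<theta> ` (P \<inter> proj_piece E U \<psi> k)) f"
    using atlas_mem unfolding mfd_smooth_def f_def by blast
  then have f: "Ck_Cn m N Om f"
    unfolding piece_Int theta_image smooth_Cn_def by (simp add: proj_bundle_def)
  have pos: "Re (f \<zeta>) > 0" if "\<zeta> \<in> Om" for \<zeta>
    using metric_facts(1)[OF inv_frame(5)[OF that] inv_frame(3)[OF that] inv_frame(6)[OF that]]
    by (simp add: f_def inv_frame[OF that])
  have "wt = (\<lambda>z. complex_of_real (- ln (Re (f z))))" by (simp add: wt_def f_def Let_def)
  then show ?thesis using Ck_Cn_ln_Re[OF Om_open f pos] by simp
qed

text \<open>The chart normalises the functional at index \<open>k\<close>; the logarithm restores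
  the factor \<open>b k\<close> that this divides out.\<close>

lemma uf_eq_wt:
  assumes x: "x \<in> V \<inter> U" and b: "b k \<noteq> 0"
  shows "uf x (cofun E \<psi> x b) = Re (wt (pt k (\<phi> x) b)) + 2 * ln (cmod (b k))"
proof -
  let ?\<zeta> = "pt k (\<phi> x) b"
  have xU: "x \<in> U" using x by simp
  have Z: "?\<zeta> \<in> Om" by (rule pt_Om[OF x])
  have bx: "bpt ?\<zeta> = x" by (rule bpt_pt[OF x])
  have "uf x (cofun E \<psi> x b) = uf x (\<lambda>v. b k * cofun E \<psi> x (coef k ?\<zeta>) v)"
    using coef_pt[of k _ b "\<phi> x", OF k] b by (intro uf_cong) (simp add: cofun_def sum_distrib_left)
  also have "\<dots> = uf x (cofun E \<psi> x (coef k ?\<zeta>)) + 2 * ln (cmod (b k))"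
    using inv_frame[OF Z] b unfolding bx by (intro metric_facts(2)[where v = "fr k x"]) auto
  also have "uf x (cofun E \<psi> x (coef k ?\<zeta>)) = Re (wt ?\<zeta>)" using wt_eq_uf[OF Z] by (simp add: bx)
  finally show ?thesis .
qed

end

section \<open>Semi-positivity along a quotient\<close>

lemma holo_Cn_cong:
  assumes \<Omega>: "Cn_open n \<Omega>" and eq: "\<And>z. z \<in> \<Omega> \<Longrightarrow> f z = g z" and f: "holo_Cn n \<Omega> f"
  shows "holo_Cn n \<Omega> g"
  unfolding holo_Cn_def
proof (intro conjI ballI allI impI)
  show "continuous_on \<Omega> g" using f eq by (simp add: holo_Cn_def cong: continuous_on_cong)
  fix z j assume z: "z \<in> \<Omega>" and j: "j < n"
  have "(\<lambda>w. f (z(j := w))) field_differentiable (at (z j))" using f z j by (simp add: holo_Cn_def)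
  moreover have "open {w. z(j := w) \<in> \<Omega>}" using open_slice[OF \<Omega> Cn_openD[OF \<Omega> z] j] .
  ultimately show "(\<lambda>w. g (z(j := w))) field_differentiable (at (z j))"
    unfolding field_differentiable_def
    by (elim exE) (rule exI, erule has_field_derivative_transform_within_open, auto simp: eq z)
qed

lemma holo_Cn_subset: "holo_Cn n \<Omega> f \<Longrightarrow> \<Omega>' \<subseteq> \<Omega> \<Longrightarrow> holo_Cn n \<Omega>' f"
  unfolding holo_Cn_def using continuous_on_subset by blast

lemma holo_Cn_local:
  assumes "\<And>z. z \<in> \<Omega> \<Longrightarrow> \<exists>\<Omega>'. Cn_open n \<Omega>' \<and> z \<in> \<Omega>' \<and> \<Omega>' \<subseteq> \<Omega> \<and> holo_Cn n \<Omega>' f"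
  shows "holo_Cn n \<Omega> f"
proof -
  obtain N where N: "\<And>z. z \<in> \<Omega> \<Longrightarrow> Cn_open n (N z) \<and> z \<in> N z \<and> N z \<subseteq> \<Omega> \<and> holo_Cn n (N z) f"
    using assms by metis
  have \<Omega>C: "\<Omega> \<subseteq> Cn n" using N Cn_openD by blast
  have "continuous (at z within \<Omega>) f" if z: "z \<in> \<Omega>" for z
  proof -
    obtain T where T: "open T" "N z = Cn n \<inter> T" using N[OF z] by (auto simp: openin_open)
    have "continuous (at z within N z) f"
      using N[OF z] by (simp add: holo_Cn_def continuous_on_eq_continuous_within)
    moreover have "at z within N z = at z within \<Omega>"
      by (rule at_within_nhd[of z T]) (use T N[OF z] \<Omega>C in auto)
    ultimately show ?thesis by simp
  qed
  then have "continuous_on \<Omega> f" by (simp add: continuous_on_eq_continuous_within)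
  moreover have "(\<lambda>w. f (z(j := w))) field_differentiable (at (z j))" if "z \<in> \<Omega>" "j < n" for z j
    using N[OF that(1)] that(2) by (auto simp: holo_Cn_def)
  ultimately show ?thesis by (simp add: holo_Cn_def)
qed

lemma holo_Cn_const: "holo_Cn n \<Omega> (\<lambda>z. c)"
  by (simp add: holo_Cn_def)

lemma holo_Cn_add: "holo_Cn n \<Omega> f \<Longrightarrow> holo_Cn n \<Omega> g \<Longrightarrow> holo_Cn n \<Omega> (\<lambda>z. f z + g z)"
  unfolding holo_Cn_def by (auto intro!: continuous_intros field_differentiable_add)

lemma holo_Cn_diff: "holo_Cn n \<Omega> f \<Longrightarrow> holo_Cn n \<Omega> g \<Longrightarrow> holo_Cn n \<Omega> (\<lambda>z. f z - g z)"
  unfolding holo_Cn_def by (auto intro!: continuous_intros field_differentiable_diff)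

lemma holo_Cn_mult: "holo_Cn n \<Omega> f \<Longrightarrow> holo_Cn n \<Omega> g \<Longrightarrow> holo_Cn n \<Omega> (\<lambda>z. f z * g z)"
  unfolding holo_Cn_def by (auto intro!: continuous_intros field_differentiable_mult)

lemma holo_Cn_divide:
  assumes "holo_Cn n \<Omega> f" "holo_Cn n \<Omega> g" "\<And>z. z \<in> \<Omega> \<Longrightarrow> g z \<noteq> 0"
  shows "holo_Cn n \<Omega> (\<lambda>z. f z / g z)"
  using assms unfolding holo_Cn_def by (auto intro!: continuous_intros field_differentiable_divide)

lemma holo_Cn_sum:
  "(\<And>i. i \<in> I \<Longrightarrow> holo_Cn n \<Omega> (f i)) \<Longrightarrow> holo_Cn n \<Omega> (\<lambda>z. \<Sum>i\<in>I. f i z)"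
  unfolding holo_Cn_def by (auto intro!: continuous_intros field_differentiable_sum)

lemma holo_Cn_slice:
  assumes \<Omega>: "Cn_open n \<Omega>" and f: "holo_Cn n \<Omega> f" and j: "j < n"
  shows "(\<lambda>w. f (z(j := w))) holomorphic_on {w. z(j := w) \<in> \<Omega>}"
  unfolding holomorphic_on_def
proof
  fix w assume w: "w \<in> {w. z(j := w) \<in> \<Omega>}"
  have "\<forall>z\<in>\<Omega>. \<forall>j<n. (\<lambda>w. f (z(j := w))) field_differentiable (at (z j))"
    using f by (simp add: holo_Cn_def)
  from this[rule_format, of "z(j := w)" j]
  have "(\<lambda>w'. f ((z(j := w))(j := w'))) field_differentiable (at ((z(j := w)) j))"
    using w j by simp
  then show "(\<lambda>w. f (z(j := w))) field_differentiable (at w within {w. z(j := w) \<in> \<Omega>})"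
    by (simp add: field_differentiable_at_within)
qed

lemma chart_polydisc_component:
  assumes M: "complex_manifold M" and chart: "(V, \<phi>) \<in> catlas M"
    and sub: "polydisc (cdim M) z \<delta> \<subseteq> \<phi> ` V" and z: "z \<in> polydisc (cdim M) z \<delta>" "z' \<in> polydisc (cdim M) z \<delta>"
  shows "connected_component_of (ctop M) (inv_into V \<phi> z) (inv_into V \<phi> z')"
proof -
  have "connectedin (top_of_set (\<phi> ` V)) (polydisc (cdim M) z \<delta>)"
    using connected_polydisc sub by (auto simp: connectedin_subtopology)
  then have "connectedin (subtopology (ctop M) V) (inv_into V \<phi> ` polydisc (cdim M) z \<delta>)"
    by (rule connectedin_continuous_map_image[OF homeomorphic_imp_continuous_map[OF chart_inv_homeo[OF M chart]]])
  then have "connectedin (ctop M) (inv_into V \<phi> ` polydisc (cdim M) z \<delta>)" by (simp add: connectedin_subtopology)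
  then show ?thesis unfolding connected_component_of_def using z by blast
qed

lemma sum_lessThan_add:
  fixes f :: "nat \<Rightarrow> complex"
  shows "(\<Sum>i<m+l. f i) = (\<Sum>i<m. f i) + (\<Sum>i<l. f (m + i))"
  by (induction l) auto

section \<open>Functionals pulled back from the trivial quotient\<close>

locale semipos = bundle_metric R E h for R :: "'a cmanifold" and E :: "('a, 'v) vbundle" and h +
  fixes \<pi> :: "'a \<Rightarrow> 'v \<Rightarrow> cvec" and r2 :: nat
  assumes cpt: "compact_space (ctop R)"
    and curv: "\<forall>(U, \<psi>)\<in>trivs (taut_line_bundle E). \<forall>(V, \<phi>)\<in>catlas (proj_bundle R E). \<forall>z\<in>\<phi> ` (V \<inter> U). \<forall>\<xi> :: nat \<Rightarrow> complex.
           0 \<le> Re (\<Sum>j<cdim (proj_bundle R E). \<Sum>k<cdim (proj_bundle R E).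
                     chern_curvature (taut_line_bundle E) h \<psi> V \<phi> j k z * \<xi> j * cnj (\<xi> k))"
    and hom: "vbundle_hom R E (trivial_vbundle R r2) \<pi>"
    and surj: "\<And>x. x \<in> topspace (ctop R) \<Longrightarrow> \<pi> x ` fib E x = Cn r2"
begin

definition lp :: "cvec \<Rightarrow> 'a \<Rightarrow> 'v \<Rightarrow> complex" where
  "lp lam x v = (\<Sum>i<r2. lam i * \<pi> x v i)"

definition nz :: "cvec \<Rightarrow> bool" where "nz lam \<longleftrightarrow> (\<exists>i<r2. lam i \<noteq> 0)"

definition vf :: "cvec \<Rightarrow> 'a \<Rightarrow> real" where "vf lam x = uf x (lp lam x)"

lemma homD:
  assumes "x \<in> X"
  shows "u \<in> fib E x \<Longrightarrow> \<pi> x u \<in> Cn r2"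
    "u \<in> fib E x \<Longrightarrow> v \<in> fib E x \<Longrightarrow> \<pi> x (vadd E x u v) = (\<lambda>i. \<pi> x u i + \<pi> x v i)"
    "u \<in> fib E x \<Longrightarrow> \<pi> x (vscale E x c u) = (\<lambda>i. c * \<pi> x u i)"
proof -
  have "\<forall>x\<in>X.
        (\<forall>u\<in>fib E x. \<pi> x u \<in> fib (trivial_vbundle R r2) x) \<and>
        (\<forall>u\<in>fib E x. \<forall>v\<in>fib E x. \<pi> x (vadd E x u v) = vadd (trivial_vbundle R r2) x (\<pi> x u) (\<pi> x v)) \<and>
        (\<forall>c. \<forall>u\<in>fib E x. \<pi> x (vscale E x c u) = vscale (trivial_vbundle R r2) x c (\<pi> x u))"
    using hom unfolding vbundle_hom_def by (elim conjE)
  from bspec[OF this assms]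
  show "u \<in> fib E x \<Longrightarrow> \<pi> x u \<in> Cn r2"
    "u \<in> fib E x \<Longrightarrow> v \<in> fib E x \<Longrightarrow> \<pi> x (vadd E x u v) = (\<lambda>i. \<pi> x u i + \<pi> x v i)"
    "u \<in> fib E x \<Longrightarrow> \<pi> x (vscale E x c u) = (\<lambda>i. c * \<pi> x u i)"
    by (simp_all add: trivial_vbundle_def)
qed

lemma lin_lp: "x \<in> X \<Longrightarrow> lin_on E x (lp lam x)"
  unfolding lin_on_def lp_def by (auto simp: homD algebra_simps sum.distrib sum_distrib_left)

lemma lp_nonzero:
  assumes "x \<in> X" "nz lam" obtains v where "v \<in> fib E x" "lp lam x v \<noteq> 0"
proof -
  obtain i where i: "i < r2" "lam i \<noteq> 0" using assms(2) by (auto simp: nz_def)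
  have "cunit i \<in> \<pi> x ` fib E x" using surj[OF assms(1)] cunit_Cn[OF i(1)] by simp
  then obtain v where v: "v \<in> fib E x" "\<pi> x v = cunit i" by (metis imageE)
  then have "lp lam x v = lam i" using i by (simp add: lp_def cunit_def if_distrib cong: if_cong)
  then show ?thesis using that v i by simp
qed

end

locale graph = piece_metric R E V \<phi> U \<psi> k h + semipos R E h \<pi> r2
  for R :: "'a cmanifold" and E :: "('a, 'v) vbundle" and V \<phi> U \<psi> k h \<pi> r2 +
  fixes lam :: cvec
begin

definition co :: "nat \<Rightarrow> cvec \<Rightarrow> complex" where
  "co j z = lp lam (inv_into V \<phi> z) (fr j (inv_into V \<phi> z))"

definition Ok :: "cvec set" where "Ok = {z \<in> \<phi> ` (V \<inter> U). co k z \<noteq> 0}"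

text \<open>The section of the projective bundle given by the kernels of \<open>lp lam\<close>, in
  the coordinates of affine piece \<open>k\<close>; over \<open>Ok\<close> it stays in this
  piece.\<close>

definition \<Gamma> :: "cvec \<Rightarrow> cvec" where "\<Gamma> z = pt k z (\<lambda>j. co j z)"

lemma co_holo:
  assumes "j < r" shows "holo_Cn n (\<phi> ` (V \<inter> U)) (co j)"
proof -
  have "\<forall>(U, \<psi>)\<in>trivs E. \<forall>(U', \<psi>')\<in>trivs (trivial_vbundle R r2). \<forall>k<vrank E. \<forall>j<vrank (trivial_vbundle R r2).
        mfd_holo R (U \<inter> U') (\<lambda>x. \<psi>' x (\<pi> x (frame E \<psi> k x)) j)"
    using hom unfolding vbundle_hom_def by (elim conjE)
  from bspec[OF this triv] assms
  have *: "mfd_holo R (U \<inter> X) (\<lambda>x. \<pi> x (fr j x) i)" if "i < r2" for i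
    using that by (simp add: trivial_vbundle_def)
  have UX: "V \<inter> (U \<inter> X) = V \<inter> U" using openin_subset[OF triv_open[OF triv]] by auto
  have "holo_Cn n (\<phi> ` (V \<inter> U)) (\<lambda>z. \<pi> (inv_into V \<phi> z) (fr j (inv_into V \<phi> z)) i)" if "i < r2" for i
    using *[OF that] chart unfolding mfd_holo_def by (auto simp: UX)
  then have "holo_Cn n (\<phi> ` (V \<inter> U)) (\<lambda>z. \<Sum>i<r2. lam i * \<pi> (inv_into V \<phi> z) (fr j (inv_into V \<phi> z)) i)"
    by (intro holo_Cn_sum holo_Cn_mult holo_Cn_const) auto
  then show ?thesis unfolding co_def lp_def .
qed

lemma Ok_open: "Cn_open n Ok"
proof -
  have "continuous_on (\<phi> ` (V \<inter> U)) (co k)" using co_holo[OF k] by (simp add: holo_Cn_def)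
  then have "openin (top_of_set (\<phi> ` (V \<inter> U))) (\<phi> ` (V \<inter> U) \<inter> co k -` (- {0}))"
    by (intro continuous_openin_preimage_gen) auto
  moreover have "\<phi> ` (V \<inter> U) \<inter> co k -` (- {0}) = Ok" by (auto simp: Ok_def)
  ultimately show ?thesis using VU_open openin_trans by metis
qed

lemma Ok_sub: "Ok \<subseteq> \<phi> ` (V \<inter> U)" "Ok \<subseteq> \<phi> ` V" by (auto simp: Ok_def)

lemma co_holo_Ok: "j < r \<Longrightarrow> holo_Cn n Ok (co j)"
  using holo_Cn_subset[OF co_holo Ok_sub(1)] .

lemma co_k_nz: "z \<in> Ok \<Longrightarrow> co k z \<noteq> 0" by (simp add: Ok_def)

lemma inv_Ok: "z \<in> Ok \<Longrightarrow> inv_into V \<phi> z \<in> V \<inter> U" "z \<in> Ok \<Longrightarrow> \<phi> (inv_into V \<phi> z) = z"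
  using chart_inv[OF M chart] by (auto simp: Ok_def)

lemma \<Gamma>_Om: "z \<in> Ok \<Longrightarrow> \<Gamma> z \<in> Om"
  using pt_Om[OF inv_Ok(1)] inv_Ok(2) by (simp add: \<Gamma>_def)

lemma \<Gamma>_holo: "i < N \<Longrightarrow> holo_Cn n Ok (\<lambda>z. \<Gamma> z i)"
proof (cases "i < n")
  case True
  have "continuous_on Ok (\<lambda>z. z i)"
    by (rule continuous_on_product_then_coordinatewise[OF continuous_on_id])
  moreover have "(\<lambda>w. (z(j := w)) i) field_differentiable at (z j)" for z :: cvec and j
    by (cases "i = j") (auto intro: field_differentiable_ident)
  ultimately show ?thesis using True by (simp add: \<Gamma>_def pt_def holo_Cn_def)
next
  case False
  assume i: "i < N"
  have s: "skip k (i - n) < r" using i False k by (intro skip_less) auto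
  have "holo_Cn n Ok (\<lambda>z. co (skip k (i - n)) z / co k z)"
    by (intro holo_Cn_divide co_holo_Ok s k co_k_nz)
  moreover have "(\<lambda>z. \<Gamma> z i) = (\<lambda>z. co (skip k (i - n)) z / co k z)"
    unfolding \<Gamma>_def pt_def using False i by (simp only: if_False if_True)
  ultimately show ?thesis by simp
qed

lemma \<Gamma>_cont: "continuous_on Ok \<Gamma>"
proof (rule continuous_on_coordinatewise_then_product)
  fix i show "continuous_on Ok (\<lambda>z. \<Gamma> z i)"
  proof (cases "i < N")
    case True then show ?thesis using \<Gamma>_holo[of i] by (simp add: holo_Cn_def)
  next
    case False then show ?thesis by (simp add: \<Gamma>_def pt_def)
  qed
qed

lemma vf_eq: "z \<in> Ok \<Longrightarrow> vf lam (inv_into V \<phi> z) = Re (wt (\<Gamma> z)) + 2 * ln (cmod (co k z))"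
proof -
  assume z: "z \<in> Ok"
  let ?x = "inv_into V \<phi> z"
  have xU: "?x \<in> U" "?x \<in> V \<inter> U" using inv_Ok(1)[OF z] by auto
  have "uf ?x (lp lam ?x) = uf ?x (cofun E \<psi> ?x (\<lambda>j. lp lam ?x (fr j ?x)))"
    by (rule uf_cong, rule lin_eq_cofun[OF triv xU(1) lin_lp[OF trivD(1)[OF triv xU(1)]]])
  also have "\<dots> = Re (wt (pt k (\<phi> ?x) (\<lambda>j. lp lam ?x (fr j ?x)))) + 2 * ln (cmod (lp lam ?x (fr k ?x)))"
    by (rule uf_eq_wt[OF xU(2)]) (use co_k_nz[OF z] in \<open>simp add: co_def\<close>)
  finally show ?thesis using inv_Ok(2)[OF z] by (simp add: vf_def \<Gamma>_def co_def)
qed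

lemma psd:
  assumes "\<zeta> \<in> Om"
  shows "0 \<le> Re (\<Sum>j<N. \<Sum>l<N. wirt j (wirt_bar l wt) \<zeta> * \<xi> j * cnj (\<xi> l))"
proof -
  have A: "\<forall>z\<in>\<theta> ` (P \<inter> proj_piece E U \<psi> k). \<forall>\<xi> :: nat \<Rightarrow> complex.
           0 \<le> Re (\<Sum>j<cdim (proj_bundle R E). \<Sum>l<cdim (proj_bundle R E).
                     chern_curvature (taut_line_bundle E) h \<tau> P \<theta> j l z * \<xi> j * cnj (\<xi> l))"
    using bspec[OF bspec[OF curv taut_triv, simplified] atlas_mem] by simp
  have cc: "chern_curvature (taut_line_bundle E) h \<tau> P \<theta> j l = wirt j (wirt_bar l wt)" for j l
    unfolding chern_curvature_def wt_def ..
  have dim: "cdim (proj_bundle R E) = N" by (simp add: proj_bundle_def)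
  show ?thesis by (rule A[unfolded piece_Int theta_image cc dim, rule_format, OF assms])
qed

definition slice :: "cvec \<Rightarrow> nat \<Rightarrow> complex set" where "slice z i = {w. z(i := w) \<in> Ok}"

lemma disc: "z \<in> Ok \<Longrightarrow> i < n \<Longrightarrow> holo_disc N Om (slice z i) (\<lambda>w. \<Gamma> (z(i := w)))"
proof
  assume z: "z \<in> Ok" and i: "i < n"
  show "Cn_open N Om" by (rule Om_open)
  show "open (slice z i)" unfolding slice_def by (rule open_slice[OF Ok_open Cn_openD[OF Ok_open z] i])
  show "\<Gamma> (z(i := w)) \<in> Om" if "w \<in> slice z i" for w using that \<Gamma>_Om by (simp add: slice_def)
  show "(\<lambda>w. \<Gamma> (z(i := w)) l) holomorphic_on slice z i" if "l < N" for l
    unfolding slice_def by (rule holo_Cn_slice[OF Ok_open \<Gamma>_holo[OF that] i])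
qed

lemma slice_mem: "z \<in> Ok \<Longrightarrow> z i \<in> slice z i" by (simp add: slice_def)

text \<open>By \<open>vf_eq\<close> the potential along the section is \<open>wt\<close> on the
  graph plus the logarithm of the modulus of a holomorphic function without zeros. The logarithm is
  harmonic in each variable, so only the Levi form of \<open>wt\<close> is left.\<close>

lemma vf_laplacian:
  assumes z: "z \<in> Ok" and i: "i < n"
  shows "has_laplacian (\<lambda>w. vf lam (inv_into V \<phi> (z(i := w)))) (z i)
           (4 * Re (holo_disc.levi N (\<lambda>w. \<Gamma> (z(i := w))) wt (z i)))"
proof -
  interpret holo_disc N Om "slice z i" "\<lambda>w. \<Gamma> (z(i := w))" by (rule disc[OF z i])
  have 1: "has_laplacian (\<lambda>w. Re (wt (\<Gamma> (z(i := w))))) (z i) (4 * Re (levi wt (z i)))"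
    by (rule has_laplacian_comp[OF wt_Ck slice_mem[OF z]])
  have 2: "has_laplacian (\<lambda>w. 2 * ln (cmod (co k (z(i := w))))) (z i) 0"
  proof (rule has_laplacian_ln_cmod[OF D slice_mem[OF z]])
    show "(\<lambda>w. co k (z(i := w))) holomorphic_on slice z i"
      unfolding slice_def by (rule holo_Cn_slice[OF Ok_open co_holo_Ok[OF k] i])
    show "co k (z(i := z i)) \<noteq> 0" using co_k_nz[OF z] by simp
  qed
  have "\<forall>\<^sub>F w in nhds (z i). w \<in> slice z i" using D slice_mem[OF z] by (rule eventually_nhds_in_open)
  then have "\<forall>\<^sub>F w in nhds (z i). Re (wt (\<Gamma> (z(i := w)))) + 2 * ln (cmod (co k (z(i := w)))) = vf lam (inv_into V \<phi> (z(i := w)))"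
    by eventually_elim (simp add: slice_def vf_eq)
  with has_laplacian_add[OF 1 2] show ?thesis using has_laplacian_cong by force
qed

lemma levi_nonneg:
  assumes z: "z \<in> Ok" and i: "i < n"
  shows "0 \<le> Re (holo_disc.levi N (\<lambda>w. \<Gamma> (z(i := w))) wt (z i))"
proof -
  interpret holo_disc N Om "slice z i" "\<lambda>w. \<Gamma> (z(i := w))" by (rule disc[OF z i])
  have "\<Gamma> (z(i := z i)) \<in> Om" using \<Gamma>_Om[OF z] by simp
  then show ?thesis unfolding levi_def by (rule psd)
qed

lemma vf_continuous: "continuous_on Ok (\<lambda>z. vf lam (inv_into V \<phi> z))"
proof -
  have "continuous_on Ok (\<lambda>z. wt (\<Gamma> z))"
    by (rule continuous_on_compose2[OF Ck_Cn_continuous[OF wt_Ck] \<Gamma>_cont]) (use \<Gamma>_Om in auto)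
  moreover have "continuous_on Ok (co k)" using co_holo_Ok[OF k] by (simp add: holo_Cn_def)
  ultimately have "continuous_on Ok (\<lambda>z. Re (wt (\<Gamma> z)) + 2 * ln (cmod (co k z)))"
    using co_k_nz by (intro continuous_intros) auto
  then show ?thesis by (simp add: vf_eq cong: continuous_on_cong)
qed

end

context semipos
begin

text \<open>By surjectivity of \<open>\<pi> x\<close> the functional \<open>lp lam x\<close> is
  nonzero, hence nonzero on some frame vector, and the index of that vector selects the affine
  piece.\<close>

lemma graph_exists:
  assumes V: "(V, \<phi>) \<in> catlas R" "x \<in> V" and T: "(U, \<psi>) \<in> trivs E" "x \<in> U" and lam: "nz lam"
  obtains k where "graph R E V \<phi> U \<psi> k h \<pi> r2" "lp lam x (frame E \<psi> k x) \<noteq> 0" "k < r"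
proof -
  have x: "x \<in> X" using trivD(1)[OF T] .
  obtain v where v: "v \<in> fib E x" "lp lam x v \<noteq> 0" using lp_nonzero[OF x lam] .
  have "\<exists>k<r. lp lam x (frame E \<psi> k x) \<noteq> 0"
  proof (rule ccontr)
    assume "\<not> ?thesis"
    then have "cofun E \<psi> x (\<lambda>j. lp lam x (frame E \<psi> j x)) v = 0" by (simp add: cofun_def)
    then show False using lin_eq_cofun[OF T lin_lp[OF x] v(1)] v(2) by simp
  qed
  then obtain k where k: "k < r" "lp lam x (frame E \<psi> k x) \<noteq> 0" by blast
  have "graph R E V \<phi> U \<psi> k h \<pi> r2"
    using V T k hol_bundle_axioms bundle_metric_axioms semipos_axioms
    by (simp add: graph_def piece_metric_def affine_piece_def affine_piece_axioms_def)
  then show ?thesis using that k by blast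
qed

lemma vf_component_const:
  assumes lam: "nz lam" and xy: "connected_component_of (ctop R) x y"
  shows "vf lam x = vf lam y"
proof (rule compact_mfd_max_principle[OF M cpt _ xy])
  fix V \<phi> x assume V: "(V, \<phi>) \<in> catlas R" "x \<in> V"
  have "x \<in> X" using openin_subset[OF chart_open[OF M V(1)]] V(2) by auto
  then obtain U \<psi> where T: "(U, \<psi>) \<in> trivs E" "x \<in> U" using triv_exists by blast
  obtain k where g: "graph R E V \<phi> U \<psi> k h \<pi> r2" and kne: "lp lam x (frame E \<psi> k x) \<noteq> 0"
    using graph_exists[OF V T lam] by blast
  interpret graph R E V \<phi> U \<psi> k h \<pi> r2 lam by (rule g)
  have "\<phi> x \<in> Ok" using kne V T chart_inv[OF M V] by (simp add: Ok_def co_def)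
  moreover have "\<exists>L\<ge>0. has_laplacian (\<lambda>w. vf lam (inv_into V \<phi> (z(i := w)))) (z i) L" if "z \<in> Ok" "i < n" for z i
    using vf_laplacian[OF that] levi_nonneg[OF that] by (meson mult_nonneg_nonneg zero_le_numeral)
  ultimately show "\<exists>\<Omega>. Cn_open n \<Omega> \<and> \<phi> x \<in> \<Omega> \<and> \<Omega> \<subseteq> \<phi> ` V \<and> continuous_on \<Omega> (\<lambda>z. vf lam (inv_into V \<phi> z)) \<and>
         (\<forall>z\<in>\<Omega>. \<forall>i<n. \<exists>L\<ge>0. has_laplacian (\<lambda>w. vf lam (inv_into V \<phi> (z(i := w)))) (z i) L)"
    using Ok_open Ok_sub(2) vf_continuous by blast
qed

end

context graph
begin

text \<open>Polydiscs are connected, so \<open>vf_component_const\<close> makes the potential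
  constant near each point. Its Laplacian in each variable is then 0, which makes the velocity of
  the section a null vector of the Levi form.\<close>

lemma wirt_holo:
  assumes lam: "nz lam" and l: "l < N"
  shows "holo_Cn n Ok (\<lambda>z. wirt l wt (\<Gamma> z))"
  unfolding holo_Cn_def
proof (intro conjI ballI allI impI)
  have "continuous_on Om (wirt l wt)" by (rule Ck_Cn_continuous[OF Ck_Cn_wirt(1)[OF Om_open wt_Ck l]])
  then show "continuous_on Ok (\<lambda>z. wirt l wt (\<Gamma> z))"
    by (rule continuous_on_compose2[OF _ \<Gamma>_cont]) (use \<Gamma>_Om in auto)
  fix z i assume z: "z \<in> Ok" and i: "i < n"
  interpret holo_disc N Om "slice z i" "\<lambda>w. \<Gamma> (z(i := w))" by (rule disc[OF z i])
  obtain \<delta> where \<delta>: "\<delta> > 0" "polydisc n z \<delta> \<subseteq> Ok" using Cn_open_contains_polydisc[OF Ok_open z] .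
  have zC: "z \<in> Cn n" by (rule Cn_openD[OF Ok_open z])
  have "\<forall>\<^sub>F w in nhds (z i). w \<in> ball (z i) \<delta>" using \<delta> by (intro eventually_nhds_in_open) auto
  then have const: "\<forall>\<^sub>F w in nhds (z i). vf lam (inv_into V \<phi> (z(i := w))) = vf lam (inv_into V \<phi> z)"
  proof eventually_elim
    case (elim w)
    then have "z(i := w) \<in> polydisc n z \<delta>"
      using zC \<delta> i by (auto simp: polydisc_def dist_commute intro: Cn_upd)
    then have "connected_component_of (ctop R) (inv_into V \<phi> z) (inv_into V \<phi> (z(i := w)))"
      using \<delta> Ok_sub(2) centre_in_polydisc[OF zC \<delta>(1)]
      by (intro chart_polydisc_component[OF M chart, of _ \<delta>]) auto
    then show ?case using vf_component_const[OF lam] by metis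
  qed
  have "Re (levi wt (z i)) = 0"
    using has_laplacian_locally_const[OF vf_laplacian[OF z i] const] by simp
  moreover have "\<Gamma> (z(i := z i)) \<in> Om" using \<Gamma>_Om[OF z] by simp
  ultimately show "(\<lambda>w. wirt l wt (\<Gamma> (z(i := w)))) field_differentiable (at (z i))"
    using wirt_comp_field_differentiable[OF wt_Ck slice_mem[OF z] wt_real psd _ l] by simp
qed

end

section \<open>The fibrewise gradient\<close>

lemma DERIV_ln_cmod_line:
  assumes "w0 \<noteq> 0"
  shows "((\<lambda>t. 2 * ln (cmod (w0 + of_real t * e))) has_real_derivative 2 * Re (e / w0)) (at 0)"
proof -
  define a where "a = (Re w0)\<^sup>2 + (Im w0)\<^sup>2"
  have a: "a > 0" using assms by (simp add: a_def complex_neq_0)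
  \<comment> \<open>At 0 both sides are 0 because \<open>ln 0 = 0\<close>, so the rewriting needs no
    restriction on \<open>t\<close>.\<close>
  have eq: "2 * ln (cmod w) = ln ((Re w)\<^sup>2 + (Im w)\<^sup>2)" for w
  proof (cases "w = 0")
    case False
    then show ?thesis by (simp add: ln_realpow flip: cmod_power2)
  qed simp
  have "((\<lambda>t. ln ((Re w0 + t * Re e)\<^sup>2 + (Im w0 + t * Im e)\<^sup>2)) has_real_derivative
      (2 * (Re w0 * Re e) + 2 * (Im w0 * Im e)) / a) (at 0)"
    using a by (auto intro!: derivative_eq_intros simp: a_def field_simps)
  moreover have "(2 * (Re w0 * Re e) + 2 * (Im w0 * Im e)) / a = 2 * Re (e / w0)"
    by (simp add: Re_divide a_def mult.commute field_simps)
  ultimately show ?thesis by (simp add: eq)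
qed

context piece_metric
begin

text \<open>The coefficients of \<open>\<eta> j\<close> in the derivative of \<open>uf\<close> along
  \<open>b + t \<eta>\<close>, before taking twice the real part. For \<open>j\<close> other than
  \<open>k\<close> only the numerator of one affine coordinate moves; index \<open>k\<close>
  collects the change of the common denominator and the term \<open>1 / b k\<close> from the
  logarithm in \<open>uf_eq_wt\<close>.\<close>

definition svec :: "cvec \<Rightarrow> cvec \<Rightarrow> cvec" where
  "svec b \<zeta> = (\<lambda>j. if j = k then 1 / b k - (\<Sum>m<r-1. wirt (n + m) wt \<zeta> * b (skip k m)) / (b k)\<^sup>2
     else if j < r then wirt (n + unskip k j) wt \<zeta> / b k else 0)"

lemma wirt_bar_wt: "\<zeta> \<in> Om \<Longrightarrow> i < N \<Longrightarrow> wirt_bar i wt \<zeta> = cnj (wirt i wt \<zeta>)"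
proof -
  assume z: "\<zeta> \<in> Om" and i: "i < N"
  have "cnj (wirt i wt \<zeta>) = wirt_bar i (\<lambda>z. cnj (wt z)) \<zeta>" by (rule cnj_wirt(1)[OF wt_Ck z i])
  also have "\<dots> = wirt_bar i wt \<zeta>" by (rule wirt_cong(2)[OF Om_open wt_real z i])
  finally show ?thesis by simp
qed

lemma uf_deriv:
  assumes x: "x \<in> V \<inter> U" and b: "b k \<noteq> 0"
  shows "((\<lambda>t. uf x (cofun E \<psi> x (\<lambda>j. b j + of_real t * \<eta> j))) has_real_derivative
     2 * Re (\<Sum>j<r. \<eta> j * svec b (pt k (\<phi> x) b) j)) (at 0)"
proof -
  define \<zeta> where "\<zeta> = pt k (\<phi> x) b"
  have \<zeta>: "\<zeta> \<in> Om" unfolding \<zeta>_def by (rule pt_Om[OF x])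
  define S where "S = {t::real. b k + of_real t * \<eta> k \<noteq> 0}"
  have S: "open S" "0 \<in> S"
    unfolding S_def using b by (auto intro!: open_Collect_neq continuous_intros)
  define \<gamma> where "\<gamma> = (\<lambda>t::real. pt k (\<phi> x) (\<lambda>j. b j + of_real t * \<eta> j))"
  have \<gamma>0: "\<gamma> 0 = \<zeta>" by (simp add: \<gamma>_def \<zeta>_def)
  \<comment> \<open>The velocity of the affine coordinates at 0, by the quotient rule; the base
    point does not move.\<close>
  define dd where "dd = (\<lambda>i. if i < n then 0 else (\<eta> (skip k (i - n)) * b k - b (skip k (i - n)) * \<eta> k) / (b k)\<^sup>2)"
  have \<gamma>i: "(\<lambda>t. \<gamma> t i) = (if i < n then (\<lambda>t. \<phi> x i)
      else (\<lambda>t. (b (skip k (i - n)) + of_real t * \<eta> (skip k (i - n))) / (b k + of_real t * \<eta> k)))" if "i < N" for i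
    unfolding \<gamma>_def pt_def using that by (simp only: if_True) auto
  have "((\<lambda>t. wt (\<gamma> t)) has_derivative
     (\<lambda>h. \<Sum>i<N. wirt i wt (\<gamma> 0) * (of_real h * dd i) + wirt_bar i wt (\<gamma> 0) * cnj (of_real h * dd i))) (at 0)"
  proof (rule Cn_chain_rule[OF Om_open wt_Ck S])
    show "continuous_on S (\<lambda>t. \<gamma> t i)" if "i < N" for i
      unfolding \<gamma>i[OF that] by (auto intro!: continuous_intros simp: S_def)
    show "\<gamma> t \<in> Om" for t unfolding \<gamma>_def by (rule pt_Om[OF x])
    show "((\<lambda>t. \<gamma> t i) has_derivative (\<lambda>h. of_real h * dd i)) (at 0)" if "i < N" for i
    proof (cases "i < n")
      case True
      then show ?thesis unfolding \<gamma>i[OF that] by (simp add: dd_def)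
    next
      case False
      let ?s = "skip k (i - n)"
      have "((\<lambda>w. (b ?s + w * \<eta> ?s) / (b k + w * \<eta> k)) has_field_derivative dd i) (at (of_real 0))"
        using b False by (auto intro!: derivative_eq_intros simp: dd_def power2_eq_square field_simps)
      from has_vector_derivative_real_field[OF this] show ?thesis
        unfolding \<gamma>i[OF that] using False by (simp add: has_vector_derivative_def scaleR_conv_of_real)
    qed
  qed
  then have "((\<lambda>t. Re (wt (\<gamma> t))) has_derivative
     (\<lambda>h. Re (\<Sum>i<N. wirt i wt (\<gamma> 0) * (of_real h * dd i) + wirt_bar i wt (\<gamma> 0) * cnj (of_real h * dd i)))) (at 0)"
    by (rule has_derivative_Re)
  moreover have "Re (\<Sum>i<N. wirt i wt (\<gamma> 0) * (of_real s * dd i) + wirt_bar i wt (\<gamma> 0) * cnj (of_real s * dd i))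
      = 2 * Re (\<Sum>i<N. wirt i wt \<zeta> * dd i) * s" for s :: real
  proof -
    \<comment> \<open>\<open>wt\<close> is real, so the two Wirtinger terms are conjugate and add up
      to twice a real part.\<close>
    have "Re (wirt i wt \<zeta> * (of_real s * dd i) + wirt_bar i wt \<zeta> * cnj (of_real s * dd i))
        = 2 * Re (wirt i wt \<zeta> * dd i) * s" if "i < N" for i
      unfolding wirt_bar_wt[OF \<zeta> that] by (simp add: algebra_simps)
    then show ?thesis by (simp add: \<gamma>0 sum_distrib_left sum_distrib_right)
  qed
  ultimately have 1: "((\<lambda>t. Re (wt (\<gamma> t))) has_real_derivative 2 * Re (\<Sum>i<N. wirt i wt \<zeta> * dd i)) (at 0)"
    by (simp only: has_field_derivative_def)
  have 2: "((\<lambda>t. 2 * ln (cmod (b k + of_real t * \<eta> k))) has_real_derivative 2 * Re (\<eta> k / b k)) (at 0)"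
    by (rule DERIV_ln_cmod_line[OF b])
  have "(\<Sum>i<N. wirt i wt \<zeta> * dd i) + \<eta> k / b k = (\<Sum>j<r. \<eta> j * svec b \<zeta> j)"
  proof -
    have "(\<Sum>i<N. wirt i wt \<zeta> * dd i) = (\<Sum>m<r-1. wirt (n + m) wt \<zeta> * dd (n + m))"
      unfolding sum_lessThan_add by (simp add: dd_def)
    also have "\<dots> = (\<Sum>m<r-1. \<eta> (skip k m) * (wirt (n + m) wt \<zeta> / b k)
        - \<eta> k * (wirt (n + m) wt \<zeta> * b (skip k m) / (b k)\<^sup>2))"
      using b by (intro sum.cong refl) (simp add: dd_def field_simps power2_eq_square)
    also have "\<dots> = (\<Sum>m<r-1. \<eta> (skip k m) * (wirt (n + m) wt \<zeta> / b k))
        - \<eta> k * ((\<Sum>m<r-1. wirt (n + m) wt \<zeta> * b (skip k m)) / (b k)\<^sup>2)"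
      by (simp add: sum_subtractf sum_distrib_left sum_divide_distrib)
    also have "(\<Sum>m<r-1. \<eta> (skip k m) * (wirt (n + m) wt \<zeta> / b k)) = (\<Sum>m<r-1. \<eta> (skip k m) * svec b \<zeta> (skip k m))"
      using skip_less[of _ r k] k by (intro sum.cong refl) (auto simp: svec_def skip_neq)
    finally show ?thesis
      unfolding sum_skip[OF k] by (simp add: svec_def algebra_simps)
  qed
  with DERIV_add[OF 1 2] have 3: "((\<lambda>t. Re (wt (\<gamma> t)) + 2 * ln (cmod (b k + of_real t * \<eta> k))) has_real_derivative
      2 * Re (\<Sum>j<r. \<eta> j * svec b \<zeta> j)) (at 0)"
    by (simp only: distrib_left[symmetric] plus_complex.sel(1)[symmetric])
  have "\<forall>\<^sub>F t in nhds 0. t \<in> S" using S by (rule eventually_nhds_in_open)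
  then have "\<forall>\<^sub>F t in nhds 0. Re (wt (\<gamma> t)) + 2 * ln (cmod (b k + of_real t * \<eta> k)) = uf x (cofun E \<psi> x (\<lambda>j. b j + of_real t * \<eta> j))"
    by eventually_elim (simp add: S_def \<gamma>_def uf_eq_wt[OF x])
  from DERIV_cong_ev[OF refl this refl, THEN iffD1, OF 3] show ?thesis unfolding \<zeta>_def .
qed

end

context bundle_metric
begin

text \<open>The derivative of \<open>uf\<close> in the direction \<open>\<eta>\<close> is linear in \<open>\<eta>\<close>, hence given by a vector of \<open>E\<^sub>x\<close>:
  the gradient is defined without reference to a trivialisation.\<close>

definition is_grad :: "'a \<Rightarrow> ('v \<Rightarrow> complex) \<Rightarrow> 'v \<Rightarrow> bool" where
  "is_grad x \<xi> s \<longleftrightarrow> s \<in> fib E x \<and>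
     (\<forall>\<eta>. lin_on E x \<eta> \<longrightarrow> ((\<lambda>t. uf x (\<lambda>v. \<xi> v + of_real t * \<eta> v)) has_real_derivative 2 * Re (\<eta> s)) (at 0))"

text \<open>A test functional may be multiplied by \<i>, so the real parts of the values determine
  the values themselves, and these determine the vector.\<close>

lemma is_grad_unique:
  assumes x: "x \<in> X" and s: "is_grad x \<xi> s" "is_grad x \<xi> s'"
  shows "s = s'"
proof -
  obtain U \<psi> where T: "(U, \<psi>) \<in> trivs E" "x \<in> U" using triv_exists[OF x] .
  have eq: "Re (\<eta> s) = Re (\<eta> s')" if "lin_on E x \<eta>" for \<eta>
    using s that DERIV_unique unfolding is_grad_def by fastforce
  have sf: "s \<in> fib E x" "s' \<in> fib E x" using s by (auto simp: is_grad_def)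
  show ?thesis
  proof (rule triv_inj[OF T sf], rule ext)
    fix j
    show "\<psi> x s j = \<psi> x s' j"
    proof (cases "j < r")
      case True
      have c: "cofun E \<psi> x (\<lambda>i. c * cunit j i) v = c * \<psi> x v j" for c v
        using True by (simp add: cofun_def cunit_def if_distrib if_distribR cong: if_cong)
      from eq[OF lin_cofun[OF T]] have "Re (c * \<psi> x s j) = Re (c * \<psi> x s' j)" for c unfolding c[symmetric] .
      from this[of 1] this[of "\<i>"] show ?thesis by (simp add: complex_eq_iff)
    next
      case False
      have "\<psi> x s \<in> Cn r" "\<psi> x s' \<in> Cn r" using trivD(2)[OF T] sf by (auto simp: bij_betw_def)
      then show ?thesis using False by (simp add: Cn_def)
    qed
  qed
qed

end

context piece_metric
begin

lemma grad_exists: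
  assumes x: "x \<in> V \<inter> U" and \<xi>: "lin_on E x \<xi>" "\<xi> (fr k x) \<noteq> 0"
  obtains s where "is_grad x \<xi> s" "\<psi> x s = svec (\<lambda>j. \<xi> (fr j x)) (pt k (\<phi> x) (\<lambda>j. \<xi> (fr j x)))"
proof -
  let ?b = "\<lambda>j. \<xi> (fr j x)"
  let ?sv = "svec ?b (pt k (\<phi> x) ?b)"
  have xU: "x \<in> U" using x by simp
  have "?sv \<in> Cn r" using k by (auto simp: svec_def Cn_def)
  then have "?sv \<in> \<psi> x ` fib E x" using trivD(2)[OF triv xU] by (simp add: bij_betw_def)
  then obtain s where s: "s \<in> fib E x" "\<psi> x s = ?sv" by auto
  have "is_grad x \<xi> s"
    unfolding is_grad_def
  proof (intro conjI allI impI)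
    fix \<eta> assume \<eta>: "lin_on E x \<eta>"
    have "\<eta> s = (\<Sum>j<r. \<eta> (fr j x) * ?sv j)"
      using lin_eq_cofun[OF triv xU \<eta> s(1)] s(2) by (simp add: cofun_def)
    moreover have "uf x (\<lambda>v. \<xi> v + of_real t * \<eta> v) = uf x (cofun E \<psi> x (\<lambda>j. ?b j + of_real t * \<eta> (fr j x)))" for t :: real
      using lin_eq_cofun[OF triv xU \<xi>(1)] lin_eq_cofun[OF triv xU \<eta>]
      by (intro uf_cong) (simp add: cofun_def sum.distrib sum_distrib_left algebra_simps)
    ultimately show "((\<lambda>t. uf x (\<lambda>v. \<xi> v + of_real t * \<eta> v)) has_real_derivative 2 * Re (\<eta> s)) (at 0)"
      using uf_deriv[OF x, of ?b "\<lambda>j. \<eta> (fr j x)"] \<xi>(2) by simp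
  qed (rule s)
  then show ?thesis using that s by blast
qed

end

section \<open>The gradient as a global holomorphic section\<close>

context semipos
begin

definition holosec :: "('a \<Rightarrow> 'v) \<Rightarrow> bool" where
  "holosec s \<longleftrightarrow> (\<forall>x\<in>X. s x \<in> fib E x) \<and> (\<forall>(U, \<psi>)\<in>trivs E. \<forall>j<r. mfd_holo R U (\<lambda>x. \<psi> x (s x) j))"

definition gsec :: "cvec \<Rightarrow> 'a \<Rightarrow> 'v" where "gsec lam x = (SOME s. is_grad x (lp lam x) s)"

text \<open>Uniqueness identifies the choice made in \<open>gsec\<close> with the vector found in
  any chart, so the local coordinate formulas describe one global section.\<close>

lemma gsec_coords:
  assumes g: "graph R E V \<phi> U \<psi> k h \<pi> r2" and x: "x \<in> V \<inter> U" and kne: "lp lam x (frame E \<psi> k x) \<noteq> 0"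
  shows "is_grad x (lp lam x) (gsec lam x)"
    "\<psi> x (gsec lam x) = piece_metric.svec R E V \<phi> U \<psi> k h (\<lambda>j. lp lam x (frame E \<psi> j x))
       (pt k (\<phi> x) (\<lambda>j. lp lam x (frame E \<psi> j x)))"
proof -
  interpret graph R E V \<phi> U \<psi> k h \<pi> r2 lam by (rule g)
  have xX: "x \<in> X" using trivD(1)[OF triv] x by auto
  obtain s where s: "is_grad x (lp lam x) s" "\<psi> x s = svec (\<lambda>j. lp lam x (fr j x)) (pt k (\<phi> x) (\<lambda>j. lp lam x (fr j x)))"
    using grad_exists[OF x lin_lp[OF xX] kne] .
  have gs: "is_grad x (lp lam x) (gsec lam x)" unfolding gsec_def by (rule someI[of _ s], rule s)
  then show "is_grad x (lp lam x) (gsec lam x)" .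
  have "gsec lam x = s" by (rule is_grad_unique[OF xX gs s(1)])
  then show "\<psi> x (gsec lam x) = svec (\<lambda>j. lp lam x (fr j x)) (pt k (\<phi> x) (\<lambda>j. lp lam x (fr j x)))"
    using s(2) by simp
qed

lemma chart_exists:
  assumes "x \<in> X" obtains V \<phi> where "(V, \<phi>) \<in> catlas R" "x \<in> V"
proof -
  have "(\<Union>(V, \<phi>)\<in>catlas R. V) = X" using M unfolding complex_manifold_def by (elim conjE)
  then have "x \<in> (\<Union>(V, \<phi>)\<in>catlas R. V)" using assms by simp
  then show ?thesis using that by auto
qed

lemma gsec_grad:
  assumes x: "x \<in> X" and lam: "nz lam"
  shows "is_grad x (lp lam x) (gsec lam x)"
proof -
  obtain U \<psi> where T: "(U, \<psi>) \<in> trivs E" "x \<in> U" using triv_exists[OF x] .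
  obtain V \<phi> where V: "(V, \<phi>) \<in> catlas R" "x \<in> V" using chart_exists[OF x] .
  obtain k where "graph R E V \<phi> U \<psi> k h \<pi> r2" "lp lam x (frame E \<psi> k x) \<noteq> 0"
    using graph_exists[OF V T lam] .
  then show ?thesis using gsec_coords(1) V T by blast
qed

end

context graph
begin

text \<open>The coordinates \<open>svec\<close> are rational in the coefficients \<open>co\<close>
  and in the derivatives of \<open>wt\<close> along the graph, which are holomorphic by
  \<open>wirt_holo\<close>; the only denominators are powers of \<open>co k\<close>.\<close>

lemma gsec_holo:
  assumes lam: "nz lam" and j: "j < r"
  shows "holo_Cn n Ok (\<lambda>z. \<psi> (inv_into V \<phi> z) (gsec lam (inv_into V \<phi> z)) j)"
proof (rule holo_Cn_cong[OF Ok_open])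
  show "svec (\<lambda>j. co j z) (\<Gamma> z) j = \<psi> (inv_into V \<phi> z) (gsec lam (inv_into V \<phi> z)) j" if z: "z \<in> Ok" for z
    using gsec_coords(2)[OF graph_axioms inv_Ok(1)[OF z], of lam] co_k_nz[OF z] inv_Ok(2)[OF z]
    by (simp add: co_def \<Gamma>_def)
next
  have sq: "co k z * co k z \<noteq> 0" if "z \<in> Ok" for z using co_k_nz[OF that] by simp
  have "holo_Cn n Ok (\<lambda>z. 1 / co k z - (\<Sum>m<r-1. wirt (n + m) wt (\<Gamma> z) * co (skip k m) z) / (co k z * co k z))"
    by (intro holo_Cn_diff holo_Cn_divide holo_Cn_const holo_Cn_sum holo_Cn_mult wirt_holo[OF lam] co_holo_Ok co_k_nz sq k)
       (auto intro!: skip_less k)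
  moreover have "holo_Cn n Ok (\<lambda>z. wirt (n + unskip k j) wt (\<Gamma> z) / co k z)" if "j \<noteq> k"
    using unskip_less[OF j that k] by (intro holo_Cn_divide wirt_holo[OF lam] co_holo_Ok co_k_nz k) auto
  ultimately show "holo_Cn n Ok (\<lambda>z. svec (\<lambda>j. co j z) (\<Gamma> z) j)"
    unfolding svec_def power2_eq_square using j
    by (cases "j = k") (simp_all only: if_True if_False simp_thms)
qed

end

context semipos
begin

lemma gsec_holosec:
  assumes lam: "nz lam"
  shows "holosec (gsec lam)"
  unfolding holosec_def
proof (intro conjI ballI, goal_cases)
  case (1 x)
  then show ?case using gsec_grad[OF 1 lam] by (simp add: is_grad_def)
next
  case (2 T)
  obtain U \<psi> where T: "T = (U, \<psi>)" "(U, \<psi>) \<in> trivs E" using 2 by (cases T) auto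
  have "mfd_holo R U (\<lambda>x. \<psi> x (gsec lam x) j)" if j: "j < r" for j
    unfolding mfd_holo_def
  proof (clarify)
    fix V \<phi> assume V: "(V, \<phi>) \<in> catlas R"
    show "holo_Cn n (\<phi> ` (V \<inter> U)) (\<lambda>z. \<psi> (inv_into V \<phi> z) (gsec lam (inv_into V \<phi> z)) j)"
    proof (rule holo_Cn_local)
      fix z assume z: "z \<in> \<phi> ` (V \<inter> U)"
      then obtain x where x: "x \<in> V" "x \<in> U" "z = \<phi> x" by blast
      obtain k where g: "graph R E V \<phi> U \<psi> k h \<pi> r2" and kne: "lp lam x (frame E \<psi> k x) \<noteq> 0"
        using graph_exists[OF V x(1) T(2) x(2) lam] .
      interpret graph R E V \<phi> U \<psi> k h \<pi> r2 lam by (rule g)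
      have "z \<in> Ok" using x kne chart_inv[OF M V x(1)] by (simp add: Ok_def co_def)
      then show "\<exists>\<Omega>'. Cn_open n \<Omega>' \<and> z \<in> \<Omega>' \<and> \<Omega>' \<subseteq> \<phi> ` (V \<inter> U) \<and>
          holo_Cn n \<Omega>' (\<lambda>z. \<psi> (inv_into V \<phi> z) (gsec lam (inv_into V \<phi> z)) j)"
        using Ok_open Ok_sub(1) gsec_holo[OF lam j] by blast
    qed
  qed
  then show ?case by (simp add: T)
qed

text \<open>\<open>lp\<close> is linear in \<open>lam\<close>, so moving \<open>lam\<close> in the
  direction \<open>\<mu>\<close> moves the functional in the direction \<open>lp \<mu> x\<close>,
  which sees only the image of the gradient under \<open>\<pi>\<close>.\<close>

lemma gsec_deriv:
  assumes x: "x \<in> X" and lam: "nz lam"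
  shows "((\<lambda>t. vf (\<lambda>i. lam i + of_real t * \<mu> i) x) has_real_derivative
      2 * Re (\<Sum>i<r2. \<mu> i * \<pi> x (gsec lam x) i)) (at 0)"
proof -
  have eq: "vf (\<lambda>i. lam i + of_real t * \<mu> i) x = uf x (\<lambda>v. lp lam x v + of_real t * lp \<mu> x v)" for t :: real
    unfolding vf_def by (rule uf_cong) (simp add: lp_def algebra_simps sum.distrib sum_distrib_left)
  have d: "((\<lambda>t. uf x (\<lambda>v. lp lam x v + of_real t * lp \<mu> x v)) has_real_derivative 2 * Re (lp \<mu> x (gsec lam x))) (at 0)"
    using gsec_grad[OF x lam] lin_lp[OF x, of \<mu>] unfolding is_grad_def by blast
  have "lp \<mu> x (gsec lam x) = (\<Sum>i<r2. \<mu> i * \<pi> x (gsec lam x) i)" by (simp add: lp_def)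
  with d show ?thesis unfolding eq by (simp only:)
qed

text \<open>For all functionals near \<open>lam\<close> the potentials at \<open>x\<close> and at
  \<open>y\<close> agree. So do their derivatives with respect to \<open>lam\<close>, and by
  \<open>gsec_deriv\<close> these determine the image of the gradient.\<close>

lemma gsec_component_const:
  assumes lam: "nz lam" and xy: "connected_component_of (ctop R) x y"
  shows "\<pi> x (gsec lam x) = \<pi> y (gsec lam y)"
proof -
  have X: "x \<in> X" "y \<in> X" using xy connected_component_in_topspace by metis+
  have eq: "Re (\<Sum>i<r2. \<mu> i * \<pi> x (gsec lam x) i) = Re (\<Sum>i<r2. \<mu> i * \<pi> y (gsec lam y) i)" for \<mu> :: cvec
  proof -
    obtain i where i: "i < r2" "lam i \<noteq> 0" using lam by (auto simp: nz_def)
    \<comment> \<open>The perturbed functionals must stay nonzero for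
      \<open>vf_component_const\<close> to apply; one nonzero entry ensures this for small
      \<open>t\<close>.\<close>
    have "open {t::real. lam i + of_real t * \<mu> i \<noteq> 0}" by (intro open_Collect_neq continuous_intros)
    then have "\<forall>\<^sub>F t::real in nhds 0. t \<in> {t::real. lam i + of_real t * \<mu> i \<noteq> 0}"
      using i(2) by (intro eventually_nhds_in_open) auto
    then have "\<forall>\<^sub>F t::real in nhds 0. vf (\<lambda>i. lam i + of_real t * \<mu> i) x = vf (\<lambda>i. lam i + of_real t * \<mu> i) y"
      by eventually_elim (rule vf_component_const[OF _ xy], use i in \<open>auto simp: nz_def\<close>)
    from DERIV_cong_ev[OF refl this refl, THEN iffD1, OF gsec_deriv[OF X(1) lam, of \<mu>]]
    have "2 * Re (\<Sum>i<r2. \<mu> i * \<pi> x (gsec lam x) i) = 2 * Re (\<Sum>i<r2. \<mu> i * \<pi> y (gsec lam y) i)"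
      using gsec_deriv[OF X(2) lam, of \<mu>] by (rule DERIV_unique)
    then show ?thesis by linarith
  qed
  have C: "\<pi> x (gsec lam x) \<in> Cn r2" "\<pi> y (gsec lam y) \<in> Cn r2"
    using homD(1)[OF X(1)] homD(1)[OF X(2)] gsec_grad[OF X(1) lam] gsec_grad[OF X(2) lam] by (auto simp: is_grad_def)
  show ?thesis
  proof
    fix j show "\<pi> x (gsec lam x) j = \<pi> y (gsec lam y) j"
    proof (cases "j < r2")
      case True
      have c: "(\<Sum>i<r2. (c * cunit j i) * f i) = c * f j" for c and f :: cvec
        using True by (simp add: cunit_def if_distrib if_distribR cong: if_cong)
      from eq[of "\<lambda>i. c * cunit j i" for c] have "Re (c * \<pi> x (gsec lam x) j) = Re (c * \<pi> y (gsec lam y) j)" for c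
        unfolding c .
      from this[of 1] this[of \<i>] show ?thesis by (simp add: complex_eq_iff)
    next
      case False then show ?thesis using C by (simp add: Cn_def)
    qed
  qed
qed

text \<open>The derivative of \<open>vf\<close> in the direction of \<open>lam\<close> itself, where
  the scaling rule of \<open>metric_facts\<close> leaves a constant plus
  \<open>2 * ln (cmod (1 + t))\<close>.\<close>

lemma gsec_euler:
  assumes x: "x \<in> X" and lam: "nz lam"
  shows "Re (\<Sum>i<r2. lam i * \<pi> x (gsec lam x) i) = 1"
proof -
  obtain v where v: "v \<in> fib E x" "lp lam x v \<noteq> 0" using lp_nonzero[OF x lam] .
  have eq: "vf (\<lambda>i. lam i + of_real t * lam i) x = vf lam x + 2 * ln (cmod (1 + of_real t * 1))"
    if "t \<in> {-1<..<1}" for t :: real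
  proof -
    have "vf (\<lambda>i. lam i + of_real t * lam i) x = uf x (\<lambda>v. (1 + of_real t) * lp lam x v)"
      unfolding vf_def by (rule uf_cong) (simp add: lp_def algebra_simps sum.distrib sum_distrib_left)
    moreover have "1 + complex_of_real t \<noteq> 0" using that by (auto simp: complex_eq_iff)
    ultimately show ?thesis using metric_facts(2)[OF x lin_lp[OF x] v] by (simp add: vf_def)
  qed
  have d: "((\<lambda>t. vf lam x + 2 * ln (cmod (1 + of_real t * 1))) has_real_derivative 0 + 2 * Re (1 / 1)) (at 0)"
    by (intro DERIV_add DERIV_const DERIV_ln_cmod_line) simp
  have "\<forall>\<^sub>F t in nhds 0. t \<in> {-1<..<(1::real)}" by (rule eventually_nhds_in_open) auto
  then have "\<forall>\<^sub>F t in nhds 0. vf (\<lambda>i. lam i + of_real t * lam i) x = vf lam x + 2 * ln (cmod (1 + of_real t * 1))"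
    by eventually_elim (rule eq)
  from DERIV_cong_ev[OF refl this refl, THEN iffD2, OF d]
  have "((\<lambda>t. vf (\<lambda>i. lam i + of_real t * lam i) x) has_real_derivative 0 + 2 * Re (1 / 1)) (at 0)" .
  from DERIV_unique[OF gsec_deriv[OF x lam, of lam] this]
  have "2 * Re (\<Sum>i<r2. lam i * \<pi> x (gsec lam x) i) = 2" by (simp only:) simp
  then show ?thesis by linarith
qed

end

section \<open>Splitting\<close>

text \<open>With pointwise complex scaling, bases and extension of linear maps become available for
  the separation argument.\<close>

interpretation cv: vector_space "\<lambda>(c::complex) (a::cvec) i. c * a i"
  by (unfold_locales; simp add: plus_fun_def fun_eq_iff distrib_left distrib_right mult.assoc)

interpretation cvc: vector_space_pair "\<lambda>(c::complex) (a::cvec) i. c * a i" "(*) :: complex \<Rightarrow> complex \<Rightarrow> complex"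
  by (unfold_locales; simp add: distrib_left distrib_right mult.assoc)

text \<open>A basis of \<open>S\<close> stays independent when \<open>w\<close> is added, so a
  functional may be prescribed as 1 at \<open>w\<close> and 0 on the basis.\<close>

lemma separating_functional:
  assumes S: "cv.subspace S" and w: "w \<notin> S"
  obtains g where "Vector_Spaces.linear (\<lambda>c a i. c * a i) (*) g" "g w = (1::complex)" "\<And>v. v \<in> S \<Longrightarrow> g v = 0"
proof -
  obtain B where B: "B \<subseteq> S" "cv.independent B" "S \<subseteq> cv.span B"
    by (rule cv.maximal_independent_subset)
  have "cv.span B \<subseteq> S" using B(1) S by (rule cv.span_minimal)
  then have wB: "w \<notin> cv.span B" using w by blast
  then have ind: "cv.independent (insert w B)"
    using B(2) by (rule cv.independent_insertI)
  obtain g where g: "Vector_Spaces.linear (\<lambda>c a i. c * a i) (*) g"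
    "\<forall>x\<in>insert w B. g x = (if x = w then 1 else 0)"
    using cvc.linear_independent_extend[OF ind, of "\<lambda>x. if x = w then 1 else 0"] by blast
  have gB: "g b = 0" if "b \<in> B" for b
    using g(2) that wB cv.span_base by fastforce
  have "g v = 0" if "v \<in> S" for v
    using cvc.linear_eq_0_on_span[OF g(1) gB] B(3) that by blast
  then show ?thesis using that g by simp
qed

section \<open>Locality of holomorphy on a manifold\<close>

lemma mfd_holo_cong:
  assumes M: "complex_manifold M" and W: "openin (ctop M) W"
    and eq: "\<And>x. x \<in> W \<Longrightarrow> f x = g x" and f: "mfd_holo M W f"
  shows "mfd_holo M W g"
  unfolding mfd_holo_def
proof clarify
  fix V \<phi> assume V: "(V, \<phi>) \<in> catlas M"
  have "holo_Cn (cdim M) (\<phi> ` (V \<inter> W)) (\<lambda>z. f (inv_into V \<phi> z))" using f V by (auto simp: mfd_holo_def)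
  then show "holo_Cn (cdim M) (\<phi> ` (V \<inter> W)) (\<lambda>z. g (inv_into V \<phi> z))"
    by (rule holo_Cn_cong[OF chart_image_open_Int[OF M V W], rotated])
       (auto simp: chart_inv[OF M V] eq)
qed

lemma mfd_holo_subset: "mfd_holo M W f \<Longrightarrow> W' \<subseteq> W \<Longrightarrow> mfd_holo M W' f"
  unfolding mfd_holo_def
proof clarify
  fix V \<phi> assume "\<forall>(V, \<phi>)\<in>catlas M. holo_Cn (cdim M) (\<phi> ` (V \<inter> W)) (\<lambda>z. f (inv_into V \<phi> z))"
    and W: "W' \<subseteq> W" and "(V, \<phi>) \<in> catlas M"
  then have "holo_Cn (cdim M) (\<phi> ` (V \<inter> W)) (\<lambda>z. f (inv_into V \<phi> z))" by auto
  then show "holo_Cn (cdim M) (\<phi> ` (V \<inter> W')) (\<lambda>z. f (inv_into V \<phi> z))"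
    by (rule holo_Cn_subset) (use W in auto)
qed

lemma mfd_holo_local:
  assumes M: "complex_manifold M"
    and loc: "\<And>x. x \<in> W \<Longrightarrow> \<exists>W'. openin (ctop M) W' \<and> x \<in> W' \<and> W' \<subseteq> W \<and> mfd_holo M W' f"
  shows "mfd_holo M W f"
  unfolding mfd_holo_def
proof clarify
  fix V \<phi> assume V: "(V, \<phi>) \<in> catlas M"
  show "holo_Cn (cdim M) (\<phi> ` (V \<inter> W)) (\<lambda>z. f (inv_into V \<phi> z))"
  proof (rule holo_Cn_local)
    fix z assume "z \<in> \<phi> ` (V \<inter> W)"
    then obtain x where x: "x \<in> V" "x \<in> W" "z = \<phi> x" by blast
    obtain W' where W': "openin (ctop M) W'" "x \<in> W'" "W' \<subseteq> W" "mfd_holo M W' f" using loc[OF x(2)] by blast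
    have "holo_Cn (cdim M) (\<phi> ` (V \<inter> W')) (\<lambda>z. f (inv_into V \<phi> z))" using W'(4) V by (auto simp: mfd_holo_def)
    then show "\<exists>\<Omega>'. Cn_open (cdim M) \<Omega>' \<and> z \<in> \<Omega>' \<and> \<Omega>' \<subseteq> \<phi> ` (V \<inter> W) \<and> holo_Cn (cdim M) \<Omega>' (\<lambda>z. f (inv_into V \<phi> z))"
      using chart_image_open_Int[OF M V W'(1)] x W' by (intro exI[of _ "\<phi> ` (V \<inter> W')"]) auto
  qed
qed

section \<open>Holomorphic sections and lifts of the standard basis\<close>

context semipos
begin

lemma component_open:
  assumes "x \<in> X"
  obtains B where "openin (ctop R) B" "x \<in> B" "\<And>y. y \<in> B \<Longrightarrow> connected_component_of (ctop R) x y"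
proof -
  obtain V \<phi> where V: "(V, \<phi>) \<in> catlas R" "x \<in> V" using chart_exists[OF assms] .
  have z: "\<phi> x \<in> \<phi> ` V" using V by simp
  obtain \<delta> where \<delta>: "\<delta> > 0" "polydisc n (\<phi> x) \<delta> \<subseteq> \<phi> ` V"
    using Cn_open_contains_polydisc[OF chart_image_open[OF M V(1)] z] .
  have c: "\<phi> x \<in> polydisc n (\<phi> x) \<delta>"
    by (rule centre_in_polydisc[OF Cn_openD[OF chart_image_open[OF M V(1)] z] \<delta>(1)])
  show ?thesis
  proof (rule that)
    show "openin (ctop R) {y \<in> V. \<phi> y \<in> polydisc n (\<phi> x) \<delta>}"
      by (rule chart_preimage_open[OF M V(1) Cn_open_polydisc \<delta>(2)])
    show "x \<in> {y \<in> V. \<phi> y \<in> polydisc n (\<phi> x) \<delta>}" using V c by simp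
    show "connected_component_of (ctop R) x y" if "y \<in> {y \<in> V. \<phi> y \<in> polydisc n (\<phi> x) \<delta>}" for y
      using chart_polydisc_component[OF M V(1) \<delta>(2) c, of "\<phi> y"] that chart_inv[OF M V(1)] V(2) by simp
  qed
qed

lemma holosecD: "holosec s \<Longrightarrow> x \<in> X \<Longrightarrow> s x \<in> fib E x"
  "holosec s \<Longrightarrow> (U, \<psi>) \<in> trivs E \<Longrightarrow> j < r \<Longrightarrow> mfd_holo R U (\<lambda>x. \<psi> x (s x) j)"
  by (auto simp: holosec_def)

lemma holosecI:
  "(\<And>x. x \<in> X \<Longrightarrow> s x \<in> fib E x) \<Longrightarrow>
   (\<And>U \<psi> j. (U, \<psi>) \<in> trivs E \<Longrightarrow> j < r \<Longrightarrow> mfd_holo R U (\<lambda>x. \<psi> x (s x) j)) \<Longrightarrow> holosec s"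
  by (auto simp: holosec_def)

lemma holosec_zero: "holosec (vzero E)"
proof (rule holosecI)
  show "vzero E x \<in> fib E x" if "x \<in> X" for x using fib_closed(1)[OF that] .
  fix U \<psi> j assume T: "(U, \<psi>) \<in> trivs E" "j < r"
  show "mfd_holo R U (\<lambda>x. \<psi> x (vzero E x) j)"
  proof (rule mfd_holo_cong[OF M triv_open[OF T(1)], of "\<lambda>x. 0"])
    show "0 = \<psi> x (vzero E x) j" if "x \<in> U" for x using trivD(3)[OF T(1) that] by simp
    show "mfd_holo R U (\<lambda>x. 0)" by (auto simp: mfd_holo_def holo_Cn_const)
  qed
qed

lemma holosec_add: "holosec s \<Longrightarrow> holosec t \<Longrightarrow> holosec (\<lambda>x. vadd E x (s x) (t x))"
proof (rule holosecI)
  assume s: "holosec s" and t: "holosec t"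
  show "vadd E x (s x) (t x) \<in> fib E x" if "x \<in> X" for x
    using fib_closed(2)[OF that] holosecD(1)[OF s that] holosecD(1)[OF t that] .
  fix U \<psi> j assume T: "(U, \<psi>) \<in> trivs E" "j < r"
  show "mfd_holo R U (\<lambda>x. \<psi> x (vadd E x (s x) (t x)) j)"
  proof (rule mfd_holo_cong[OF M triv_open[OF T(1)], of "\<lambda>x. \<psi> x (s x) j + \<psi> x (t x) j"])
    show "\<psi> x (s x) j + \<psi> x (t x) j = \<psi> x (vadd E x (s x) (t x)) j" if "x \<in> U" for x
      using trivD(4)[OF T(1) that] holosecD(1)[OF s trivD(1)[OF T(1) that]] holosecD(1)[OF t trivD(1)[OF T(1) that]]
      by simp
    show "mfd_holo R U (\<lambda>x. \<psi> x (s x) j + \<psi> x (t x) j)"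
      using holosecD(2)[OF s T] holosecD(2)[OF t T] by (auto simp: mfd_holo_def intro!: holo_Cn_add)
  qed
qed

lemma holosec_scale: "holosec s \<Longrightarrow> holosec (\<lambda>x. vscale E x c (s x))"
proof (rule holosecI)
  assume s: "holosec s"
  show "vscale E x c (s x) \<in> fib E x" if "x \<in> X" for x
    using fib_closed(3)[OF that] holosecD(1)[OF s that] .
  fix U \<psi> j assume T: "(U, \<psi>) \<in> trivs E" "j < r"
  show "mfd_holo R U (\<lambda>x. \<psi> x (vscale E x c (s x)) j)"
  proof (rule mfd_holo_cong[OF M triv_open[OF T(1)], of "\<lambda>x. c * \<psi> x (s x) j"])
    show "c * \<psi> x (s x) j = \<psi> x (vscale E x c (s x)) j" if "x \<in> U" for x
      using trivD(5)[OF T(1) that] holosecD(1)[OF s trivD(1)[OF T(1) that]] by simp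
    show "mfd_holo R U (\<lambda>x. c * \<psi> x (s x) j)"
      using holosecD(2)[OF s T] by (auto simp: mfd_holo_def intro!: holo_Cn_mult holo_Cn_const)
  qed
qed

lemma pi_zero: "x \<in> X \<Longrightarrow> \<pi> x (vzero E x) = (\<lambda>i. 0)"
proof -
  assume x: "x \<in> X"
  obtain U \<psi> where T: "(U, \<psi>) \<in> trivs E" "x \<in> U" using triv_exists[OF x] .
  have "vscale E x 0 (vzero E x) = vzero E x"
    by (rule triv_inj[OF T]) (use fib_closed[OF x] trivD[OF T] in auto)
  then show ?thesis using homD(3)[OF x fib_closed(1)[OF x], of 0] by simp
qed

text \<open>The images of single gradients cannot be prescribed. But if the space \<open>S\<close>
  of values that lift over the component missed \<open>cunit i\<close>, a functional would separate
  the two; the gradient built from this very functional has its image in \<open>S\<close>, where the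
  functional vanishes, against \<open>gsec_euler\<close>.\<close>

lemma cunit_lift:
  assumes y: "y \<in> X" and i: "i < r2"
  shows "\<exists>s. holosec s \<and> (\<forall>x. connected_component_of (ctop R) y x \<longrightarrow> \<pi> x (s x) = cunit i)"
proof -
  let ?cc = "connected_component_of (ctop R) y"
  define S where "S = {w. \<exists>s. holosec s \<and> (\<forall>x. ?cc x \<longrightarrow> \<pi> x (s x) = w)}"
  have ccX: "x \<in> X" if "?cc x" for x using connected_component_in_topspace that by metis
  have ccy: "?cc y" using y by (simp add: connected_component_of_refl)
  have sub: "cv.subspace S"
    unfolding cv.subspace_def
  proof (intro conjI ballI allI)
    have "(\<lambda>i. 0) \<in> S" unfolding S_def using holosec_zero pi_zero ccX by blast
    then show "0 \<in> S" by (simp add: zero_fun_def)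
  next
    fix u v assume "u \<in> S" "v \<in> S"
    then obtain s t where s: "holosec s" "\<And>x. ?cc x \<Longrightarrow> \<pi> x (s x) = u" and t: "holosec t" "\<And>x. ?cc x \<Longrightarrow> \<pi> x (t x) = v"
      unfolding S_def by blast
    have "\<pi> x (vadd E x (s x) (t x)) = u + v" if "?cc x" for x
      using homD(2)[OF ccX[OF that] holosecD(1)[OF s(1) ccX[OF that]] holosecD(1)[OF t(1) ccX[OF that]]] s(2)[OF that] t(2)[OF that]
      by (simp add: plus_fun_def)
    then show "u + v \<in> S" unfolding S_def using holosec_add[OF s(1) t(1)] by blast
  next
    fix c u assume "u \<in> S"
    then obtain s where s: "holosec s" "\<And>x. ?cc x \<Longrightarrow> \<pi> x (s x) = u" unfolding S_def by blast
    have "\<pi> x (vscale E x c (s x)) = (\<lambda>i. c * u i)" if "?cc x" for x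
      using homD(3)[OF ccX[OF that] holosecD(1)[OF s(1) ccX[OF that]]] s(2)[OF that] by simp
    then show "(\<lambda>i. c * u i) \<in> S" unfolding S_def using holosec_scale[OF s(1)] by blast
  qed
  have "cunit i \<in> S"
  proof (rule ccontr)
    assume "cunit i \<notin> S"
    then obtain g where g: "Vector_Spaces.linear (\<lambda>c a i. c * a i) (*) g" "g (cunit i) = (1::complex)" "\<And>v. v \<in> S \<Longrightarrow> g v = 0"
      using separating_functional[OF sub] by blast
    define \<mu> where "\<mu> j = g (cunit j)" for j
    have nz: "nz \<mu>" using i g(2) by (auto simp: nz_def \<mu>_def)
    have add: "g (\<lambda>i. a i + b i) = g a + g b" for a b
      using cvc.linear_add[OF g(1), of a b] by (simp add: plus_fun_def)
    have scale: "g (\<lambda>i. c * a i) = c * g a" for c a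
      using cvc.linear_scale[OF g(1), of c a] .
    let ?w = "\<pi> y (gsec \<mu> y)"
    have "?w \<in> S" unfolding S_def using gsec_holosec[OF nz] gsec_component_const[OF nz] by fastforce
    then have "g ?w = 0" by (rule g(3))
    moreover have "?w \<in> Cn r2"
      by (rule homD(1)[OF y holosecD(1)[OF gsec_holosec[OF nz] y]])
    then have "g ?w = (\<Sum>j<r2. ?w j * \<mu> j)"
      unfolding \<mu>_def by (intro linear_on_Cn[of r2 g] add scale)
    ultimately have "(\<Sum>j<r2. \<mu> j * ?w j) = 0" by (simp add: mult.commute)
    then show False using gsec_euler[OF y nz] by simp
  qed
  then show ?thesis by (simp add: S_def)
qed

text \<open>\<open>cunit_lift\<close> works over one component. A base point is chosen in each
  component and the lifts are pasted; components are open, so near every point the result coincides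
  with one holomorphic section.\<close>

lemma global_lift:
  assumes i: "i < r2"
  obtains s where "holosec s" "\<And>x. x \<in> X \<Longrightarrow> \<pi> x (s x) = cunit i"
proof -
  let ?cc = "connected_component_of (ctop R)"
  define rep where "rep x = (SOME y. ?cc x y)" for x
  have rep: "?cc x (rep x)" if "x \<in> X" for x
    unfolding rep_def using someI[of "?cc x" x] that by (simp add: connected_component_of_refl)
  have repX: "rep x \<in> X" if "x \<in> X" for x using connected_component_in_topspace rep[OF that] by metis
  \<comment> \<open>Points of one component have the same predicate \<open>?cc\<close>, so
    \<open>SOME\<close> returns the same base point.\<close>
  have repeq: "rep x = rep y" if "?cc x y" for x y
  proof -
    have "?cc x = ?cc y" using that connected_component_of_eq connected_component_in_topspace by metis
    then show ?thesis by (simp add: rep_def)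
  qed
  define sg where "sg y = (SOME s. holosec s \<and> (\<forall>x. ?cc y x \<longrightarrow> \<pi> x (s x) = cunit i))" for y
  have sg: "holosec (sg y)" "?cc y x \<Longrightarrow> \<pi> x (sg y x) = cunit i" if "y \<in> X" for x y
    using someI_ex[OF cunit_lift[OF that i]] unfolding sg_def by blast+
  define s where "s x = sg (rep x) x" for x
  have "holosec s"
  proof (rule holosecI)
    show "s x \<in> fib E x" if "x \<in> X" for x
      unfolding s_def by (rule holosecD(1)[OF sg(1)[OF repX[OF that]] that])
    fix U \<psi> j assume T: "(U, \<psi>) \<in> trivs E" "j < r"
    show "mfd_holo R U (\<lambda>x. \<psi> x (s x) j)"
    proof (rule mfd_holo_local[OF M])
      fix x assume x: "x \<in> U"
      have xX: "x \<in> X" using trivD(1)[OF T(1) x] .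
      obtain B where B: "openin (ctop R) B" "x \<in> B" "\<And>y. y \<in> B \<Longrightarrow> ?cc x y"
        using component_open[OF xX] by blast
      have o: "openin (ctop R) (B \<inter> U)" using B(1) triv_open[OF T(1)] by blast
      have "mfd_holo R (B \<inter> U) (\<lambda>y. \<psi> y (s y) j)"
      proof (rule mfd_holo_cong[OF M o])
        show "mfd_holo R (B \<inter> U) (\<lambda>y. \<psi> y (sg (rep x) y) j)"
          by (rule mfd_holo_subset[OF holosecD(2)[OF sg(1)[OF repX[OF xX]] T]]) simp
        show "\<psi> y (sg (rep x) y) j = \<psi> y (s y) j" if "y \<in> B \<inter> U" for y
          using repeq[of x y] B(3) that by (simp add: s_def)
      qed
      then show "\<exists>W'. openin (ctop R) W' \<and> x \<in> W' \<and> W' \<subseteq> U \<and> mfd_holo R W' (\<lambda>x. \<psi> x (s x) j)"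
        using o B(2) x by blast
    qed
  qed
  moreover have "\<pi> x (s x) = cunit i" if "x \<in> X" for x
    unfolding s_def using sg(2)[OF repX[OF that]] rep[OF that] by (simp add: connected_component_of_sym)
  ultimately show ?thesis using that by blast
qed

lemma splits: "split_surjection R E \<pi> (trivial_vbundle R r2)"
proof -
  have "\<forall>i. \<exists>s. i < r2 \<longrightarrow> holosec s \<and> (\<forall>x\<in>X. \<pi> x (s x) = cunit i)" using global_lift by metis
  then obtain s where s: "\<And>i. i < r2 \<Longrightarrow> holosec (s i)" "\<And>i x. i < r2 \<Longrightarrow> x \<in> X \<Longrightarrow> \<pi> x (s i x) = cunit i" by metis
  \<comment> \<open>Fibres have only a binary addition, so the linear combination of the lifts with
    coefficients \<open>w m\<close> is built by recursion; \<open>vspsi\<close> and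
    \<open>vspi\<close> convert it to ordinary sums in coordinates.\<close>
  define vs where "vs x w = rec_nat (vzero E x) (\<lambda>m v. vadd E x v (vscale E x (w m) (s m x)))" for x and w :: cvec
  have vs0: "vs x w 0 = vzero E x" and vsS: "vs x w (Suc m) = vadd E x (vs x w m) (vscale E x (w m) (s m x))" for x w m
    by (simp_all add: vs_def)
  have sf: "s i x \<in> fib E x" if "i < r2" "x \<in> X" for i x using holosecD(1)[OF s(1) that(2)] that(1) .
  have vsf: "vs x w m \<in> fib E x" if "x \<in> X" "m \<le> r2" for x w m
    using that(2) by (induction m) (auto simp: vs0 vsS fib_closed[OF that(1)] sf that(1))
  have vspsi: "\<psi> x (vs x w m) j = (\<Sum>i<m. w i * \<psi> x (s i x) j)"
    if "(U, \<psi>) \<in> trivs E" "x \<in> U" "m \<le> r2" for U \<psi> x w m j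
    using that(3)
  proof (induction m)
    case 0 then show ?case using trivD(3)[OF that(1,2)] by (simp add: vs0)
  next
    case (Suc m)
    have xX: "x \<in> X" using trivD(1)[OF that(1,2)] .
    have f: "s m x \<in> fib E x" "vscale E x (w m) (s m x) \<in> fib E x" "vs x w m \<in> fib E x"
      using Suc.prems sf vsf fib_closed(3) xX by auto
    show ?case using Suc trivD(4)[OF that(1,2) f(3,2)] trivD(5)[OF that(1,2) f(1)] by (simp add: vsS)
  qed
  have vspi: "\<pi> x (vs x w m) j = (\<Sum>i<m. w i * cunit i j)" if "x \<in> X" "m \<le> r2" for x w m j
    using that(2)
  proof (induction m)
    case 0 then show ?case using pi_zero[OF that(1)] by (simp add: vs0)
  next
    case (Suc m)
    have f: "s m x \<in> fib E x" "vscale E x (w m) (s m x) \<in> fib E x" "vs x w m \<in> fib E x"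
      using Suc.prems sf vsf fib_closed(3) that(1) by auto
    show ?case using Suc homD(2)[OF that(1) f(3,2)] homD(3)[OF that(1) f(1)] s(2)[of m x] that(1) by (simp add: vsS)
  qed
  define \<sigma> where "\<sigma> x w = vs x w r2" for x w
  have \<sigma>f: "\<sigma> x w \<in> fib E x" if "x \<in> X" for x w unfolding \<sigma>_def by (rule vsf[OF that order_refl])
  have fr: "frame (trivial_vbundle R r2) (\<lambda>x v. v) k x = cunit k" if "k < r2" for k x
    unfolding frame_def using cunit_Cn[OF that]
    by (intro inv_into_f_eq) (auto simp: trivial_vbundle_def inj_on_def)
  have "vbundle_hom R (trivial_vbundle R r2) E \<sigma>"
    unfolding vbundle_hom_def
  proof (rule conjI)
    show "\<forall>x\<in>X. (\<forall>u\<in>fib (trivial_vbundle R r2) x. \<sigma> x u \<in> fib E x) \<and>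
        (\<forall>u\<in>fib (trivial_vbundle R r2) x. \<forall>v\<in>fib (trivial_vbundle R r2) x.
           \<sigma> x (vadd (trivial_vbundle R r2) x u v) = vadd E x (\<sigma> x u) (\<sigma> x v)) \<and>
        (\<forall>c. \<forall>u\<in>fib (trivial_vbundle R r2) x. \<sigma> x (vscale (trivial_vbundle R r2) x c u) = vscale E x c (\<sigma> x u))"
    proof (intro ballI conjI allI)
      fix x assume x: "x \<in> X"
      obtain U \<psi> where T: "(U, \<psi>) \<in> trivs E" "x \<in> U" using triv_exists[OF x] .
      show "\<sigma> x u \<in> fib E x" for u by (rule \<sigma>f[OF x])
      have coords: "\<psi> x (\<sigma> x u) j = (\<Sum>i<r2. u i * \<psi> x (s i x) j)" for u j
        unfolding \<sigma>_def by (rule vspsi[OF T order_refl])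
      show "\<sigma> x (vadd (trivial_vbundle R r2) x u v) = vadd E x (\<sigma> x u) (\<sigma> x v)" for u v
        by (rule triv_inj[OF T \<sigma>f[OF x] fib_closed(2)[OF x \<sigma>f[OF x] \<sigma>f[OF x]]])
           (simp add: fun_eq_iff coords trivD(4)[OF T \<sigma>f[OF x] \<sigma>f[OF x]] trivial_vbundle_def algebra_simps sum.distrib)
      show "\<sigma> x (vscale (trivial_vbundle R r2) x c u) = vscale E x c (\<sigma> x u)" for c u
        by (rule triv_inj[OF T \<sigma>f[OF x] fib_closed(3)[OF x \<sigma>f[OF x]]])
           (simp add: fun_eq_iff coords trivD(5)[OF T \<sigma>f[OF x]] trivial_vbundle_def algebra_simps sum_distrib_left)
    qed
    have "mfd_holo R (X \<inter> U) (\<lambda>x. \<psi> x (\<sigma> x (cunit k)) j)" if T: "(U, \<psi>) \<in> trivs E" and k: "k < r2" and j: "j < r" for U \<psi> k j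
    proof (rule mfd_holo_cong[OF M])
      show "openin (ctop R) (X \<inter> U)" using triv_open[OF T] by blast
      show "mfd_holo R (X \<inter> U) (\<lambda>x. \<psi> x (s k x) j)"
        by (rule mfd_holo_subset[OF holosecD(2)[OF s(1)[OF k] T j]]) simp
      show "\<psi> x (s k x) j = \<psi> x (\<sigma> x (cunit k)) j" if "x \<in> X \<inter> U" for x
        using vspsi[OF T _ order_refl, of x "cunit k" j] that k
        by (simp add: \<sigma>_def cunit_def if_distrib if_distribR cong: if_cong)
    qed
    then show "\<forall>(U, \<psi>)\<in>trivs (trivial_vbundle R r2). \<forall>(U', \<psi>')\<in>trivs E. \<forall>k<vrank (trivial_vbundle R r2). \<forall>j<r.
        mfd_holo R (U \<inter> U') (\<lambda>x. \<psi>' x (\<sigma> x (frame (trivial_vbundle R r2) \<psi> k x)) j)"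
      using fr by (auto simp: trivial_vbundle_def)
  qed
  moreover have "\<pi> x (\<sigma> x w) = w" if x: "x \<in> X" and w: "w \<in> fib (trivial_vbundle R r2) x" for x w
  proof
    fix j
    have "\<pi> x (\<sigma> x w) j = (\<Sum>i<r2. w i * cunit i j)" unfolding \<sigma>_def by (rule vspi[OF x order_refl])
    also have "\<dots> = (if j < r2 then w j else 0)" by (simp add: cunit_def if_distrib cong: if_cong)
    also have "\<dots> = w j" using w by (simp add: trivial_vbundle_def Cn_def)
    finally show "\<pi> x (\<sigma> x w) j = w j" .
  qed
  ultimately show ?thesis unfolding split_surjection_def by blast
qed

end

theorem corollary3p11:
  fixes R :: "'a cmanifold"
    and E :: "('a, 'v) vbundle"
    and r\<^sub>1 r\<^sub>2 :: nat
    and \<iota> :: "'a \<Rightarrow> cvec \<Rightarrow> 'v"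
    and \<pi> :: "'a \<Rightarrow> 'v \<Rightarrow> cvec"
  assumes "complex_manifold R"
    and "compact_space (ctop R)"
    and "H1 R \<noteq> {H1_zero R}"
    and "r\<^sub>1 > 0" and "r\<^sub>2 > 0"
    and "holomorphic_vbundle R E"
    and "short_exact_sequence R (trivial_vbundle R r\<^sub>1) \<iota> E \<pi> (trivial_vbundle R r\<^sub>2)"
    and "\<not> split_surjection R E \<pi> (trivial_vbundle R r\<^sub>2)"
  shows "\<not> semi_positive (proj_bundle R E) (taut_line_bundle E)"
proof
  assume "semi_positive (proj_bundle R E) (taut_line_bundle E)"
  then obtain h where h: "hermitian_metric (proj_bundle R E) (taut_line_bundle E) h"
    and curv: "\<forall>(U, \<psi>)\<in>trivs (taut_line_bundle E). \<forall>(V, \<phi>)\<in>catlas (proj_bundle R E). \<forall>z\<in>\<phi> ` (V \<inter> U). \<forall>\<xi> :: nat \<Rightarrow> complex.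
           0 \<le> Re (\<Sum>j<cdim (proj_bundle R E). \<Sum>k<cdim (proj_bundle R E).
                     chern_curvature (taut_line_bundle E) h \<psi> V \<phi> j k z * \<xi> j * cnj (\<xi> k))"
    unfolding semi_positive_def by blast
  have hom: "vbundle_hom R E (trivial_vbundle R r\<^sub>2) \<pi>"
    using assms(7) by (simp add: short_exact_sequence_def)
  have surj: "\<pi> x ` fib E x = Cn r\<^sub>2" if "x \<in> topspace (ctop R)" for x
    using assms(7) that by (simp add: short_exact_sequence_def trivial_vbundle_def)
  interpret semipos R E h \<pi> r\<^sub>2
    by unfold_locales (fact assms(1) assms(6) h assms(2) curv hom surj)+
  show False using splits assms(8) by blast
qed

end
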